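(* Let $K\subset\mathbb{R}^3$ be a tetrahedron and let $k\ge 1$ be an integer. Then $$\boldsymbol{U}^k(K)=\boldsymbol{N}^k(K)\oplus b_K\boldsymbol{Q}^{k-1}(K),$$ $$\dim \boldsymbol{U}^k(K)=\dim \boldsymbol{N}^k(K)+4\dim \boldsymbol{P}^{k-1}_t(F),$$ where $F$ is any face of $K$. Furthermore, any function $\boldsymbol{u}\in\boldsymbol{U}^k(K)$ is uniquely determined by the following degrees of freedom: 1. $\langle\boldsymbol{u}\cdot\boldsymbol{t}_e,\kappa\rangle_e$ for all $\kappa\in P^{k}(e)$ and all edges $e$ of $K$; 2. $\langle\boldsymbol{u}\times\boldsymbol{n}_F,\boldsymbol{\mu}\rangle_F$ for all $\boldsymbol{\mu}\in\boldsymbol{P}^{k-1}_t(F)$ and all faces $F$ of $K$; 3. $\langle(\nabla\times\boldsymbol{u})\times\boldsymbol{n}_F,\boldsymbol{\chi}\rangle_F$ for all $\boldsymbol{\chi}\in\boldsymbol{P}^{k-1}_t(F)$ and all faces $F$ of $K$; 4. $(\boldsymbol{u},\boldsymbol{\rho})_K$ for all $\boldsymbol{\rho}\in\boldsymbol{P}^{k-2}(K)$.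
   Context: For a simplex $S$ (tetrahedron, face or edge) and an integer $m$, $P^m(S)$ is the space of scalar polynomials on $S$ of degree at most $m$, and $\boldsymbol{P}^m(S)=[P^m(S)]^3$. If $m<0$, conditions or degrees of freedom indexed by these spaces are void. For a face $F$ of $K$ with unit outward normal $\boldsymbol{n}_F$, $\boldsymbol{P}^{m}_t(F)$ denotes the space of tangential vector polynomials $\{\boldsymbol{\mu}\in[P^m(F)]^3:\boldsymbol{\mu}\cdot\boldsymbol{n}_F=0\}$. $\boldsymbol{t}_e$ is a unit tangent vector to the edge $e$. The brackets $(\cdot,\cdot)_K$, $\langle\cdot,\cdot\rangle_F$, $\langle\cdot,\cdot\rangle_e$ are the $L^2$ inner products on $K$, $F$, $e$. For a face $F$ of $K$ let $\lambda_F$ be the barycentric coordinate of $K$ that vanishes on $F$. Set $b_K=\prod_F\lambda_F$ (product over all four faces of $K$) and $b_F=\prod_{G\ne F}\lambda_G$ (product over the other three faces). The local Nédélec space of the first kind is $$\boldsymbol{N}^k(K)=\boldsymbol{P}^{k}(K)+\{\boldsymbol{v}\in\boldsymbol{P}^{k+1}(K):\boldsymbol{v}\cdot\boldsymbol{x}=0\}.$$ For each face $F$, $$\boldsymbol{Q}_F^{k-1}(K)=\{\boldsymbol{q}\times\boldsymbol{n}_F:\boldsymbol{q}\in\boldsymbol{P}^{k-1}(K),\ (\boldsymbol{q}\times\boldsymbol{n}_F,\,b_Kb_F(\boldsymbol{w}\times\boldsymbol{n}_F))_K=0\ \ \forall\boldsymbol{w}\in\boldsymbol{P}^{k-2}(K)\},$$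 and $$\boldsymbol{Q}^{k-1}(K)=\sum_{F}b_F\boldsymbol{Q}_F^{k-1}(K),\qquad \boldsymbol{U}^k(K)=\boldsymbol{N}^k(K)+b_K\boldsymbol{Q}^{k-1}(K).$$ *)

theory Defs
  imports "HOL-Analysis.Analysis" "HOL-Library.Function_Algebras" "HOL-Library.Set_Algebras"
begin

(* Pointwise vector space structure on functions, so that dim and span apply to spaces of
   functions. Zero and addition of functions come from Function_Algebras, sums of spaces
   (binary and indexed) from Set_Algebras. *)
instantiation "fun" :: (type, real_vector) real_vector
begin

definition scaleR_fun :: "real \<Rightarrow> ('a \<Rightarrow> 'b) \<Rightarrow> 'a \<Rightarrow> 'b"
  where "scaleR_fun c f = (\<lambda>x. c *\<^sub>R f x)"

instance
  by standard (simp_all add: scaleR_fun_def fun_eq_iff scaleR_add_right scaleR_add_left)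

end

(* P^m(S). A polynomial on the simplex S is identified with the polynomial function on the
   affine hull of S that extends it (unique, since S has interior relative to its hull); it is
   set to 0 off the hull so that equality in P^m(S) is equality of functions. In particular,
   on a tetrahedron the elements are polynomial functions on all of R^3, while on a face or an
   edge two polynomials in three variables give the same element iff they agree on S.
   The index m is an integer; P^m(S) = {0} for m < 0. *)
definition poly_space :: "int \<Rightarrow> (real^3) set \<Rightarrow> (real^3 \<Rightarrow> real) set"
  where "poly_space m S = {f. \<exists>c :: (3 \<Rightarrow> nat) \<Rightarrow> real.
    f = (\<lambda>x. if x \<in> affine hull S
             then \<Sum>\<alpha> | int (\<Sum>i\<in>UNIV. \<alpha> i) \<le> m. c \<alpha> * (\<Prod>i\<in>UNIV. (x $ i) ^ \<alpha> i)
             else 0)}"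

definition vpoly_space :: "int \<Rightarrow> (real^3) set \<Rightarrow> (real^3 \<Rightarrow> real^3) set"
  where "vpoly_space m S = {u. \<forall>i. (\<lambda>x. u x $ i) \<in> poly_space m S}"

(* Unit outward normal of the tetrahedron K on its face F. The inequality on y in F forces
   orthogonality to F, on y in K it forces the outward direction. *)
definition outward_normal :: "(real^3) set \<Rightarrow> (real^3) set \<Rightarrow> real^3"
  where "outward_normal K F =
    (THE n. norm n = 1 \<and> (\<forall>x\<in>F. \<forall>y\<in>K. n \<bullet> (y - x) \<le> 0))"

definition unit_tangent :: "(real^3) set \<Rightarrow> real^3 \<Rightarrow> bool"
  where "unit_tangent e t \<longleftrightarrow> norm t = 1 \<and> (\<exists>x\<in>e. \<exists>y\<in>e. \<exists>c. t = c *\<^sub>R (y - x))"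

definition tangential_space :: "int \<Rightarrow> (real^3) set \<Rightarrow> (real^3) set \<Rightarrow> (real^3 \<Rightarrow> real^3) set"
  where "tangential_space m K F =
    {\<mu> \<in> vpoly_space m F. \<forall>x\<in>F. \<mu> x \<bullet> outward_normal K F = 0}"

(* The affine function with value 0 on F and 1 at the vertex of K opposite to F. *)
definition bary :: "(real^3) set \<Rightarrow> (real^3) set \<Rightarrow> real^3 \<Rightarrow> real"
  where "bary K F = (THE l. (\<exists>a c. l = (\<lambda>x. a \<bullet> x + c)) \<and> (\<forall>x\<in>F. l x = 0) \<and>
    (\<forall>p. p extreme_point_of K \<and> p \<notin> F \<longrightarrow> l p = 1))"

definition bubble :: "(real^3) set \<Rightarrow> real^3 \<Rightarrow> real"
  where "bubble K x = (\<Prod>F | F facet_of K. bary K F x)"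

definition face_bubble :: "(real^3) set \<Rightarrow> (real^3) set \<Rightarrow> real^3 \<Rightarrow> real"
  where "face_bubble K F x = (\<Prod>G | G facet_of K \<and> G \<noteq> F. bary K G x)"

definition mult_space :: "(real^3 \<Rightarrow> real) \<Rightarrow> (real^3 \<Rightarrow> real^3) set \<Rightarrow> (real^3 \<Rightarrow> real^3) set"
  where "mult_space b V = (\<lambda>v x. b x *\<^sub>R v x) ` V"

(* An isometric parametrisation of the affine hull of S by a Euclidean space 'p, which has to be
   chosen with the dimension of S. Pulling back along it turns surface measure on a face and arc
   length on an edge into Lebesgue measure on real^2 and real; by invariance of Lebesgue measure
   under isometries the integrals do not depend on the choice. *)
definition isometric_chart :: "(real^3) set \<Rightarrow> 'p::euclidean_space \<Rightarrow> real^3"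
  where "isometric_chart S = (SOME \<phi>. (\<forall>x y. dist (\<phi> x) (\<phi> y) = dist x y) \<and> S \<subseteq> range \<phi>)"

definition L2_cell :: "(real^3) set \<Rightarrow> (real^3 \<Rightarrow> 'b::real_inner) \<Rightarrow> (real^3 \<Rightarrow> 'b) \<Rightarrow> real"
  where "L2_cell K u v = (LINT x:K|lborel. u x \<bullet> v x)"

definition L2_face :: "(real^3) set \<Rightarrow> (real^3 \<Rightarrow> 'b::real_inner) \<Rightarrow> (real^3 \<Rightarrow> 'b) \<Rightarrow> real"
  where "L2_face F u v = (let \<phi> = (isometric_chart F :: real^2 \<Rightarrow> real^3) in
    LINT s:(\<phi> -` F)|lborel. u (\<phi> s) \<bullet> v (\<phi> s))"

definition L2_edge :: "(real^3) set \<Rightarrow> (real^3 \<Rightarrow> 'b::real_inner) \<Rightarrow> (real^3 \<Rightarrow> 'b) \<Rightarrow> real"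
  where "L2_edge e u v = (let \<phi> = (isometric_chart e :: real \<Rightarrow> real^3) in
    LINT s:(\<phi> -` e)|lborel. u (\<phi> s) \<bullet> v (\<phi> s))"

definition curl :: "(real^3 \<Rightarrow> real^3) \<Rightarrow> real^3 \<Rightarrow> real^3"
  where "curl u x = (let J = jacobian u (at x) in
    vector [J $ 3 $ 2 - J $ 2 $ 3, J $ 1 $ 3 - J $ 3 $ 1, J $ 2 $ 1 - J $ 1 $ 2])"

definition nedelec :: "int \<Rightarrow> (real^3) set \<Rightarrow> (real^3 \<Rightarrow> real^3) set"
  where "nedelec k K = vpoly_space k K + {v \<in> vpoly_space (k + 1) K. \<forall>x\<in>K. v x \<bullet> x = 0}"

(* Used with m = k - 1, so that the test functions w have degree at most k - 2. *)
definition Q_face :: "int \<Rightarrow> (real^3) set \<Rightarrow> (real^3) set \<Rightarrow> (real^3 \<Rightarrow> real^3) set"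
  where "Q_face m K F = (let n = outward_normal K F in
    {\<lambda>x. cross3 (q x) n | q. q \<in> vpoly_space m K \<and>
      (\<forall>w \<in> vpoly_space (m - 1) K.
        L2_cell K (\<lambda>x. cross3 (q x) n)
          (\<lambda>x. (bubble K x * face_bubble K F x) *\<^sub>R cross3 (w x) n) = 0)})"

definition Q_space :: "int \<Rightarrow> (real^3) set \<Rightarrow> (real^3 \<Rightarrow> real^3) set"
  where "Q_space m K = (\<Sum>F | F facet_of K. mult_space (face_bubble K F) (Q_face m K F))"

definition U_space :: "int \<Rightarrow> (real^3) set \<Rightarrow> (real^3 \<Rightarrow> real^3) set"
  where "U_space k K = nedelec k K + mult_space (bubble K) (Q_space (k - 1) K)"

end

theory Submission
  imports Defs
begin

text \<open>
  The heart of the matter is the injectivity of the degrees of freedom: a field \<open>u = n + b\<^sub>K z\<close>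
  of the enriched space, with \<open>n\<close> in the Nedelec space and \<open>z = \<Sum>\<^sub>F b\<^sub>F q\<^sub>F\<close>, must vanish as
  soon as all its degrees of freedom do. The directness of the sum
  is obtained on the way, and the dimension formula follows once each
  \<open>b\<^sub>F Q\<^sub>F\<close> is seen to be a copy of the tangential polynomials on \<open>F\<close>.

  The bubble \<open>b\<^sub>K\<close> vanishes on the boundary, so the edge and face moments of \<open>u\<close> are those of
  \<open>n\<close>; the orthogonality built into \<open>Q\<^sub>F\<close> says that \<open>b\<^sub>K z\<close> has no moments against
  \<open>P\<^sup>k\<^sup>-\<^sup>2\<close> either. Hence \<open>n\<close> has vanishing Nedelec moments, and \<open>n = 0\<close> by the unisolvence of
  the Nedelec element (\<open>nedelec_zero\<close>). What is left is \<open>u = b\<^sub>K z\<close>. On a face \<open>F\<close> only the gradient of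
  \<open>b\<^sub>K\<close> contributes to the curl, which makes \<open>curl u \<times> n\<^sub>F\<close> a negative multiple of
  \<open>b\<^sub>F\<^sup>2 q\<^sub>F\<close> there (\<open>curl_bubble_trace\<close>). Testing with \<open>q\<^sub>F\<close> itself gives \<open>q\<^sub>F = 0\<close> on \<open>F\<close>, so
  \<open>q\<^sub>F = \<lambda>\<^sub>F p\<close> with \<open>p\<close> of degree \<open>k - 2\<close>, and the orthogonality in \<open>Q\<^sub>F\<close> tested
  with \<open>p\<close> yields \<open>p = 0\<close> (\<open>Q_face_zero\<close>).

  For the Nedelec part, the tangential component along an edge has degree \<open>k\<close> and so is
  orthogonal to itself. On a face, integration by parts shows first that the surface curl of the
  tangential component \<open>u\<^sub>F\<close> is orthogonal to itself; a curl-free Nedelec field has degree \<open>k\<close> only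
  (\<open>curl_free_degree\<close>), so for each edge tangent \<open>t\<close> the product \<open>u\<^sub>F \<bullet> t\<close> has the form
  \<open>\<lambda> \<psi>\<close> with \<open>\<psi>\<close> of degree \<open>k - 1\<close>, and \<open>\<psi> t\<close> is an admissible test field. The
  cell is treated in the same way (\<open>nedelec_2d_zero\<close>, \<open>nedelec_3d_zero\<close>). The
  integration by parts behind these steps is that \<open>div w\<close> has mean zero when \<open>w\<close> is
  tangential to all faces. This holds because the maps \<open>x + t w(x)\<close> send the cell injectively into
  itself for small \<open>t\<close> of either sign, so that the integral of their Jacobian cannot exceed the
  volume, while its derivative at \<open>t = 0\<close> is the integral of \<open>div w\<close>
  (\<open>integral_divergence_invariant_field\<close>).

  For the dimensions, restriction to \<open>F\<close> maps \<open>Q\<^sub>F\<close> bijectively onto the tangential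
  polynomials on \<open>F\<close>: it is injective by the argument above, and surjective because an
  extension can be corrected by some \<open>\<lambda>\<^sub>F p\<close>, where \<open>p\<close> solves a positive definite finite
  dimensional problem (\<open>restr_Q_face\<close>).
\<close>

section \<open>Polynomial functions of bounded degree\<close>

text \<open>Sums of products of affine functions. This presentation is invariant under affine changes of
  variables, and it turns each statement about degrees into an induction with one interesting
  case. For negative \<open>m\<close> only the zero function qualifies, so that indices such as \<open>m - 1\<close>
  and \<open>k - 2\<close> need no case distinctions.\<close>

inductive polyfun :: "int \<Rightarrow> ('a::euclidean_space \<Rightarrow> real) \<Rightarrow> bool" where
  polyfun_zero: "polyfun m (\<lambda>_. 0)"
| polyfun_const: "0 \<le> m \<Longrightarrow> polyfun m (\<lambda>_. c)"
| polyfun_add: "polyfun m f \<Longrightarrow> polyfun m g \<Longrightarrow> polyfun m (\<lambda>x. f x + g x)"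
| polyfun_affine_mult: "linear h \<Longrightarrow> polyfun m f \<Longrightarrow> polyfun (m + 1) (\<lambda>x. (h x + c) * f x)"

lemma polyfun_mono:
  assumes "polyfun m f" "m \<le> n"
  shows "polyfun n f"
  using assms
proof (induction arbitrary: n)
  case (polyfun_affine_mult h m f c)
  then have "polyfun (n - 1) f" by simp
  then show ?case using polyfun.polyfun_affine_mult[OF polyfun_affine_mult.hyps(1), of "n - 1" f c] by simp
qed (auto intro: polyfun.intros)

lemma polyfun_affine:
  assumes "linear h" "1 \<le> m"
  shows "polyfun m (\<lambda>x. h x + c)"
  using polyfun_affine_mult[OF assms(1) polyfun_const[of 0 1], of c] assms(2) polyfun_mono by auto

lemma polyfun_linear:
  assumes "linear h" "1 \<le> m"
  shows "polyfun m h"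
  using polyfun_affine[OF assms, of 0] by simp

lemma polyfun_cmult:
  assumes "polyfun m f"
  shows "polyfun m (\<lambda>x. c * f x)"
  using assms
proof induction
  case (polyfun_add m f g)
  then show ?case by (auto simp: distrib_left intro: polyfun.polyfun_add)
next
  case (polyfun_affine_mult h m f d)
  from polyfun.polyfun_affine_mult[OF polyfun_affine_mult(1,3), of d]
  show ?case by (simp add: mult.left_commute)
qed (auto intro: polyfun.intros)

lemma polyfun_uminus: "polyfun m f \<Longrightarrow> polyfun m (\<lambda>x. - f x)"
  using polyfun_cmult[of m f "-1"] by simp

lemma polyfun_diff: "polyfun m f \<Longrightarrow> polyfun m g \<Longrightarrow> polyfun m (\<lambda>x. f x - g x)"
  using polyfun_add[OF _ polyfun_uminus, of m f g] by simp

lemma polyfun_sum: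
  "(\<And>i. i \<in> I \<Longrightarrow> polyfun m (f i)) \<Longrightarrow> polyfun m (\<lambda>x. \<Sum>i\<in>I. f i x)"
  by (induction I rule: infinite_finite_induct) (auto intro: polyfun.intros)

lemma polyfun_mult:
  assumes "polyfun m f" "polyfun n g"
  shows "polyfun (m + n) (\<lambda>x. f x * g x)"
  using assms
proof induction
  case (polyfun_const m c)
  then show ?case by (auto intro: polyfun_mono[OF polyfun_cmult])
next
  case (polyfun_add m f1 f2)
  then show ?case by (auto simp: distrib_right intro: polyfun.polyfun_add)
next
  case (polyfun_affine_mult h m f d)
  from polyfun.polyfun_affine_mult[OF polyfun_affine_mult(1) polyfun_affine_mult(3)[OF polyfun_affine_mult(4)], of d]
  show ?case by (simp add: algebra_simps)
qed (auto intro: polyfun.intros)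

lemma polyfun_prod:
  "finite I \<Longrightarrow> (\<And>i. i \<in> I \<Longrightarrow> polyfun (m i) (f i)) \<Longrightarrow> polyfun (\<Sum>i\<in>I. m i) (\<lambda>x. \<Prod>i\<in>I. f i x)"
  by (induction I rule: finite_induct) (auto intro: polyfun_mult polyfun.intros)

lemma polyfun_power:
  assumes "polyfun m f"
  shows "polyfun (int n * m) (\<lambda>x. f x ^ n)"
proof (induction n)
  case 0
  show ?case by (simp add: polyfun_const)
next
  case (Suc n)
  have "int (Suc n) * m = m + int n * m" by (simp add: algebra_simps)
  with polyfun_mult[OF assms Suc.IH] show ?case by simp
qed

lemma polyfun_compose_affine:
  fixes A :: "'b::euclidean_space \<Rightarrow> 'a::euclidean_space"
  assumes "polyfun m f" "linear A"
  shows "polyfun m (\<lambda>x. f (A x + b))"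
  using assms(1)
proof induction
  case (polyfun_affine_mult h m f c)
  have "linear (\<lambda>x. h (A x))" using linear_compose[OF assms(2) polyfun_affine_mult(1)] by (simp add: o_def)
  from polyfun.polyfun_affine_mult[OF this polyfun_affine_mult(3), of "h b + c"]
  show ?case by (simp add: linear_add[OF polyfun_affine_mult(1)] add.assoc)
qed (auto intro: polyfun.intros)

lemma polyfun_continuous:
  assumes "polyfun m f"
  shows "continuous_on S f"
  using assms
proof induction
  case (polyfun_affine_mult h m f c)
  then have "continuous_on S h" by (simp add: linear_continuous_on linear_linear)
  with polyfun_affine_mult show ?case by (auto intro!: continuous_intros)
qed (auto intro!: continuous_on_add)

lemma polyfun_derivative:
  assumes "polyfun m f"
  shows "\<exists>G. (\<forall>x. (f has_derivative (\<lambda>d. G d x)) (at x)) \<and> (\<forall>d. polyfun (m - 1) (G d))"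
  using assms
proof induction
  case (polyfun_zero m)
  show ?case by (rule exI[of _ "\<lambda>d x. 0"]) (auto intro: polyfun.intros)
next
  case (polyfun_const m c)
  show ?case by (rule exI[of _ "\<lambda>d x. 0"]) (auto intro: polyfun.intros)
next
  case (polyfun_add m f g)
  then obtain F G where "\<And>x. (f has_derivative (\<lambda>d. F d x)) (at x)" "\<And>d. polyfun (m - 1) (F d)"
    "\<And>x. (g has_derivative (\<lambda>d. G d x)) (at x)" "\<And>d. polyfun (m - 1) (G d)"
    by blast
  then show ?case
    by (intro exI[of _ "\<lambda>d x. F d x + G d x"]) (auto intro!: polyfun.polyfun_add derivative_intros)
next
  case (polyfun_affine_mult h m f c)
  then obtain F where F: "\<And>x. (f has_derivative (\<lambda>d. F d x)) (at x)" "\<And>d. polyfun (m - 1) (F d)"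
    by blast
  have "(h has_derivative h) (at x)" for x
    using polyfun_affine_mult(1) linear_imp_has_derivative by blast
  then have "((\<lambda>x. (h x + c) * f x) has_derivative (\<lambda>d. (h x + c) * F d x + h d * f x)) (at x)" for x
    by (auto intro!: derivative_eq_intros F simp: algebra_simps)
  moreover have "polyfun m (\<lambda>x. (h x + c) * F d x + h d * f x)" for d
    using polyfun.polyfun_affine_mult[OF polyfun_affine_mult(1) F(2)[of d], of c]
    by (intro polyfun.polyfun_add polyfun_cmult polyfun_affine_mult) simp
  ultimately show ?case
    by (intro exI[of _ "\<lambda>d x. (h x + c) * F d x + h d * f x"]) auto
qed

lemma polyfun_has_derivative:
  "polyfun m f \<Longrightarrow> (f has_derivative frechet_derivative f (at x)) (at x)"
  by (meson differentiable_def frechet_derivative_works polyfun_derivative)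

lemma polyfun_directional_derivative:
  assumes "polyfun m f"
  shows "polyfun (m - 1) (\<lambda>x. frechet_derivative f (at x) d)"
proof -
  from polyfun_derivative[OF assms] obtain G where G: "\<And>x. (f has_derivative (\<lambda>d. G d x)) (at x)"
    "\<And>d. polyfun (m - 1) (G d)" by blast
  have "frechet_derivative f (at x) d = G d x" for x
    using fun_cong[OF frechet_derivative_at[OF G(1)[of x]], of d] by simp
  with G(2) show ?thesis by simp
qed

text \<open>Euler's relation \<open>x \<cdot> \<nabla>f = m f\<close> for homogeneous \<open>f\<close> becomes, for an arbitrary
  polynomial, an equality up to terms of lower degree.\<close>

lemma polyfun_euler:
  assumes "polyfun m f"
  shows "polyfun (m - 1) (\<lambda>x. frechet_derivative f (at x) x - of_int m * f x)"
  using assms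
proof induction
  case (polyfun_zero m)
  then show ?case by (auto intro: polyfun.intros simp: frechet_derivative_const)
next
  case (polyfun_const m c)
  then show ?case
    by (cases "m = 0") (auto intro: polyfun.intros simp: frechet_derivative_const)
next
  case (polyfun_add m f g)
  have "frechet_derivative (\<lambda>x. f x + g x) (at x)
    = (\<lambda>d. frechet_derivative f (at x) d + frechet_derivative g (at x) d)" for x
    by (rule frechet_derivative_at[symmetric])
      (auto intro!: derivative_intros polyfun_has_derivative polyfun_add)
  then show ?case
    using polyfun.polyfun_add[OF polyfun_add(3,4)] by (simp add: algebra_simps)
next
  case (polyfun_affine_mult h m f c)
  have "(h has_derivative h) (at x)" for x
    using polyfun_affine_mult(1) linear_imp_has_derivative by blast
  moreover have "(f has_derivative frechet_derivative f (at x)) (at x)" for x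
    by (rule polyfun_has_derivative[OF polyfun_affine_mult(2)])
  ultimately have "((\<lambda>x. (h x + c) * f x) has_derivative
      (\<lambda>d. (h x + c) * frechet_derivative f (at x) d + h d * f x)) (at x)" for x
    by (auto intro!: derivative_eq_intros simp: algebra_simps)
  from frechet_derivative_at[OF this]
  have eq: "frechet_derivative (\<lambda>x. (h x + c) * f x) (at x) x - of_int (m + 1) * ((h x + c) * f x)
      = (h x + c) * (frechet_derivative f (at x) x - of_int m * f x) + (- c) * f x" for x
    by (simp add: algebra_simps fun_eq_iff)
  have "polyfun m (\<lambda>x. (h x + c) * (frechet_derivative f (at x) x - of_int m * f x) + (- c) * f x)"
    using polyfun.polyfun_affine_mult[OF polyfun_affine_mult(1,3), of c]
    by (intro polyfun.polyfun_add polyfun_cmult polyfun_affine_mult) simp_all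
  with eq show ?case by simp
qed

text \<open>The substitution \<open>x - l(x) d\<close> projects onto the hyperplane \<open>l = 0\<close>, so what remains of
  \<open>f\<close> after subtracting its values there is divisible by \<open>l\<close>.\<close>

lemma polyfun_divide_projection:
  assumes "polyfun m f" "linear h" "h d = 1"
  shows "\<exists>g. polyfun (m - 1) g \<and> (\<forall>x. f x - f (x - (h x + c) *\<^sub>R d) = (h x + c) * g x)"
  using assms(1)
proof induction
  case (polyfun_zero m)
  show ?case by (rule exI[of _ "\<lambda>x. 0"]) (auto intro: polyfun.intros)
next
  case (polyfun_const m c)
  show ?case by (rule exI[of _ "\<lambda>x. 0"]) (auto intro: polyfun.intros)
next
  case (polyfun_add m f1 f2)
  then obtain g1 g2 where "polyfun (m - 1) g1" "polyfun (m - 1) g2"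
    "\<And>x. f1 x - f1 (x - (h x + c) *\<^sub>R d) = (h x + c) * g1 x"
    "\<And>x. f2 x - f2 (x - (h x + c) *\<^sub>R d) = (h x + c) * g2 x" by blast
  note g = this
  have "f1 x + f2 x - (f1 y + f2 y) = (h x + c) * (g1 x + g2 x)"
    if "y = x - (h x + c) *\<^sub>R d" for x y
    using g(3)[of x] g(4)[of x] unfolding that distrib_left by linarith
  with polyfun.polyfun_add[OF g(1,2)] show ?case by blast
next
  case (polyfun_affine_mult a m f b)
  then obtain g where g: "polyfun (m - 1) g"
    "\<And>x. f x - f (x - (h x + c) *\<^sub>R d) = (h x + c) * g x" by blast
  interpret a: linear a by fact
  let ?p = "\<lambda>x. x - (h x + c) *\<^sub>R d"
  have "linear (\<lambda>x. x - h x *\<^sub>R d)"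
    using assms(2) by (auto intro!: linearI simp: linear_add linear_scale algebra_simps)
  from polyfun_compose_affine[OF polyfun_affine_mult(2) this, of "- c *\<^sub>R d"]
  have "polyfun m (\<lambda>x. f (?p x))" by (simp add: algebra_simps)
  moreover have "polyfun m (\<lambda>x. (a x + b) * g x)"
    using polyfun.polyfun_affine_mult[OF polyfun_affine_mult(1) g(1), of b] by simp
  ultimately have "polyfun m (\<lambda>x. (a x + b) * g x + a d * f (?p x))"
    by (intro polyfun.polyfun_add polyfun_cmult)
  moreover have "(a x + b) * f x - (a (?p x) + b) * f (?p x)
      = (h x + c) * ((a x + b) * g x + a d * f (?p x))" for x
  proof -
    have "(a x + b) * f x - (a (?p x) + b) * f (?p x)
        = (a x + b) * (f x - f (?p x)) + (a x - a (?p x)) * f (?p x)"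
      by (simp add: algebra_simps)
    also have "a x - a (?p x) = (h x + c) * a d" by (simp add: a.diff a.scale)
    finally show ?thesis using g(2)[of x] by (simp add: algebra_simps)
  qed
  ultimately show ?case by (intro exI[of _ "\<lambda>x. (a x + b) * g x + a d * f (?p x)"]) simp
qed

lemma polyfun_divide:
  assumes "polyfun m f" "linear h" "h e \<noteq> 0" and z: "\<And>x. h x + c = 0 \<Longrightarrow> f x = 0"
  shows "\<exists>g. polyfun (m - 1) g \<and> (\<forall>x. f x = (h x + c) * g x)"
proof -
  let ?d = "(1 / h e) *\<^sub>R e"
  have d: "h ?d = 1" using assms by (simp add: linear_scale)
  have "f (x - (h x + c) *\<^sub>R ?d) = 0" for x
    by (rule z) (use assms(3) in \<open>simp add: linear_diff[OF assms(2)] linear_scale[OF assms(2)]\<close>)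
  with polyfun_divide_projection[OF assms(1,2) d, of c] show ?thesis by simp
qed

lemma polyfun_on_line:
  fixes x d :: "'a::euclidean_space"
  assumes "polyfun m f"
  shows "\<exists>p. \<forall>t. f (x + t *\<^sub>R d) = poly p t"
  using assms
proof induction
  case (polyfun_zero m)
  show ?case by (rule exI[of _ 0]) simp
next
  case (polyfun_const m c)
  show ?case by (rule exI[of _ "[:c:]"]) simp
next
  case (polyfun_add m f g)
  then obtain p q where "\<And>t. f (x + t *\<^sub>R d) = poly p t" "\<And>t. g (x + t *\<^sub>R d) = poly q t" by blast
  then show ?case by (intro exI[of _ "p + q"]) simp
next
  case (polyfun_affine_mult h m f c)
  then obtain p where "\<And>t. f (x + t *\<^sub>R d) = poly p t" by blast
  then show ?case
    by (intro exI[of _ "[:h x + c, h d:] * p"])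
      (simp add: linear_add[OF polyfun_affine_mult(1)] linear_scale[OF polyfun_affine_mult(1)] algebra_simps)
qed

text \<open>Each line through a point of \<open>U\<close> meets \<open>U\<close> in an interval, on which the univariate polynomial
  obtained by restriction has infinitely many roots.\<close>

lemma polyfun_zero_on_open:
  assumes f: "polyfun m f" and U: "open U" "U \<noteq> {}" and z: "\<And>x. x \<in> U \<Longrightarrow> f x = 0"
  shows "f x = 0"
proof -
  obtain y where y: "y \<in> U" using U by blast
  then obtain e where e: "e > 0" "ball y e \<subseteq> U" using U openE by blast
  let ?d = "x - y"
  obtain p where p: "\<And>t. f (y + t *\<^sub>R ?d) = poly p t" using polyfun_on_line[OF f] by blast
  define r where "r = e / (norm ?d + 1)"
  have r: "r > 0" using e(1) by (simp add: r_def add_nonneg_pos)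
  have "poly p t = 0" if "t \<in> {0..<r}" for t
  proof -
    have "dist y (y + t *\<^sub>R ?d) = t * norm ?d" using that by (simp add: dist_norm)
    also have "\<dots> \<le> t * (norm ?d + 1)" using that by (simp add: mult_left_mono)
    also have "\<dots> < r * (norm ?d + 1)" using that by (intro mult_strict_right_mono) (auto intro: add_nonneg_pos)
    also have "\<dots> = e" by (simp add: r_def add_nonneg_eq_0_iff)
    finally have "y + t *\<^sub>R ?d \<in> U" using e(2) by auto
    then show ?thesis using z p by metis
  qed
  then have "{0..<r} \<subseteq> {t. poly p t = 0}" by blast
  moreover have "infinite {0..<r}" using r by (simp add: infinite_Ico)
  ultimately have "p = 0" using poly_roots_finite finite_subset by blast
  with p[of 1] show ?thesis by simp
qed

text \<open>Near a point where \<open>f\<close> does not vanish, \<open>g\<close> is zero.\<close>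

lemma polyfun_mult_eq_0:
  assumes f: "polyfun m f" and g: "polyfun n g" and z: "\<And>x. f x * g x = 0" and "f y \<noteq> 0"
  shows "g x = 0"
proof (rule polyfun_zero_on_open[OF g])
  have "continuous_on UNIV f" by (rule polyfun_continuous[OF f])
  then show "open (f -` (- {0}))" by (intro open_vimage) auto
  show "f -` (- {0}) \<noteq> {}" using assms(4) by auto
  show "\<And>x. x \<in> f -` (- {0}) \<Longrightarrow> g x = 0" using z by auto
qed

section \<open>The spaces of polynomials on a simplex\<close>

definition vpolyfun :: "int \<Rightarrow> ('a::euclidean_space \<Rightarrow> 'b::euclidean_space) \<Rightarrow> bool"
  where "vpolyfun m u \<longleftrightarrow> (\<forall>d. polyfun m (\<lambda>x. u x \<bullet> d))"

text \<open>Elements of \<^const>\<open>poly_space\<close> are cut off outside the affine hull of \<open>S\<close>.\<close>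

definition restr :: "'a::real_vector set \<Rightarrow> ('a \<Rightarrow> 'b::real_vector) \<Rightarrow> 'a \<Rightarrow> 'b"
  where "restr S f = (\<lambda>x. if x \<in> affine hull S then f x else 0)"

text \<open>The function spaces are subspaces of an infinite dimensional space, where \<^const>\<open>dim\<close> is
  meaningful only for subspaces that are contained in the span of a finite set.\<close>

definition fin_dim :: "'v::real_vector set \<Rightarrow> bool"
  where "fin_dim V \<longleftrightarrow> (\<exists>B. finite B \<and> V \<subseteq> span B)"

lemma scaleR_fun_apply [simp]: "(c *\<^sub>R f) x = c *\<^sub>R f x"
  by (simp add: scaleR_fun_def)

lemma sum_fun_apply [simp]: "(\<Sum>i\<in>I. f i) x = (\<Sum>i\<in>I. f i x)"
  by (induction I rule: infinite_finite_induct) (auto simp: zero_fun_def plus_fun_def)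

lemma fin_dim_subset: "fin_dim V \<Longrightarrow> W \<subseteq> V \<Longrightarrow> fin_dim W"
  unfolding fin_dim_def by blast

lemma fin_dim_linear_image:
  assumes "linear L" "fin_dim V"
  shows "fin_dim (L ` V)"
proof -
  obtain B where "finite B" "V \<subseteq> span B" using assms(2) by (auto simp: fin_dim_def)
  then have "finite (L ` B)" "L ` V \<subseteq> span (L ` B)"
    using linear_span_image[OF assms(1), of B] by auto
  then show ?thesis unfolding fin_dim_def by blast
qed

lemma fin_dim_set_plus:
  assumes "fin_dim V" "fin_dim W"
  shows "fin_dim (V + W)"
proof -
  obtain A B where AB: "finite A" "V \<subseteq> span A" "finite B" "W \<subseteq> span B"
    using assms by (auto simp: fin_dim_def)
  have "V + W \<subseteq> span (A \<union> B)"
  proof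
    fix x assume "x \<in> V + W"
    then obtain v w where "x = v + w" "v \<in> V" "w \<in> W" by (auto elim: set_plus_elim)
    moreover have "span A \<subseteq> span (A \<union> B)" "span B \<subseteq> span (A \<union> B)" by (auto intro!: span_mono)
    ultimately show "x \<in> span (A \<union> B)" using AB by (auto intro!: span_add)
  qed
  then show ?thesis unfolding fin_dim_def using AB by (intro exI[of _ "A \<union> B"]) auto
qed

lemma fin_dim_sum:
  fixes V :: "'i \<Rightarrow> 'v::real_vector set"
  assumes "finite I" "\<And>i. i \<in> I \<Longrightarrow> fin_dim (V i)"
  shows "fin_dim (\<Sum>i\<in>I. V i)"
  using assms
proof (induction I rule: finite_induct)
  case empty
  have "fin_dim {0 :: 'v}" unfolding fin_dim_def by (intro exI[of _ "{}"]) auto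
  then show ?case by (simp add: set_zero)
qed (auto intro: fin_dim_set_plus)

section \<open>Monomials\<close>

definition monomial :: "(3 \<Rightarrow> nat) \<Rightarrow> real^3 \<Rightarrow> real"
  where "monomial \<alpha> x = (\<Prod>i\<in>UNIV. (x $ i) ^ \<alpha> i)"

lemma finite_exponents: "finite {\<alpha> :: 3 \<Rightarrow> nat. int (\<Sum>i\<in>UNIV. \<alpha> i) \<le> m}"
proof (rule finite_subset)
  show "{\<alpha> :: 3 \<Rightarrow> nat. int (\<Sum>i\<in>UNIV. \<alpha> i) \<le> m} \<subseteq> UNIV \<rightarrow>\<^sub>E {..nat m}"
  proof
    fix \<alpha> :: "3 \<Rightarrow> nat" assume "\<alpha> \<in> {\<alpha>. int (\<Sum>i\<in>UNIV. \<alpha> i) \<le> m}"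
    then have m: "int (\<Sum>i\<in>UNIV. \<alpha> i) \<le> m" by blast
    define s where "s = (\<Sum>i\<in>UNIV. \<alpha> i)"
    have "\<alpha> i \<le> s" for i unfolding s_def by (rule member_le_sum) auto
    moreover have "s \<le> nat m" using m unfolding s_def[symmetric] by linarith
    ultimately have "\<alpha> i \<le> nat m" for i using le_trans by blast
    then show "\<alpha> \<in> UNIV \<rightarrow>\<^sub>E {..nat m}" by auto
  qed
qed (auto intro: finite_PiE)

lemma polyfun_monomial: "polyfun (int (\<Sum>i\<in>UNIV. \<alpha> i)) (monomial \<alpha>)"
proof -
  have "linear (\<lambda>x::real^3. x $ i)" for i
    by (auto intro!: linearI)
  then have "polyfun (int (\<alpha> i)) (\<lambda>x::real^3. (x $ i) ^ \<alpha> i)" for i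
    using polyfun_power[OF polyfun_linear, of "\<lambda>x. x $ i" 1 "\<alpha> i"] by simp
  then show ?thesis unfolding monomial_def of_nat_sum by (intro polyfun_prod) auto
qed

text \<open>Multiplication by a coordinate is linear and sends monomials to monomials of degree one higher,
  which is what the inductive rule for affine factors requires.\<close>

lemma polyfun_span_monomials:
  assumes "polyfun m f"
  shows "f \<in> span (monomial ` {\<alpha>. int (\<Sum>i\<in>UNIV. \<alpha> i) \<le> m})"
  using assms
proof induction
  case (polyfun_zero m)
  show ?case using span_zero[of "monomial ` {\<alpha>. int (\<Sum>i\<in>UNIV. \<alpha> i) \<le> m}"] unfolding zero_fun_def .
next
  case (polyfun_const m c)
  then have "monomial (\<lambda>_. 0) \<in> monomial ` {\<alpha>. int (\<Sum>i\<in>UNIV. \<alpha> i) \<le> m}" by auto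
  then have "c *\<^sub>R monomial (\<lambda>_. 0) \<in> span (monomial ` {\<alpha>. int (\<Sum>i\<in>UNIV. \<alpha> i) \<le> m})"
    by (intro span_scale span_base)
  moreover have "c *\<^sub>R monomial (\<lambda>_. 0) = (\<lambda>_. c)" by (auto simp: monomial_def)
  ultimately show ?case by simp
next
  case (polyfun_add m f g)
  from span_add[OF polyfun_add(3,4)] show ?case by (simp add: plus_fun_def)
next
  case (polyfun_affine_mult h m f c)
  let ?M = "\<lambda>m. span (monomial ` {\<alpha>. int (\<Sum>i\<in>UNIV. \<alpha> i) \<le> m})"
  have coord: "(\<lambda>x. x $ i * f x) \<in> ?M (m + 1)" for i
  proof -
    let ?L = "\<lambda>f x. x $ i * f x :: real"
    have "linear (?L :: (real^3 \<Rightarrow> real) \<Rightarrow> _)"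
      by (rule linearI) (auto simp: fun_eq_iff distrib_left)
    then have "?L f \<in> span (?L ` monomial ` {\<alpha>. int (\<Sum>i\<in>UNIV. \<alpha> i) \<le> m})"
      using polyfun_affine_mult(3) linear_span_image by blast
    also have "\<dots> \<subseteq> ?M (m + 1)"
    proof (intro span_mono image_subsetI, elim imageE)
      fix g \<alpha> assume \<alpha>: "g = monomial \<alpha>" "\<alpha> \<in> {\<alpha>. int (\<Sum>i\<in>UNIV. \<alpha> i) \<le> m}"
      define \<beta> where "\<beta> j = \<alpha> j + (if j = i then 1 else 0)" for j
      have "(\<Sum>j\<in>UNIV. \<beta> j) = (\<Sum>j\<in>UNIV. \<alpha> j) + 1"
        by (simp add: \<beta>_def sum.distrib)
      with \<alpha>(2) have "monomial \<beta> \<in> monomial ` {\<alpha>. int (\<Sum>i\<in>UNIV. \<alpha> i) \<le> m + 1}"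
        by (intro imageI) (simp del: of_nat_sum)
      moreover have "monomial \<beta> = ?L g"
      proof
        fix x :: "real^3"
        have "x $ j ^ (if j = i then 1 else 0) = (if j = i then x $ i else 1)" for j by auto
        then show "monomial \<beta> x = ?L g x"
          by (simp add: monomial_def \<beta>_def \<alpha>(1) power_add prod.distrib mult.commute)
      qed
      ultimately show "?L g \<in> monomial ` {\<alpha>. int (\<Sum>i\<in>UNIV. \<alpha> i) \<le> m + 1}" by simp
    qed
    finally show ?thesis .
  qed
  have sub: "?M m \<subseteq> ?M (m + 1)" by (intro span_mono) auto
  have h: "h x = (\<Sum>i\<in>UNIV. h (axis i 1) * x $ i)" for x
  proof -
    have "h x = h (\<Sum>i\<in>UNIV. x $ i *\<^sub>R axis i 1)" by (simp add: basis_expansion flip: scalar_mult_eq_scaleR)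
    also have "\<dots> = (\<Sum>i\<in>UNIV. h (axis i 1) * x $ i)"
      using polyfun_affine_mult(1) by (simp add: linear_sum linear_scale mult.commute)
    finally show ?thesis .
  qed
  have "(\<lambda>x. (h x + c) * f x) = (\<Sum>i\<in>UNIV. h (axis i 1) *\<^sub>R (\<lambda>x. x $ i * f x)) + c *\<^sub>R f"
    by (intro ext, subst h) (simp add: plus_fun_def distrib_right sum_distrib_right mult.assoc)
  moreover have "\<dots> \<in> ?M (m + 1)"
    using coord sub polyfun_affine_mult(3) by (intro span_add span_sum span_scale) auto
  ultimately show ?case by simp
qed

lemma polyfun_iff_monomials:
  fixes f :: "real^3 \<Rightarrow> real"
  shows "polyfun m f \<longleftrightarrow> (\<exists>c. f = (\<lambda>x. \<Sum>\<alpha> | int (\<Sum>i\<in>UNIV. \<alpha> i) \<le> m. c \<alpha> * (\<Prod>i\<in>UNIV. (x $ i) ^ \<alpha> i)))"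
    (is "_ \<longleftrightarrow> (\<exists>c. f = ?p c)")
proof
  assume "polyfun m f"
  then have "f \<in> span (monomial ` {\<alpha>. int (\<Sum>i\<in>UNIV. \<alpha> i) \<le> m})" by (rule polyfun_span_monomials)
  also have "\<dots> \<subseteq> range ?p"
  proof (rule span_minimal)
    show "monomial ` {\<alpha>. int (\<Sum>i\<in>UNIV. \<alpha> i) \<le> m} \<subseteq> range ?p"
    proof clarify
      fix \<alpha> :: "3 \<Rightarrow> nat" assume "int (\<Sum>i\<in>UNIV. \<alpha> i) \<le> m"
      then have "?p (\<lambda>\<beta>. if \<beta> = \<alpha> then 1 else 0) = monomial \<alpha>"
        by (intro ext, subst sum.remove[OF finite_exponents, of \<alpha>]) (auto simp: monomial_def intro!: sum.neutral)
      note this[symmetric]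
      then show "monomial \<alpha> \<in> range ?p" by (rule range_eqI[where x = "\<lambda>\<beta>. if \<beta> = \<alpha> then 1 else 0"])
    qed
    show "subspace (range ?p)"
      unfolding subspace_def
    proof (intro conjI allI ballI)
      show "0 \<in> range ?p" by (rule range_eqI[of _ _ "\<lambda>_. 0"]) (simp add: zero_fun_def)
    next
      fix f g assume "f \<in> range ?p" "g \<in> range ?p"
      then obtain a b where "f = ?p a" "g = ?p b" by blast
      then show "f + g \<in> range ?p"
        by (intro range_eqI[of _ _ "\<lambda>\<alpha>. a \<alpha> + b \<alpha>"]) (simp add: plus_fun_def distrib_right sum.distrib)
    next
      fix r f assume "f \<in> range ?p"
      then obtain a where "f = ?p a" by blast
      then show "r *\<^sub>R f \<in> range ?p"
        by (intro range_eqI[of _ _ "\<lambda>\<alpha>. r * a \<alpha>"]) (simp add: scaleR_fun_def sum_distrib_left mult.assoc)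
    qed
  qed
  finally show "\<exists>c. f = ?p c" by blast
next
  assume "\<exists>c. f = ?p c"
  then obtain c where c: "f = ?p c" by blast
  show "polyfun m f"
    unfolding c monomial_def[symmetric]
    by (intro polyfun_sum polyfun_cmult) (auto intro: polyfun_mono[OF polyfun_monomial])
qed

lemma poly_space_eq: "poly_space m S = restr S ` {f. polyfun m f}"
proof (intro equalityI subsetI)
  fix f assume "f \<in> poly_space m S"
  then obtain c :: "(3 \<Rightarrow> nat) \<Rightarrow> real" where "f = restr S
    (\<lambda>x. \<Sum>\<alpha> | int (\<Sum>i\<in>UNIV. \<alpha> i) \<le> m. c \<alpha> * (\<Prod>i\<in>UNIV. (x $ i) ^ \<alpha> i))"
    unfolding poly_space_def restr_def mem_Collect_eq by (elim exE)
  moreover have "polyfun m (\<lambda>x. \<Sum>\<alpha> | int (\<Sum>i\<in>UNIV. \<alpha> i) \<le> m. c \<alpha> * (\<Prod>i\<in>UNIV. (x $ i) ^ \<alpha> i))"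
    unfolding polyfun_iff_monomials by (rule exI[of _ c]) (rule refl)
  ultimately show "f \<in> restr S ` {f. polyfun m f}" by (intro image_eqI CollectI)
next
  fix f assume "f \<in> restr S ` {f. polyfun m f}"
  then obtain g where g: "polyfun m g" "f = restr S g" by (elim imageE CollectE)
  from g(1) obtain c where c: "g = (\<lambda>x. \<Sum>\<alpha> | int (\<Sum>i\<in>UNIV. \<alpha> i) \<le> m. c \<alpha> * (\<Prod>i\<in>UNIV. (x $ i) ^ \<alpha> i))"
    unfolding polyfun_iff_monomials by (elim exE)
  show "f \<in> poly_space m S"
    unfolding poly_space_def g(2) c restr_def mem_Collect_eq by (rule exI[of _ c]) (rule refl)
qed

section \<open>Vector-valued polynomials\<close>

lemma vpolyfunD: "vpolyfun m u \<Longrightarrow> polyfun m (\<lambda>x. u x \<bullet> d)"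
  by (simp add: vpolyfun_def)

lemma vpolyfun_nth: "vpolyfun m u \<Longrightarrow> polyfun m (\<lambda>x. u x $ i)"
  using vpolyfunD[of m u "axis i 1"] by (simp add: inner_axis)

lemma vpolyfun_BasisI:
  assumes "\<And>b. b \<in> Basis \<Longrightarrow> polyfun m (\<lambda>x. u x \<bullet> b)"
  shows "vpolyfun m u"
  unfolding vpolyfun_def
proof
  fix d
  have "polyfun m (\<lambda>x. \<Sum>b\<in>Basis. (d \<bullet> b) * (u x \<bullet> b))"
    using assms by (intro polyfun_sum polyfun_cmult)
  moreover have "u x \<bullet> d = (\<Sum>b\<in>Basis. (d \<bullet> b) * (u x \<bullet> b))" for x
    by (subst euclidean_inner) (simp add: mult.commute)
  ultimately show "polyfun m (\<lambda>x. u x \<bullet> d)" by simp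
qed

lemma vpolyfun_nthI:
  fixes u :: "'a::euclidean_space \<Rightarrow> real^'n"
  assumes "\<And>i. polyfun m (\<lambda>x. u x $ i)"
  shows "vpolyfun m u"
  using assms by (intro vpolyfun_BasisI) (auto simp: Basis_vec_def inner_axis)

lemma vpolyfun_mono: "vpolyfun m u \<Longrightarrow> m \<le> n \<Longrightarrow> vpolyfun n u"
  unfolding vpolyfun_def using polyfun_mono by blast

lemma vpolyfun_zero: "vpolyfun m (\<lambda>_. 0)"
  by (simp add: vpolyfun_def polyfun_zero)

lemma vpolyfun_add: "vpolyfun m u \<Longrightarrow> vpolyfun m v \<Longrightarrow> vpolyfun m (\<lambda>x. u x + v x)"
  by (simp add: vpolyfun_def inner_add_left polyfun_add)

lemma vpolyfun_diff: "vpolyfun m u \<Longrightarrow> vpolyfun m v \<Longrightarrow> vpolyfun m (\<lambda>x. u x - v x)"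
  by (simp add: vpolyfun_def inner_diff_left polyfun_diff)

lemma vpolyfun_cmult: "vpolyfun m u \<Longrightarrow> vpolyfun m (\<lambda>x. c *\<^sub>R u x)"
  by (simp add: vpolyfun_def polyfun_cmult)

lemma vpolyfun_scaleR: "polyfun m f \<Longrightarrow> vpolyfun n u \<Longrightarrow> vpolyfun (m + n) (\<lambda>x. f x *\<^sub>R u x)"
  by (simp add: vpolyfun_def polyfun_mult)

lemma vpolyfun_scaleR_const: "polyfun m f \<Longrightarrow> vpolyfun m (\<lambda>x. f x *\<^sub>R a)"
  unfolding vpolyfun_def using polyfun_cmult[of m f "a \<bullet> _"] by (simp add: mult.commute)

lemma vpolyfun_sum:
  "(\<And>i. i \<in> I \<Longrightarrow> vpolyfun m (f i)) \<Longrightarrow> vpolyfun m (\<lambda>x. \<Sum>i\<in>I. f i x)"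
  by (induction I rule: infinite_finite_induct) (auto intro: vpolyfun_add vpolyfun_zero)

lemma vpolyfun_compose_linear:
  assumes "vpolyfun m u" "linear L"
  shows "vpolyfun m (\<lambda>x. L (u x))"
  unfolding vpolyfun_def
proof
  fix d
  have "L (u x) \<bullet> d = u x \<bullet> adjoint L d" for x by (rule adjoint_works[OF assms(2), symmetric])
  then show "polyfun m (\<lambda>x. L (u x) \<bullet> d)" using vpolyfunD[OF assms(1)] by simp
qed

lemma vpolyfun_compose_affine:
  "vpolyfun m u \<Longrightarrow> linear A \<Longrightarrow> vpolyfun m (\<lambda>x. u (A x + b))"
  unfolding vpolyfun_def using polyfun_compose_affine[of m _ A b] by blast

lemma vpolyfun_continuous:
  assumes "vpolyfun m u"
  shows "continuous_on S u"
proof -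
  have "continuous_on S (\<lambda>x. \<Sum>b\<in>Basis. (u x \<bullet> b) *\<^sub>R b)"
    by (intro continuous_on_sum continuous_on_scaleR continuous_on_const
        polyfun_continuous[OF vpolyfunD[OF assms]])
  then show ?thesis by (simp add: euclidean_representation)
qed

lemma vpolyfun_inner:
  assumes "vpolyfun m u" "vpolyfun n v"
  shows "polyfun (m + n) (\<lambda>x. u x \<bullet> v x)"
proof -
  have "polyfun (m + n) (\<lambda>x. \<Sum>b\<in>Basis. (u x \<bullet> b) * (v x \<bullet> b))"
    by (rule polyfun_sum, rule polyfun_mult) (simp_all add: assms vpolyfunD)
  then show ?thesis by (simp add: euclidean_inner[symmetric])
qed

lemma vpolyfun_zero_on_open:
  assumes "vpolyfun m u" "open U" "U \<noteq> {}" "\<And>x. x \<in> U \<Longrightarrow> u x = 0"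
  shows "u x = 0"
  using polyfun_zero_on_open[OF vpolyfunD[OF assms(1)] assms(2,3), of "u x" x] assms(4) by simp

lemma vpolyfun_divide:
  assumes "vpolyfun m u" "linear h" "h e \<noteq> 0" and z: "\<And>x. h x + c = 0 \<Longrightarrow> u x = 0"
  shows "\<exists>v. vpolyfun (m - 1) v \<and> (\<forall>x. u x = (h x + c) *\<^sub>R v x)"
proof -
  have "\<exists>g. polyfun (m - 1) g \<and> (\<forall>x. u x \<bullet> b = (h x + c) * g x)" for b
    using polyfun_divide[OF vpolyfunD[OF assms(1)] assms(2,3)] z by simp
  then obtain g where g: "\<And>b. polyfun (m - 1) (g b)" "\<And>b x. u x \<bullet> b = (h x + c) * g b x" by metis
  have "vpolyfun (m - 1) (\<lambda>x. \<Sum>b\<in>Basis. g b x *\<^sub>R b)"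
    using g(1) by (intro vpolyfun_sum vpolyfun_scaleR_const)
  moreover have "u x = (h x + c) *\<^sub>R (\<Sum>b\<in>Basis. g b x *\<^sub>R b)" for x
  proof -
    have "u x = (\<Sum>b\<in>Basis. (u x \<bullet> b) *\<^sub>R b)" by (rule euclidean_representation[symmetric])
    also have "\<dots> = (h x + c) *\<^sub>R (\<Sum>b\<in>Basis. g b x *\<^sub>R b)"
      unfolding g(2) scaleR_sum_right scaleR_scaleR ..
    finally show ?thesis .
  qed
  ultimately show ?thesis by blast
qed

lemma vpoly_space_eq: "vpoly_space m S = restr S ` {u. vpolyfun m u}"
proof (intro equalityI subsetI)
  fix u assume "u \<in> vpoly_space m S"
  then have "\<forall>i. \<exists>f. polyfun m f \<and> (\<lambda>x. u x $ i) = restr S f"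
    by (auto simp: vpoly_space_def poly_space_eq)
  then obtain f where f: "\<And>i. polyfun m (f i)" "\<And>i. (\<lambda>x. u x $ i) = restr S (f i)" by metis
  have "vpolyfun m (\<lambda>x. \<chi> i. f i x)" by (rule vpolyfun_nthI) (simp add: f)
  moreover have "u x $ i = restr S (f i) x" for x i using fun_cong[OF f(2)] by simp
  then have "u = restr S (\<lambda>x. \<chi> i. f i x)"
    by (intro ext) (simp add: restr_def vec_eq_iff)
  ultimately show "u \<in> restr S ` {u. vpolyfun m u}" by blast
next
  fix u :: "real^3 \<Rightarrow> real^3" assume "u \<in> restr S ` {u. vpolyfun m u}"
  then obtain v where v: "vpolyfun m v" "u = restr S v" by blast
  have eq: "(\<lambda>x. u x $ i) = restr S (\<lambda>x. v x $ i)" for i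
    by (rule ext) (simp add: v(2) restr_def)
  have "(\<lambda>x. u x $ i) \<in> poly_space m S" for i
    unfolding poly_space_eq eq by (intro imageI CollectI vpolyfun_nth v(1))
  then show "u \<in> vpoly_space m S" by (simp add: vpoly_space_def)
qed

lemma linear_restr: "linear (restr S)"
proof (rule linearI)
  fix f g :: "'a \<Rightarrow> 'b" and c :: real
  show "restr S (f + g) = restr S f + restr S g"
    by (rule ext) (simp add: restr_def)
  show "restr S (c *\<^sub>R f) = c *\<^sub>R restr S f"
    by (rule ext) (simp add: restr_def)
qed

lemma fin_dim_vpolyfun: "fin_dim {u :: real^3 \<Rightarrow> real^3. vpolyfun m u}"
proof -
  let ?M = "span (monomial ` {\<alpha>. int (\<Sum>i\<in>UNIV. \<alpha> i) \<le> m})"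
  let ?E = "\<lambda>i f x. f x *\<^sub>R (axis i 1 :: real^3)"
  have "linear (?E i :: (real^3 \<Rightarrow> real) \<Rightarrow> _)" for i
    by (rule linearI; rule ext) (simp_all add: scaleR_add_left)
  moreover have "fin_dim ?M" unfolding fin_dim_def
    by (intro exI[of _ "monomial ` {\<alpha>. int (\<Sum>i\<in>UNIV. \<alpha> i) \<le> m}"] conjI finite_imageI finite_exponents order_refl)
  ultimately have "fin_dim (\<Sum>i\<in>UNIV. ?E i ` ?M)"
    by (intro fin_dim_sum fin_dim_linear_image) auto
  moreover have "{u :: real^3 \<Rightarrow> real^3. vpolyfun m u} \<subseteq> (\<Sum>i\<in>UNIV. ?E i ` ?M)"
  proof clarify
    fix u :: "real^3 \<Rightarrow> real^3" assume u: "vpolyfun m u"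
    have "u = (\<Sum>i\<in>UNIV. ?E i (\<lambda>x. u x $ i))"
      by (intro ext) (simp add: vec_eq_iff axis_def if_distrib cong: if_cong)
    moreover have "?E i (\<lambda>x. u x $ i) \<in> ?E i ` ?M" for i
      by (rule image_eqI[where x = "\<lambda>x. u x $ i", OF refl polyfun_span_monomials[OF vpolyfun_nth[OF u]]])
    ultimately show "u \<in> (\<Sum>i\<in>UNIV. ?E i ` ?M)"
      unfolding set_sum_alt[OF finite]
      by (intro CollectI exI[of _ "\<lambda>i. ?E i (\<lambda>x. u x $ i)"] conjI) auto
  qed
  ultimately show ?thesis by (rule fin_dim_subset)
qed

section \<open>Partial derivatives of polynomials\<close>

definition pd :: "'n::finite \<Rightarrow> (real^'n \<Rightarrow> real) \<Rightarrow> real^'n \<Rightarrow> real"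
  where "pd j f x = frechet_derivative f (at x) (axis j 1)"

lemma polyfun_pd: "polyfun m f \<Longrightarrow> polyfun (m - 1) (pd j f)"
  unfolding pd_def by (rule polyfun_directional_derivative)

lemma frechet_derivative_pd:
  assumes "polyfun m f"
  shows "frechet_derivative f (at x) d = (\<Sum>j\<in>UNIV. d $ j * pd j f x)"
proof -
  have lin: "linear (frechet_derivative f (at x))"
    using polyfun_has_derivative[OF assms] has_derivative_linear by blast
  have "frechet_derivative f (at x) d = frechet_derivative f (at x) (\<Sum>j\<in>UNIV. d $ j *\<^sub>R axis j 1)"
    by (simp add: basis_expansion flip: scalar_mult_eq_scaleR)
  also have "\<dots> = (\<Sum>j\<in>UNIV. d $ j * pd j f x)"
    by (simp add: linear_sum[OF lin] linear_scale[OF lin] pd_def)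
  finally show ?thesis .
qed

lemma pd_add: "polyfun m f \<Longrightarrow> polyfun n g \<Longrightarrow> pd j (\<lambda>x. f x + g x) x = pd j f x + pd j g x"
  unfolding pd_def
  by (subst frechet_derivative_at[symmetric, OF has_derivative_add[OF polyfun_has_derivative polyfun_has_derivative]]) auto

lemma pd_diff: "polyfun m f \<Longrightarrow> polyfun n g \<Longrightarrow> pd j (\<lambda>x. f x - g x) x = pd j f x - pd j g x"
  unfolding pd_def
  by (subst frechet_derivative_at[symmetric, OF has_derivative_diff[OF polyfun_has_derivative polyfun_has_derivative]]) auto

lemma pd_mult:
  "polyfun m f \<Longrightarrow> polyfun n g \<Longrightarrow> pd j (\<lambda>x. f x * g x) x = f x * pd j g x + pd j f x * g x"
  unfolding pd_def
  by (subst frechet_derivative_at[symmetric, OF has_derivative_mult[OF polyfun_has_derivative polyfun_has_derivative]]) auto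

lemma pd_cmult:
  assumes "polyfun m f"
  shows "pd j (\<lambda>x. a * f x) x = a * pd j f x"
  unfolding pd_def
  by (subst frechet_derivative_at[symmetric, OF has_derivative_mult_right[OF polyfun_has_derivative[OF assms]]]) auto

lemma pd_affine:
  assumes "linear h"
  shows "pd j (\<lambda>x. h x + c) x = h (axis j 1)"
proof -
  have "((\<lambda>x. h x + c) has_derivative h) (at x)"
    using linear_imp_has_derivative[OF assms, of "at x"] by (auto intro!: derivative_eq_intros)
  then show ?thesis unfolding pd_def using frechet_derivative_at by metis
qed

lemma pd_zero: "pd j (\<lambda>_. 0) x = 0"
  by (simp add: pd_def frechet_derivative_const)

lemma vpolyfun_has_derivative:
  fixes u :: "'a::euclidean_space \<Rightarrow> real^'n"
  assumes "vpolyfun m u"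
  shows "(u has_derivative (\<lambda>d. \<chi> i. frechet_derivative (\<lambda>x. u x $ i) (at x) d)) (at x)"
  unfolding has_derivative_componentwise_within[of u]
proof
  fix b :: "real^'n" assume "b \<in> Basis"
  then obtain i where b: "b = axis i 1" by (auto simp: Basis_vec_def)
  show "((\<lambda>x. u x \<bullet> b) has_derivative
      (\<lambda>d. (\<chi> i. frechet_derivative (\<lambda>x. u x $ i) (at x) d) \<bullet> b)) (at x)"
    unfolding b using polyfun_has_derivative[OF vpolyfun_nth[OF assms, of i]] by (simp add: inner_axis)
qed

lemma vpolyfun_frechet_derivative_nth:
  fixes u :: "'a::euclidean_space \<Rightarrow> real^'n"
  assumes "vpolyfun m u"
  shows "frechet_derivative u (at x) d $ i = frechet_derivative (\<lambda>x. u x $ i) (at x) d"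
  using fun_cong[OF frechet_derivative_at[OF vpolyfun_has_derivative[OF assms], of x], of d, symmetric] by simp

section \<open>Integration over polyhedral cells\<close>

lemma set_integrable_continuous_compact:
  fixes f :: "'a::euclidean_space \<Rightarrow> real"
  assumes "compact S" "continuous_on S f"
  shows "set_integrable lborel S f"
  unfolding set_integrable_def using borel_integrable_compact[OF assms] .

text \<open>The set of points of \<open>U\<close> where \<open>f\<close> does not vanish is open and negligible.\<close>

lemma integral_zero_imp_zero:
  fixes f :: "'a::euclidean_space \<Rightarrow> real"
  assumes S: "compact S" and f: "continuous_on S f" and pos: "\<And>x. x \<in> S \<Longrightarrow> 0 \<le> f x"
    and zero: "(LINT x:S|lborel. f x) = 0" and U: "open U" "U \<subseteq> S" and x: "x \<in> U"
  shows "f x = 0"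
proof (rule ccontr)
  assume nz: "f x \<noteq> 0"
  let ?g = "\<lambda>x. indicator S x *\<^sub>R f x"
  have "integrable lborel ?g" by (rule borel_integrable_compact[OF S f])
  moreover have "AE x in lborel. 0 \<le> ?g x" using pos by (auto split: split_indicator)
  ultimately have "AE x in lborel. ?g x = 0"
    using zero integral_nonneg_eq_0_iff_AE unfolding set_lebesgue_integral_def by blast
  from AE_E3[OF this] obtain N where N: "\<And>x. x \<in> space lborel - N \<Longrightarrow> ?g x = 0" "N \<in> null_sets lborel"
    by blast
  let ?V = "{x \<in> U. f x \<in> - {0}}"
  have "?V \<subseteq> N" using N(1) U(2) by (force simp: indicator_def)
  moreover have "negligible N"
    using N(2) unfolding negligible_iff_null_sets by (rule null_sets_completionI)
  ultimately have "negligible ?V" using negligible_subset by blast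
  moreover have "open ?V"
    using continuous_open_preimage[OF continuous_on_subset[OF f U(2)] U(1), of "- {0}"]
      open_Compl[OF closed_singleton[of "0::real"]]
    by (simp add: vimage_def Int_def)
  ultimately have "?V = {}" using open_not_negligible by blast
  with x nz show False by auto
qed

text \<open>For small \<open>t\<close> the linear term decides the sign, and \<open>t\<close> may have either sign.\<close>

lemma cubic_nonpos_imp_zero:
  fixes A B C :: real
  assumes "\<delta> > 0" and le: "\<And>t. \<bar>t\<bar> < \<delta> \<Longrightarrow> t * A + t^2 * B + t^3 * C \<le> 0"
  shows "A = 0"
proof -
  have main: "A \<le> 0" if le: "\<And>t. 0 < t \<Longrightarrow> t < \<delta> \<Longrightarrow> t * A + t^2 * B + t^3 * C \<le> 0" for A B C :: real
  proof -
    have ev: "eventually (\<lambda>t. A + t * B + t^2 * C \<le> 0) (at_right 0)"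
      unfolding eventually_at_right_field
    proof (intro exI[of _ \<delta>] conjI allI impI)
      fix t :: real assume t: "0 < t" "t < \<delta>"
      have "t * (A + t * B + t^2 * C) \<le> 0"
        using le[OF t] by (simp add: power2_eq_square power3_eq_cube algebra_simps)
      with t show "A + t * B + t^2 * C \<le> 0" by (simp add: mult_le_0_iff)
    qed (use assms in auto)
    have "((\<lambda>t. A + t * B + t^2 * C) \<longlongrightarrow> A + 0 * B + 0^2 * C) (at_right 0)"
      by (intro tendsto_intros)
    then have "((\<lambda>t. A + t * B + t^2 * C) \<longlongrightarrow> A) (at_right 0)" by simp
    then show "A \<le> 0" using ev by (rule tendsto_upperbound) simp
  qed
  have "A \<le> 0" by (rule main[of A B C]) (rule le, simp)
  moreover have "- A \<le> 0"
  proof (rule main[of _ B "- C"])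
    fix t :: real assume "0 < t" "t < \<delta>"
    then show "t * (- A) + t^2 * B + t^3 * (- C) \<le> 0" using le[of "- t"] by (simp add: power3_eq_cube)
  qed
  ultimately show ?thesis by simp
qed

text \<open>The map \<open>x + t w(x)\<close> is injective on \<open>S\<close> once \<open>\<bar>t\<bar>\<close> is less than the inverse of a Lipschitz
  constant of \<open>w\<close>. If it also maps \<open>S\<close> into itself, then the integral of its Jacobian determinant is at
  most the volume of \<open>S\<close>. As a polynomial in \<open>t\<close> this integral is maximal at \<open>t = 0\<close>, so its linear
  coefficient vanishes; that coefficient is the integral of the trace of the derivative of \<open>w\<close>. The
  assumption on the determinant fits dimensions up to three.\<close>

lemma integral_divergence_invariant_field:
  fixes w :: "real^('n::{finite,wellorder}) \<Rightarrow> real^('n::{finite,wellorder})"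
  assumes S: "compact S"
    and der: "\<And>x. (w has_derivative D x) (at x)"
    and lip: "\<And>x y. x \<in> S \<Longrightarrow> y \<in> S \<Longrightarrow> norm (w x - w y) \<le> L * norm (x - y)"
    and eps: "\<epsilon> > 0" and inv: "\<And>t x. \<bar>t\<bar> < \<epsilon> \<Longrightarrow> x \<in> S \<Longrightarrow> x + t *\<^sub>R w x \<in> S"
    and det: "\<And>t x. det (matrix (\<lambda>d. d + t *\<^sub>R D x d)) = 1 + t * a x + t^2 * b x + t^3 * c x"
    and cont: "continuous_on S a" "continuous_on S b" "continuous_on S c"
  shows "(LINT x:S|lborel. a x) = 0"
proof -
  have int: "f integrable_on S" "(LINT x:S|lborel. f x) = integral S f"
    if "continuous_on S f" for f :: "real^('n::{finite,wellorder}) \<Rightarrow> real"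
    using set_borel_integral_eq_integral[OF set_integrable_continuous_compact[OF S that]] by auto
  \<comment> \<open>Below the second bound the map is injective, since \<open>\<bar>t\<bar> L < 1\<close>.\<close>
  define \<delta> where "\<delta> = min \<epsilon> (1 / (\<bar>L\<bar> + 1))"
  have \<delta>: "\<delta> > 0" using eps by (simp add: \<delta>_def add_nonneg_pos)
  have "t * integral S a + t^2 * integral S b + t^3 * integral S c \<le> 0" if t: "\<bar>t\<bar> < \<delta>" for t
  proof -
    let ?f = "\<lambda>x. x + t *\<^sub>R w x" and ?J = "\<lambda>x. 1 + t * a x + t^2 * b x + t^3 * c x"
    have der': "(?f has_derivative (\<lambda>d. d + t *\<^sub>R D x d)) (at x within S)" for x
      by (intro derivative_intros has_derivative_at_withinI[OF der])
    have "\<bar>t\<bar> * (\<bar>L\<bar> + 1) < 1"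
      using t by (simp add: \<delta>_def pos_less_divide_eq add_nonneg_pos)
    then have tL: "\<bar>t\<bar> * \<bar>L\<bar> < 1" by (simp add: distrib_left)
    have inj: "inj_on ?f S"
    proof (rule inj_onI, rule ccontr)
      fix x y assume xy: "x \<in> S" "y \<in> S" "?f x = ?f y" "x \<noteq> y"
      then have "x - y = t *\<^sub>R (w y - w x)" by (simp add: algebra_simps)
      then have "norm (x - y) = \<bar>t\<bar> * norm (w x - w y)" by (simp add: norm_minus_commute)
      also have "\<dots> \<le> \<bar>t\<bar> * (\<bar>L\<bar> * norm (x - y))"
        using lip[OF xy(1,2)] by (intro mult_left_mono order_trans[OF lip[OF xy(1,2)]] mult_right_mono) auto
      also have "\<dots> < 1 * norm (x - y)"
        using mult_strict_right_mono[OF tL, of "norm (x - y)"] xy(4) by (simp add: mult.assoc)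
      finally show False by simp
    qed
    have contJ: "continuous_on S ?J" using cont by (intro continuous_intros)
    then have contJ': "continuous_on S (\<lambda>x. \<bar>?J x\<bar>)" by (rule continuous_on_rabs)
    have Sleb: "S \<in> sets lebesgue" using S by (simp add: lmeasurable_compact fmeasurableD)
    have "measure lebesgue (?f ` S) = integral S (\<lambda>x. \<bar>det (matrix (\<lambda>d. d + t *\<^sub>R D x d))\<bar>)"
      by (rule measure_differentiable_image_eq[OF Sleb der' inj]) (simp add: det int(1)[OF contJ'])
    then have "integral S (\<lambda>x. \<bar>?J x\<bar>) = measure lebesgue (?f ` S)" by (simp add: det)
    also have "\<dots> \<le> measure lebesgue S"
    proof (rule measure_mono_fmeasurable)
      have "\<bar>t\<bar> < \<epsilon>" using t by (simp add: \<delta>_def)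
      then show "?f ` S \<subseteq> S" using inv[of t] by (intro image_subsetI)
      have "continuous_on S ?f"
        by (rule has_derivative_continuous_on) (rule der')
      then have "compact (?f ` S)" by (rule compact_continuous_image[OF _ S])
      then show "?f ` S \<in> sets lebesgue" by (simp add: lmeasurable_compact fmeasurableD)
    qed (simp add: S lmeasurable_compact)
    also have "\<dots> = integral S (\<lambda>x. 1)" using S by (simp add: lmeasure_integral lmeasurable_compact)
    finally have le: "integral S (\<lambda>x. \<bar>?J x\<bar>) \<le> integral S (\<lambda>x. 1)" .
    have "integral S ?J \<le> integral S (\<lambda>x. \<bar>?J x\<bar>)"
      by (intro integral_le int(1) contJ contJ') auto
    moreover have "integral S ?J
        = integral S (\<lambda>x. 1) + t * integral S a + t^2 * integral S b + t^3 * integral S c"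
      by (intro integral_unique has_integral_add has_integral_mult_right integrable_integral
          int(1) cont continuous_on_const)
    ultimately show ?thesis using le by linarith
  qed
  from cubic_nonpos_imp_zero[OF \<delta> this] show ?thesis unfolding int(2)[OF cont(1)] .
qed

lemma bounded_on_compact:
  fixes g :: "'a::topological_space \<Rightarrow> real"
  assumes "compact S" "continuous_on S g"
  shows "\<exists>M. \<forall>x\<in>S. \<bar>g x\<bar> \<le> M"
  using compact_imp_bounded[OF compact_continuous_image[OF assms(2,1)]] by (simp add: bounded_iff)

lemma polyfun_lipschitz:
  assumes "polyfun m f" "compact S"
  shows "\<exists>L. \<forall>x\<in>S. \<forall>y\<in>S. \<bar>f x - f y\<bar> \<le> L * norm (x - y)"
  using assms(1)
proof induction
  case (polyfun_add m f g)
  then obtain K L where "\<And>x y. x \<in> S \<Longrightarrow> y \<in> S \<Longrightarrow> \<bar>f x - f y\<bar> \<le> K * norm (x - y)"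
    "\<And>x y. x \<in> S \<Longrightarrow> y \<in> S \<Longrightarrow> \<bar>g x - g y\<bar> \<le> L * norm (x - y)" by blast
  then have "\<bar>f x + g x - (f y + g y)\<bar> \<le> (K + L) * norm (x - y)" if "x \<in> S" "y \<in> S" for x y
    using that unfolding distrib_right by (smt (verit))
  then show ?case by blast
next
  case (polyfun_affine_mult h m f c)
  then obtain L where L: "\<And>x y. x \<in> S \<Longrightarrow> y \<in> S \<Longrightarrow> \<bar>f x - f y\<bar> \<le> L * norm (x - y)" by blast
  obtain A where A: "\<And>x. x \<in> S \<Longrightarrow> \<bar>h x + c\<bar> \<le> A"
    using bounded_on_compact[OF assms(2) polyfun_continuous[OF polyfun_affine[OF polyfun_affine_mult(1) order_refl]]] by blast
  obtain B where B: "\<And>x. x \<in> S \<Longrightarrow> \<bar>f x\<bar> \<le> B"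
    using bounded_on_compact[OF assms(2) polyfun_continuous[OF polyfun_affine_mult(2)]] by blast
  obtain H where H: "\<And>x. \<bar>h x\<bar> \<le> H * norm x"
    using linear_bounded[OF polyfun_affine_mult(1)] by auto
  have "\<bar>(h x + c) * f x - (h y + c) * f y\<bar> \<le> (A * L + H * B) * norm (x - y)"
    if "x \<in> S" "y \<in> S" for x y
  proof -
    have "(h x + c) * f x - (h y + c) * f y = (h x + c) * (f x - f y) + h (x - y) * f y"
      by (simp add: linear_diff[OF polyfun_affine_mult(1)] algebra_simps)
    also have "\<bar>\<dots>\<bar> \<le> \<bar>h x + c\<bar> * \<bar>f x - f y\<bar> + \<bar>h (x - y)\<bar> * \<bar>f y\<bar>"
      by (metis abs_mult abs_triangle_ineq)
    also have "\<dots> \<le> A * (L * norm (x - y)) + (H * norm (x - y)) * B"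
      by (intro add_mono mult_mono A B L H that) (use A[OF that(1)] H[of "x - y"] in \<open>auto intro: order_trans[OF abs_ge_zero]\<close>)
    finally show ?thesis by (simp add: algebra_simps)
  qed
  then show ?case by blast
qed (intro exI[of _ 0], simp)+

lemma vpolyfun_lipschitz:
  assumes "vpolyfun m u" "compact S"
  shows "\<exists>L. \<forall>x\<in>S. \<forall>y\<in>S. norm (u x - u y) \<le> L * norm (x - y)"
proof -
  have "\<forall>b. \<exists>L. \<forall>x\<in>S. \<forall>y\<in>S. \<bar>u x \<bullet> b - u y \<bullet> b\<bar> \<le> L * norm (x - y)"
    using polyfun_lipschitz[OF vpolyfunD[OF assms(1)] assms(2)] by blast
  then obtain L where L: "\<And>b x y. x \<in> S \<Longrightarrow> y \<in> S \<Longrightarrow> \<bar>u x \<bullet> b - u y \<bullet> b\<bar> \<le> L b * norm (x - y)"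
    by metis
  have "norm (u x - u y) \<le> (\<Sum>b\<in>Basis. L b) * norm (x - y)" if "x \<in> S" "y \<in> S" for x y
  proof -
    have "norm (u x - u y) \<le> (\<Sum>b\<in>Basis. \<bar>(u x - u y) \<bullet> b\<bar>)" by (rule norm_le_l1)
    also have "\<dots> \<le> (\<Sum>b\<in>Basis. L b * norm (x - y))"
      using L[OF that] by (intro sum_mono) (simp add: inner_diff_left)
    finally show ?thesis by (simp add: sum_distrib_right)
  qed
  then show ?thesis by blast
qed

text \<open>A compact polyhedron \<open>S\<close> with nonempty interior, given by affine inequalities
  \<open>h i x + c i \<ge> 0\<close>. Tetrahedra, and triangles and segments in isometric coordinates, are
  instances with the barycentric coordinates as the affine functions.\<close>

locale cell =
  fixes I :: "'i set" and h :: "'i \<Rightarrow> 'a::euclidean_space \<Rightarrow> real" and c :: "'i \<Rightarrow> real" and S :: "'a set"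
  assumes fin: "finite I" and lin: "\<And>i. i \<in> I \<Longrightarrow> linear (h i)"
    and S_eq: "S = {x. \<forall>i\<in>I. 0 \<le> h i x + c i}" and cpt: "compact S"
    and pos_ex: "\<exists>x. \<forall>i\<in>I. 0 < h i x + c i"
begin

definition pos :: "'a set" where "pos = {x. \<forall>i\<in>I. 0 < h i x + c i}"

lemma polyfun_lam: "i \<in> I \<Longrightarrow> 1 \<le> m \<Longrightarrow> polyfun m (\<lambda>x. h i x + c i)"
  by (rule polyfun_affine[OF lin])

lemma pos_nonempty: "pos \<noteq> {}" using pos_ex by (auto simp: pos_def)

lemma pos_subset: "pos \<subseteq> S" by (auto simp: pos_def S_eq less_imp_le)

lemma open_pos: "open pos"
proof -
  have "open {x. 0 < h i x + c i}" if "i \<in> I" for i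
    by (intro open_Collect_less continuous_on_const polyfun_continuous[OF polyfun_lam[OF that order_refl]])
  then have "open (\<Inter>i\<in>I. {x. 0 < h i x + c i})" using fin by (intro open_INT) auto
  also have "(\<Inter>i\<in>I. {x. 0 < h i x + c i}) = pos" by (auto simp: pos_def)
  finally show ?thesis .
qed

text \<open>Test fields will always be chosen such that the vanishing moment is a weighted square norm.\<close>

lemma weighted_square_zero:
  fixes u :: "'a \<Rightarrow> 'b::euclidean_space"
  assumes W: "continuous_on S W" "\<And>x. x \<in> S \<Longrightarrow> 0 \<le> W x" "\<And>x. x \<in> pos \<Longrightarrow> 0 < W x"
    and u: "vpolyfun m u" and zero: "(LINT x:S|lborel. W x * (u x \<bullet> u x)) = 0"
  shows "u x = 0"
proof (rule vpolyfun_zero_on_open[OF u open_pos pos_nonempty])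
  fix x assume x: "x \<in> pos"
  have "W x * (u x \<bullet> u x) = 0"
    by (rule integral_zero_imp_zero[OF cpt _ _ zero open_pos pos_subset x])
      (use W in \<open>auto intro!: continuous_intros vpolyfun_continuous[OF u]\<close>)
  with W(3)[OF x] show "u x = 0" by auto
qed

lemma weighted_square_zero_real:
  assumes W: "continuous_on S W" "\<And>x. x \<in> S \<Longrightarrow> 0 \<le> W x" "\<And>x. x \<in> pos \<Longrightarrow> 0 < W x"
    and f: "polyfun m f" and zero: "(LINT x:S|lborel. W x * (f x * f x)) = 0"
  shows "f x = 0"
  using weighted_square_zero[OF W, of m f] f zero by (auto simp: vpolyfun_def polyfun_cmult mult.commute)

text \<open>If the derivative of each defining function \<open>\<lambda>\<close> along \<open>w\<close> is \<open>\<lambda> g\<close>, then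
  \<open>\<lambda>(x + t w(x)) = \<lambda>(x) (1 + t g(x))\<close>, which stays nonnegative while \<open>\<bar>t g\<bar> \<le> 1\<close>.\<close>

lemma tangential_invariance:
  assumes "\<And>i. i \<in> I \<Longrightarrow> continuous_on S (g i) \<and> (\<forall>x\<in>S. h i (w x) = (h i x + c i) * g i x)"
  shows "\<exists>\<epsilon>>0. \<forall>t x. \<bar>t\<bar> < \<epsilon> \<longrightarrow> x \<in> S \<longrightarrow> x + t *\<^sub>R w x \<in> S"
proof -
  have "\<forall>i\<in>I. \<exists>M. \<forall>x\<in>S. \<bar>g i x\<bar> \<le> M"
    using assms bounded_on_compact[OF cpt] by blast
  then obtain M where M: "\<And>i x. i \<in> I \<Longrightarrow> x \<in> S \<Longrightarrow> \<bar>g i x\<bar> \<le> M i" by metis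
  \<comment> \<open>A common bound for all \<open>g i\<close>; the summand 1 keeps it positive when \<open>I\<close> is empty.\<close>
  define B where "B = (\<Sum>i\<in>I. \<bar>M i\<bar>) + 1"
  have B: "B > 0" unfolding B_def by (simp add: sum_nonneg add_nonneg_pos)
  have MB: "\<bar>M i\<bar> \<le> B" if "i \<in> I" for i
    using member_le_sum[OF that _ fin, of "\<lambda>i. \<bar>M i\<bar>"] by (simp add: B_def)
  have "x + t *\<^sub>R w x \<in> S" if t: "\<bar>t\<bar> < 1 / B" and x: "x \<in> S" for t x
    unfolding S_eq
  proof (intro CollectI ballI)
    fix i assume i: "i \<in> I"
    have "\<bar>t * g i x\<bar> \<le> \<bar>t\<bar> * B"
      unfolding abs_mult using M[OF i x] MB[OF i] by (intro mult_left_mono) auto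
    also have "\<dots> \<le> 1" using t B by (simp add: field_simps)
    finally have "0 \<le> 1 + t * g i x" by linarith
    moreover have "0 \<le> h i x + c i" using x i by (simp add: S_eq)
    ultimately have "0 \<le> (h i x + c i) * (1 + t * g i x)" by simp
    also have "\<dots> = h i (x + t *\<^sub>R w x) + c i"
      using assms[OF i] x by (simp add: linear_add[OF lin[OF i]] linear_scale[OF lin[OF i]] algebra_simps)
    finally show "0 \<le> h i (x + t *\<^sub>R w x) + c i" .
  qed
  then show ?thesis using B by (intro exI[of _ "1 / B"]) auto
qed

end

lemma matrix_identity_plus:
  fixes w :: "real^'n \<Rightarrow> real^'n"
  shows "matrix (\<lambda>d. d + t *\<^sub>R (\<chi> i. frechet_derivative (\<lambda>x. w x $ i) (at x) d)) $ i $ j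
    = (if i = j then 1 else 0) + t * pd j (\<lambda>x. w x $ i) x"
  by (simp add: matrix_def pd_def axis_def)

text \<open>Gauss' theorem without boundary term. The hypothesis on \<open>h i (w x)\<close> expresses that \<open>w\<close> is
  tangential to the face \<open>h i x + c i = 0\<close>.\<close>

lemma divergence_tangential_zero:
  fixes w :: "real^('n::{finite,wellorder}) \<Rightarrow> real^('n::{finite,wellorder})"
  assumes "cell I h c S" and w: "vpolyfun m w"
    and g: "\<And>i. i \<in> I \<Longrightarrow> \<exists>g n. polyfun n g \<and> (\<forall>x. h i (w x) = (h i x + c i) * g x)"
    and det: "\<And>t x. det (matrix (\<lambda>d. d + t *\<^sub>R (\<chi> i. frechet_derivative (\<lambda>x. w x $ i) (at x) d)))
      = 1 + t * a x + t^2 * b x + t^3 * r x"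
    and cont: "continuous_on S a" "continuous_on S b" "continuous_on S r"
  shows "(LINT x:S|lborel. a x) = 0"
proof -
  interpret cell I h c S by fact
  obtain L where L: "\<And>x y. x \<in> S \<Longrightarrow> y \<in> S \<Longrightarrow> norm (w x - w y) \<le> L * norm (x - y)"
    using vpolyfun_lipschitz[OF w cpt] by blast
  from g obtain G n where G: "\<And>i. i \<in> I \<Longrightarrow> polyfun (n i) (G i)"
    "\<And>i x. i \<in> I \<Longrightarrow> h i (w x) = (h i x + c i) * G i x" by metis
  obtain \<epsilon> where \<epsilon>: "\<epsilon> > 0" "\<And>t x. \<bar>t\<bar> < \<epsilon> \<Longrightarrow> x \<in> S \<Longrightarrow> x + t *\<^sub>R w x \<in> S"
    using tangential_invariance[of G w] polyfun_continuous[OF G(1)] G(2) by blast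
  show ?thesis
    by (rule integral_divergence_invariant_field[OF cpt vpolyfun_has_derivative[OF w] L \<epsilon> det cont])
qed

lemma divergence_zero_2:
  fixes w :: "real^2 \<Rightarrow> real^2"
  assumes "cell I h c S" and w: "vpolyfun m w"
    and g: "\<And>i. i \<in> I \<Longrightarrow> \<exists>g n. polyfun n g \<and> (\<forall>x. h i (w x) = (h i x + c i) * g x)"
  shows "(LINT x:S|lborel. pd 1 (\<lambda>x. w x $ 1) x + pd 2 (\<lambda>x. w x $ 2) x) = 0"
proof -
  let ?p = "\<lambda>i j. pd j (\<lambda>x. w x $ i)"
  have c: "continuous_on S (?p i j)" for i j
    by (rule polyfun_continuous[OF polyfun_pd[OF vpolyfun_nth[OF w]]])
  show ?thesis
  proof (rule divergence_tangential_zero[OF assms])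
    show "det (matrix (\<lambda>d. d + t *\<^sub>R (\<chi> i. frechet_derivative (\<lambda>x. w x $ i) (at x) d)))
      = 1 + t * (?p 1 1 x + ?p 2 2 x) + t^2 * (?p 1 1 x * ?p 2 2 x - ?p 1 2 x * ?p 2 1 x) + t^3 * 0" for t x
      unfolding det_2 matrix_identity_plus by (simp add: power2_eq_square algebra_simps)
  qed (assumption | intro continuous_intros c)+
qed

lemma det_3_identity_plus:
  fixes t :: real
  shows "(1 + t * a11) * (1 + t * a22) * (1 + t * a33) + t * a12 * (t * a23) * (t * a31)
    + t * a13 * (t * a21) * (t * a32) - (1 + t * a11) * (t * a23) * (t * a32)
    - t * a12 * (t * a21) * (1 + t * a33) - t * a13 * (1 + t * a22) * (t * a31)
    = 1 + t * (a11 + a22 + a33)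
      + t^2 * (a11 * a22 - a12 * a21 + a11 * a33 - a13 * a31 + a22 * a33 - a23 * a32)
      + t^3 * (a11 * a22 * a33 + a12 * a23 * a31 + a13 * a21 * a32 - a11 * a23 * a32
        - a12 * a21 * a33 - a13 * a22 * a31)"
  by (simp add: power2_eq_square power3_eq_cube algebra_simps)

lemma divergence_zero_3:
  fixes w :: "real^3 \<Rightarrow> real^3"
  assumes "cell I h c S" and w: "vpolyfun m w"
    and g: "\<And>i. i \<in> I \<Longrightarrow> \<exists>g n. polyfun n g \<and> (\<forall>x. h i (w x) = (h i x + c i) * g x)"
  shows "(LINT x:S|lborel. pd 1 (\<lambda>x. w x $ 1) x + pd 2 (\<lambda>x. w x $ 2) x + pd 3 (\<lambda>x. w x $ 3) x) = 0"
proof -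
  let ?p = "\<lambda>i j. pd j (\<lambda>x. w x $ i)"
  have c: "continuous_on S (?p i j)" for i j
    by (rule polyfun_continuous[OF polyfun_pd[OF vpolyfun_nth[OF w]]])
  show ?thesis
  proof (rule divergence_tangential_zero[OF assms])
    show "det (matrix (\<lambda>d. d + t *\<^sub>R (\<chi> i. frechet_derivative (\<lambda>x. w x $ i) (at x) d)))
      = 1 + t * (?p 1 1 x + ?p 2 2 x + ?p 3 3 x)
      + t^2 * (?p 1 1 x * ?p 2 2 x - ?p 1 2 x * ?p 2 1 x
          + ?p 1 1 x * ?p 3 3 x - ?p 1 3 x * ?p 3 1 x + ?p 2 2 x * ?p 3 3 x - ?p 2 3 x * ?p 3 2 x)
      + t^3 * (?p 1 1 x * ?p 2 2 x * ?p 3 3 x + ?p 1 2 x * ?p 2 3 x * ?p 3 1 x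
          + ?p 1 3 x * ?p 2 1 x * ?p 3 2 x - ?p 1 1 x * ?p 2 3 x * ?p 3 2 x
          - ?p 1 2 x * ?p 2 1 x * ?p 3 3 x - ?p 1 3 x * ?p 2 2 x * ?p 3 1 x)" for t x
      unfolding det_3 matrix_identity_plus by (simp add: det_3_identity_plus)
  qed (assumption | intro continuous_intros c)+
qed

section \<open>Vanishing Nedelec fields in the plane\<close>

unbundle cross3_syntax

lemma pd_sum:
  "finite I \<Longrightarrow> (\<And>i. i \<in> I \<Longrightarrow> polyfun m (f i)) \<Longrightarrow> pd j (\<lambda>x. \<Sum>i\<in>I. f i x) x = (\<Sum>i\<in>I. pd j (f i) x)"
proof (induction I rule: finite_induct)
  case empty
  then show ?case by (simp add: pd_zero)
next
  case (insert i I)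
  then show ?case by (simp add: pd_add[of m _ m] polyfun_sum)
qed

lemma linear_nth: "linear (\<lambda>x::real^'n. x $ j)"
  by (rule linearI) auto

lemma linear_inner: "linear (\<lambda>x::'a::euclidean_space. n \<bullet> x)"
  by (rule linearI) (auto simp: inner_add_right)

lemma polyfun_cancel:
  assumes "polyfun m l" "polyfun n f" "polyfun n' g" "l y \<noteq> 0" "\<And>x. l x * f x = l x * g x"
  shows "f x = g x"
proof -
  let ?n = "max n n'"
  have "polyfun ?n (\<lambda>x. f x - g x)"
    by (intro polyfun_diff polyfun_mono[OF assms(2)] polyfun_mono[OF assms(3)]) auto
  from polyfun_mult_eq_0[OF assms(1) this _ assms(4)] show ?thesis
    using assms(5) by (simp add: right_diff_distrib)
qed

text \<open>With \<open>w(x) = u(x) \<bullet> x\<close> and a symmetric derivative of \<open>u\<close> one has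
  \<open>\<nabla>w = u + (x \<bullet> \<nabla>)u\<close>. The left side has degree \<open>k\<close> by hypothesis, and modulo degree \<open>k\<close>
  the right side is \<open>(k + 2) u\<close> by the approximate Euler relation.

  The two hypotheses on degrees replace membership in the Nedelec space. They express that
  the homogeneous part of degree \<open>k + 1\<close> is orthogonal to \<open>x\<close>, and unlike
  \<open>v(x) \<bullet> x = 0\<close> they are invariant under translations and under restriction to faces and
  edges.\<close>

lemma curl_free_degree:
  fixes u :: "real^'n \<Rightarrow> real^'n"
  assumes u: "vpolyfun (k + 1) u" and ux: "polyfun (k + 1) (\<lambda>x. u x \<bullet> x)" and k: "0 \<le> k"
    and sym: "\<And>i j x. pd i (\<lambda>x. u x $ j) x = pd j (\<lambda>x. u x $ i) x"
  shows "vpolyfun k u"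
proof (rule vpolyfun_nthI)
  fix i
  let ?u = "\<lambda>j x. u x $ j"
  note uj = vpolyfun_nth[OF u]
  note xj = polyfun_linear[OF linear_nth order_refl]
  have "pd i (\<lambda>x. u x \<bullet> x) x = ?u i x + frechet_derivative (?u i) (at x) x" for x
  proof -
    have "pd i (\<lambda>x. u x \<bullet> x) x = pd i (\<lambda>x. \<Sum>j\<in>UNIV. ?u j x * x $ j) x"
      by (simp add: inner_vec_def)
    also have "\<dots> = (\<Sum>j\<in>UNIV. pd i (\<lambda>x. ?u j x * x $ j) x)"
      by (rule pd_sum[OF finite polyfun_mult[OF uj xj]])
    also have "\<dots> = (\<Sum>j\<in>UNIV. ?u j x * axis i 1 $ j + pd i (?u j) x * x $ j)"
      by (simp add: pd_mult[OF uj xj] pd_affine[OF linear_nth, where c = 0, simplified])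
    also have "\<dots> = u x \<bullet> axis i 1 + (\<Sum>j\<in>UNIV. x $ j * pd j (?u i) x)"
      by (simp add: sum.distrib sym[of i] mult.commute inner_vec_def)
    also have "u x \<bullet> axis i 1 = ?u i x" by (simp add: inner_axis)
    finally show ?thesis by (simp add: frechet_derivative_pd[OF uj])
  qed
  then have eq: "pd i (\<lambda>x. u x \<bullet> x) = (\<lambda>x. ?u i x + frechet_derivative (?u i) (at x) x)"
    by (rule ext)
  have "polyfun k (\<lambda>x. ?u i x + frechet_derivative (?u i) (at x) x)"
    using polyfun_pd[OF ux, of i] unfolding eq by simp
  moreover have "polyfun k (\<lambda>x. frechet_derivative (?u i) (at x) x - of_int (k + 1) * ?u i x)"
    using polyfun_euler[OF uj[of i]] by simp
  ultimately have "polyfun k (\<lambda>x. (1 / of_int (k + 2)) *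
      ((?u i x + frechet_derivative (?u i) (at x) x) - (frechet_derivative (?u i) (at x) x - of_int (k + 1) * ?u i x)))"
    by (rule polyfun_cmult[OF polyfun_diff])
  moreover have "(1 / of_int (k + 2)) *
      ((?u i x + frechet_derivative (?u i) (at x) x) - (frechet_derivative (?u i) (at x) x - of_int (k + 1) * ?u i x)) = ?u i x" for x
    using k by (simp add: field_simps)
  ultimately show "polyfun k (?u i)" by simp
qed

text \<open>The one-dimensional instance of the Nedelec condition: a polynomial \<open>g\<close> such that \<open>s g(s)\<close> has no
  larger degree than allowed for \<open>g\<close> loses its top coefficient.\<close>

lemma edge_trace_degree:
  fixes g :: "real \<Rightarrow> real"
  assumes g: "polyfun (k + 1) g" and sg: "polyfun (k + 1) (\<lambda>s. s * g s)"
  shows "polyfun k g"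
proof -
  obtain g' where g': "polyfun k g'" "\<And>s. s * g s = s * g' s"
    using polyfun_divide[OF sg linear_id[unfolded id_def], of 1 0] by auto
  have "g s = g' s" for s
    by (rule polyfun_cancel[OF polyfun_linear[OF linear_id[unfolded id_def] order_refl] g g'(1), of 1])
      (use g'(2) in auto)
  then have "g = g'" by (rule ext)
  with g'(1) show ?thesis by simp
qed

lemma (in cell) set_integral_add_continuous:
  "continuous_on S f \<Longrightarrow> continuous_on S g \<Longrightarrow>
    (LINT x:S|lborel. f x + g x) = (LINT x:S|lborel. f x) + (LINT x:S|lborel. (g x :: real))"
  by (intro set_integral_add set_integrable_continuous_compact[OF cpt])

text \<open>The face problem, where \<open>u\<close> is the tangential component in isometric coordinates. First, the scalar curl
  \<open>q\<close> of \<open>u\<close> is orthogonal to itself: the field \<open>q (u\<^sub>2, -u\<^sub>1)\<close> is tangential to all edges, and its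
  divergence is \<open>q\<^sup>2 - u \<bullet> (\<partial>\<^sub>2 q, -\<partial>\<^sub>1 q)\<close>, whose second term
  integrates to zero. Then \<open>u\<close> has degree \<open>k\<close>, the component along each edge tangent \<open>t\<close> is
  \<open>\<lambda> \<psi>\<close> with \<open>\<psi>\<close> of degree \<open>k - 1\<close>, and the moment against \<open>\<psi> t\<close> shows \<open>\<psi> = 0\<close>.\<close>

lemma nedelec_2d_zero:
  fixes u :: "real^2 \<Rightarrow> real^2"
  assumes "cell I h c S" and nz: "\<And>i. i \<in> I \<Longrightarrow> \<exists>e. h i e \<noteq> 0"
    and u: "vpolyfun (k + 1) u" and ux: "polyfun (k + 1) (\<lambda>x. u x \<bullet> x)" and k: "0 \<le> k"
    and edge: "\<And>i x. i \<in> I \<Longrightarrow> h i x + c i = 0 \<Longrightarrow> h i (axis 1 1) * u x $ 2 - h i (axis 2 1) * u x $ 1 = 0"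
    and ij: "i \<in> I" "j \<in> I" "h i (axis 1 1) * h j (axis 2 1) \<noteq> h i (axis 2 1) * h j (axis 1 1)"
    and orth: "\<And>\<nu>. vpolyfun (k - 1) \<nu> \<Longrightarrow> (LINT x:S|lborel. u x \<bullet> \<nu> x) = 0"
  shows "u x = 0"
proof -
  interpret cell I h c S by fact
  let ?t = "\<lambda>i x. h i (axis 1 1) * u x $ 2 - h i (axis 2 1) * u x $ 1"
  note uj = vpolyfun_nth[OF u]
  have h_eq: "h i d = d $ 1 * h i (axis 1 1) + d $ 2 * h i (axis 2 1)" if "i \<in> I" for i d
  proof -
    have "h i d = h i (\<Sum>j\<in>UNIV. d $ j *\<^sub>R axis j 1)"
      by (simp add: basis_expansion flip: scalar_mult_eq_scaleR)
    then show ?thesis by (simp add: sum_2 linear_add[OF lin[OF that]] linear_scale[OF lin[OF that]])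
  qed
  define q where "q = (\<lambda>x. pd 1 (\<lambda>x. u x $ 2) x - pd 2 (\<lambda>x. u x $ 1) x)"
  have q: "polyfun k q"
    unfolding q_def using polyfun_diff[OF polyfun_pd[OF uj] polyfun_pd[OF uj]] by simp
  define \<nu> :: "real^2 \<Rightarrow> real^2" where "\<nu> = (\<lambda>x. vector [pd 2 q x, - pd 1 q x])"
  have \<nu>: "vpolyfun (k - 1) \<nu>"
  proof (rule vpolyfun_nthI)
    fix i :: 2
    show "polyfun (k - 1) (\<lambda>x. \<nu> x $ i)"
      using exhaust_2[of i] by (elim disjE) (simp_all add: \<nu>_def polyfun_uminus polyfun_pd q)
  qed
  define w :: "real^2 \<Rightarrow> real^2" where "w = (\<lambda>x. vector [q x * u x $ 2, - (q x * u x $ 1)])"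
  have w: "vpolyfun (k + (k + 1)) w"
  proof (rule vpolyfun_nthI)
    fix i :: 2
    show "polyfun (k + (k + 1)) (\<lambda>x. w x $ i)"
      using exhaust_2[of i] polyfun_mult[OF q uj[of 2]] polyfun_uminus[OF polyfun_mult[OF q uj[of 1]]]
      by (elim disjE) (simp_all add: w_def)
  qed
  have "(LINT x:S|lborel. pd 1 (\<lambda>x. w x $ 1) x + pd 2 (\<lambda>x. w x $ 2) x) = 0"
  proof (rule divergence_zero_2[OF assms(1) w])
    fix i assume i: "i \<in> I"
    have "polyfun (k + 1) (?t i)" by (intro polyfun_diff polyfun_cmult uj)
    moreover obtain e where "h i e \<noteq> 0" using nz[OF i] by blast
    ultimately obtain g where g: "polyfun k g" "\<And>x. ?t i x = (h i x + c i) * g x"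
      using polyfun_divide[OF _ lin[OF i], of "k + 1" "?t i" e "c i"] edge[OF i] by auto
    have "h i (w x) = (h i x + c i) * (q x * g x)" for x
    proof -
      have "h i (w x) = q x * ?t i x" by (subst h_eq[OF i]) (simp add: w_def algebra_simps)
      then show ?thesis by (simp add: g(2))
    qed
    with polyfun_mult[OF q g(1)] show "\<exists>g n. polyfun n g \<and> (\<forall>x. h i (w x) = (h i x + c i) * g x)" by blast
  qed
  moreover have "pd 1 (\<lambda>x. w x $ 1) x + pd 2 (\<lambda>x. w x $ 2) x = q x * q x + - (u x \<bullet> \<nu> x)" for x
  proof -
    have "pd 2 (\<lambda>x. w x $ 2) x = pd 2 (\<lambda>x. - 1 * (q x * u x $ 1)) x" by (simp add: w_def)
    also have "\<dots> = - (q x * pd 2 (\<lambda>x. u x $ 1) x + pd 2 q x * u x $ 1)"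
      by (subst pd_cmult[OF polyfun_mult[OF q uj]], subst pd_mult[OF q uj]) simp
    finally show ?thesis
      by (simp add: w_def pd_mult[OF q uj] \<nu>_def inner_vec_def sum_2) (simp add: q_def algebra_simps)
  qed
  ultimately have "0 = (LINT x:S|lborel. q x * q x + - (u x \<bullet> \<nu> x))" by simp
  also have "\<dots> = (LINT x:S|lborel. q x * q x) + (LINT x:S|lborel. - (u x \<bullet> \<nu> x))"
    by (intro set_integral_add_continuous continuous_intros polyfun_continuous[OF q]
        vpolyfun_continuous[OF u] vpolyfun_continuous[OF \<nu>])
  also have "(LINT x:S|lborel. - (u x \<bullet> \<nu> x)) = - (LINT x:S|lborel. u x \<bullet> \<nu> x)"
    by (simp add: set_lebesgue_integral_def)
  finally have "(LINT x:S|lborel. 1 * (q x * q x)) = 0" using orth[OF \<nu>] by simp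
  then have "q x = 0" for x by (intro weighted_square_zero_real[OF _ _ _ q, of "\<lambda>_. 1"]) auto
  then have "pd 1 (\<lambda>x. u x $ 2) x = pd 2 (\<lambda>x. u x $ 1) x" for x by (simp add: q_def)
  then have "pd i (\<lambda>x. u x $ j) x = pd j (\<lambda>x. u x $ i) x" for i j x
    using exhaust_2[of i] exhaust_2[of j] by auto
  from curl_free_degree[OF u ux k this] have uk: "vpolyfun k u" .
  have t0: "?t i x = 0" if i: "i \<in> I" for i x
  proof -
    have "polyfun k (?t i)" by (intro polyfun_diff polyfun_cmult vpolyfun_nth[OF uk])
    moreover obtain e where "h i e \<noteq> 0" using nz[OF i] by blast
    ultimately obtain \<psi> where \<psi>: "polyfun (k - 1) \<psi>" "\<And>x. ?t i x = (h i x + c i) * \<psi> x"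
      using polyfun_divide[OF _ lin[OF i], of k "?t i" e "c i"] edge[OF i] by auto
    \<comment> \<open>The edge direction: the gradient of \<open>h i\<close> turned by a right angle.\<close>
    let ?r = "vector [- h i (axis 2 1), h i (axis 1 1)] :: real^2"
    have "u x \<bullet> (\<psi> x *\<^sub>R ?r) = (h i x + c i) * (\<psi> x * \<psi> x)" for x
    proof -
      have "u x \<bullet> (\<psi> x *\<^sub>R ?r) = \<psi> x * ?t i x" by (simp add: inner_vec_def sum_2 algebra_simps)
      then show ?thesis by (simp add: \<psi>(2))
    qed
    then have "(LINT x:S|lborel. (h i x + c i) * (\<psi> x * \<psi> x)) = (LINT x:S|lborel. u x \<bullet> (\<psi> x *\<^sub>R ?r))"
      by (simp only:)
    also have "\<dots> = 0" by (rule orth[OF vpolyfun_scaleR_const[OF \<psi>(1)]])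
    finally have "(LINT x:S|lborel. (h i x + c i) * (\<psi> x * \<psi> x)) = 0" .
    then have "\<psi> x = 0"
      by (intro weighted_square_zero_real[OF _ _ _ \<psi>(1), of "\<lambda>x. h i x + c i"]
          polyfun_continuous[OF polyfun_lam[OF i order_refl]]) (use i in \<open>auto simp: S_eq pos_def\<close>)
    then show ?thesis by (simp add: \<psi>(2))
  qed
  let ?D = "h i (axis 1 1) * h j (axis 2 1) - h i (axis 2 1) * h j (axis 1 1)"
  have "?D * u x $ 1 = h j (axis 1 1) * ?t i x - h i (axis 1 1) * ?t j x"
    "?D * u x $ 2 = h j (axis 2 1) * ?t i x - h i (axis 2 1) * ?t j x"
    by (simp_all add: algebra_simps)
  then have "u x $ 1 = 0" "u x $ 2 = 0" using t0[OF ij(1)] t0[OF ij(2)] ij(3) by auto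
  then show ?thesis by (simp add: vec_eq_iff forall_2)
qed

section \<open>Vanishing Nedelec fields in space\<close>

text \<open>The curl in terms of partial derivatives of the components.\<close>

definition rot :: "(real^3 \<Rightarrow> real^3) \<Rightarrow> real^3 \<Rightarrow> real^3"
  where "rot u x = vector [pd 2 (\<lambda>x. u x $ 3) x - pd 3 (\<lambda>x. u x $ 2) x,
    pd 3 (\<lambda>x. u x $ 1) x - pd 1 (\<lambda>x. u x $ 3) x, pd 1 (\<lambda>x. u x $ 2) x - pd 2 (\<lambda>x. u x $ 1) x]"

definition divergence :: "(real^3 \<Rightarrow> real^3) \<Rightarrow> real^3 \<Rightarrow> real"
  where "divergence u x = pd 1 (\<lambda>x. u x $ 1) x + pd 2 (\<lambda>x. u x $ 2) x + pd 3 (\<lambda>x. u x $ 3) x"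

lemma vpolyfun_rot:
  assumes "vpolyfun m u"
  shows "vpolyfun (m - 1) (rot u)"
proof (rule vpolyfun_nthI)
  fix i :: 3
  show "polyfun (m - 1) (\<lambda>x. rot u x $ i)"
    using exhaust_3[of i]
    by (elim disjE) (simp_all add: rot_def polyfun_diff polyfun_pd vpolyfun_nth[OF assms])
qed

lemma polyfun_divergence: "vpolyfun m u \<Longrightarrow> polyfun (m - 1) (divergence u)"
  unfolding divergence_def by (intro polyfun_add polyfun_pd vpolyfun_nth)

lemma curl_eq_rot:
  assumes "vpolyfun m u"
  shows "curl u x = rot u x"
  by (simp add: curl_def rot_def jacobian_def matrix_def pd_def vpolyfun_frechet_derivative_nth[OF assms] Let_def)

lemma vpolyfun_cross:
  assumes "vpolyfun m u" "vpolyfun n v"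
  shows "vpolyfun (m + n) (\<lambda>x. u x \<times> v x)"
proof (rule vpolyfun_nthI)
  fix i :: 3
  show "polyfun (m + n) (\<lambda>x. (u x \<times> v x) $ i)"
    using exhaust_3[of i]
    by (elim disjE) (simp_all add: cross3_def polyfun_diff polyfun_mult vpolyfun_nth[OF assms(1)] vpolyfun_nth[OF assms(2)])
qed

lemma vpolyfun_const: "0 \<le> m \<Longrightarrow> vpolyfun m (\<lambda>_. a)"
  by (simp add: vpolyfun_def polyfun_const)

lemma divergence_cross:
  assumes u: "vpolyfun m u" and v: "vpolyfun n v"
  shows "divergence (\<lambda>x. u x \<times> v x) x = rot u x \<bullet> v x - u x \<bullet> rot v x"
proof -
  have d: "pd j (\<lambda>x. u x $ a * v x $ b - u x $ a' * v x $ b') x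
    = u x $ a * pd j (\<lambda>x. v x $ b) x + pd j (\<lambda>x. u x $ a) x * v x $ b
      - (u x $ a' * pd j (\<lambda>x. v x $ b') x + pd j (\<lambda>x. u x $ a') x * v x $ b')" for j a b a' b'
    by (simp add: pd_diff[OF polyfun_mult[OF vpolyfun_nth[OF u] vpolyfun_nth[OF v]] polyfun_mult[OF vpolyfun_nth[OF u] vpolyfun_nth[OF v]]]
        pd_mult[OF vpolyfun_nth[OF u] vpolyfun_nth[OF v]])
  show ?thesis
    by (simp add: divergence_def rot_def cross3_def d inner_vec_def sum_3) (simp add: algebra_simps)
qed

lemma divergence_scaleR:
  assumes f: "polyfun m f" and v: "vpolyfun n v"
  shows "divergence (\<lambda>x. f x *\<^sub>R v x) x = (\<Sum>j\<in>UNIV. pd j f x * v x $ j) + f x * divergence v x"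
  by (simp add: divergence_def pd_mult[OF f vpolyfun_nth[OF v]] sum_3 algebra_simps)

lemma cross_dual_basis:
  fixes a b c u :: "real^3"
  shows "(a \<bullet> (b \<times> c)) *\<^sub>R u = (u \<bullet> (b \<times> c)) *\<^sub>R a + (u \<bullet> (c \<times> a)) *\<^sub>R b + (u \<bullet> (a \<times> b)) *\<^sub>R c"
    and "(a \<bullet> (b \<times> c)) *\<^sub>R u = (u \<bullet> a) *\<^sub>R (b \<times> c) + (u \<bullet> b) *\<^sub>R (c \<times> a) + (u \<bullet> c) *\<^sub>R (a \<times> b)"
  by (simp_all add: vec_eq_iff forall_3 cross3_def inner_vec_def sum_3 algebra_simps)

text \<open>Composition with the orthogonal projection onto the plane reduces the claim to the absence of zero
  divisors among polynomials on the whole space.\<close>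

lemma vanish_on_plane_cancel:
  fixes n :: "'a::euclidean_space"
  assumes f: "polyfun m f" and \<psi>: "polyfun m' \<psi>" and y: "n \<bullet> y + c = 0" "f y \<noteq> 0" and n: "n \<noteq> 0"
    and z: "\<And>x. n \<bullet> x + c = 0 \<Longrightarrow> f x * \<psi> x = 0" and x: "n \<bullet> x + c = 0"
  shows "\<psi> x = 0"
proof -
  let ?d = "(1 / (n \<bullet> n)) *\<^sub>R n"
  let ?A = "\<lambda>x. x - (n \<bullet> x) *\<^sub>R ?d" and ?b = "- c *\<^sub>R ?d"
  have A: "linear ?A" by (rule linearI) (auto simp: inner_add_right algebra_simps)
  have on: "n \<bullet> (?A x + ?b) + c = 0" for x using n by (simp add: inner_diff_right inner_add_right)
  have fix_plane: "?A x + ?b = x" if "n \<bullet> x + c = 0" for x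
  proof -
    have "?A x + ?b = x - (n \<bullet> x + c) *\<^sub>R ?d" by (simp only: scaleR_add_left scaleR_minus_left) simp
    then show ?thesis by (simp only: that scaleR_zero_left diff_zero)
  qed
  have fy: "f (?A y + ?b) \<noteq> 0" unfolding fix_plane[OF y(1)] by (rule y(2))
  have "\<psi> (?A x + ?b) = 0"
    by (rule polyfun_mult_eq_0[OF polyfun_compose_affine[OF f A] polyfun_compose_affine[OF \<psi> A] _ fy])
      (rule z[OF on])
  then show ?thesis unfolding fix_plane[OF x] .
qed

text \<open>The direction \<open>n \<times> (n' \<times> n)\<close> is parallel to the first plane and not to the second.\<close>

lemma transversal_planes:
  fixes n n' :: "real^3"
  assumes nn: "n \<times> n' \<noteq> 0"
  shows "\<exists>y. n \<bullet> y + c = 0 \<and> n' \<bullet> y + c' \<noteq> 0"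
proof -
  let ?t = "n \<times> (n' \<times> n)" and ?p = "(- c / (n \<bullet> n)) *\<^sub>R n"
  have n0: "n \<bullet> n \<noteq> 0" using nn by auto
  have t: "n \<bullet> ?t = 0" "n' \<bullet> ?t = (n \<times> n') \<bullet> (n \<times> n')"
    by (simp_all add: cross3_def inner_vec_def sum_3 algebra_simps)
  define s where "s = (1 - (n' \<bullet> ?p + c')) / ((n \<times> n') \<bullet> (n \<times> n'))"
  have "n' \<bullet> (?p + s *\<^sub>R ?t) + c' = s * ((n \<times> n') \<bullet> (n \<times> n')) + (n' \<bullet> ?p + c')"
    using t by (simp add: inner_add_right inner_diff_right)
  also have "\<dots> = 1" using nn by (simp add: s_def)
  finally have "n' \<bullet> (?p + s *\<^sub>R ?t) + c' \<noteq> 0" by simp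
  moreover have "n \<bullet> (?p + s *\<^sub>R ?t) + c = 0" using n0 t by (simp add: inner_add_right inner_diff_right)
  ultimately show ?thesis by blast
qed

text \<open>The cell problem, where \<open>n i\<close> are normal vectors of the faces and \<open>\<lambda>\<^sub>i\<close> their affine functions. Since
  \<open>u \<times> \<phi>\<close> is tangential to all faces, \<open>curl u\<close> is orthogonal to all \<open>\<phi>\<close> of degree
  \<open>k - 1\<close>. Writing \<open>u \<times> n\<^sub>i = \<lambda>\<^sub>i G\<close> and taking divergences gives
  \<open>curl u \<bullet> n\<^sub>i = \<lambda>\<^sub>i div G\<close>, because \<open>G\<close> is orthogonal to \<open>n\<^sub>i\<close>; testing with
  \<open>(div G) n\<^sub>i\<close> shows that this vanishes for every \<open>i\<close>, hence \<open>curl u = 0\<close>. Now \<open>u\<close> has degree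
  \<open>k\<close>, and its component along an edge direction \<open>n\<^sub>j \<times> n\<^sub>i\<close> vanishes on two faces. It is therefore
  \<open>\<lambda>\<^sub>i \<lambda>\<^sub>j \<xi>\<close> with \<open>\<xi>\<close> of degree \<open>k - 2\<close>, and the interior moment against \<open>\<xi>\<close> times that direction gives \<open>\<xi> = 0\<close>.\<close>

lemma nedelec_3d_zero:
  fixes u :: "real^3 \<Rightarrow> real^3"
  assumes cell: "cell I (\<lambda>i x. n i \<bullet> x) c S" and nz: "\<And>i. i \<in> I \<Longrightarrow> n i \<noteq> 0"
    and u: "vpolyfun (k + 1) u" and ux: "polyfun (k + 1) (\<lambda>x. u x \<bullet> x)" and k: "0 \<le> k"
    and face: "\<And>i x. i \<in> I \<Longrightarrow> n i \<bullet> x + c i = 0 \<Longrightarrow> u x \<times> n i = 0"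
    and ijl: "i \<in> I" "j \<in> I" "l \<in> I" "n i \<bullet> (n j \<times> n l) \<noteq> 0"
    and orth: "\<And>\<nu>. vpolyfun (k - 2) \<nu> \<Longrightarrow> (LINT x:S|lborel. u x \<bullet> \<nu> x) = 0"
  shows "u x = 0"
proof -
  interpret cell I "\<lambda>i x. n i \<bullet> x" c S by fact
  have lam: "polyfun 1 (\<lambda>x. n i \<bullet> x + c i)" for i by (rule polyfun_affine[OF linear_inner order_refl])
  have lam_nz: "\<exists>y. n i \<bullet> y + c i \<noteq> 0" if "i \<in> I" for i
    using pos_ex that by (metis less_irrefl)
  have nn: "n i \<bullet> n i \<noteq> 0" if "i \<in> I" for i using nz[OF that] by simp
  have trace: "\<exists>G. vpolyfun k G \<and> (\<forall>x. u x \<times> n i = (n i \<bullet> x + c i) *\<^sub>R G x)" if i: "i \<in> I" for i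
    using vpolyfun_divide[OF vpolyfun_cross[OF u vpolyfun_const[OF order_refl, of "n i"]] linear_inner, of "n i" "n i" "c i"]
      face[OF i] nn[OF i] by auto
  have curl_orth: "(LINT x:S|lborel. rot u x \<bullet> \<phi> x) = 0" if \<phi>: "vpolyfun (k - 1) \<phi>" for \<phi>
  proof -
    note w = vpolyfun_cross[OF u \<phi>]
    have "(LINT x:S|lborel. divergence (\<lambda>x. u x \<times> \<phi> x) x) = 0"
      unfolding divergence_def
    proof (rule divergence_zero_3[OF cell w])
      fix i assume "i \<in> I"
      from trace[OF this] obtain G where G: "vpolyfun k G" "\<And>x. u x \<times> n i = (n i \<bullet> x + c i) *\<^sub>R G x" by blast
      have "n i \<bullet> (u x \<times> \<phi> x) = (n i \<bullet> x + c i) * (-1 * (G x \<bullet> \<phi> x))" for x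
      proof -
        have "n i \<bullet> (u x \<times> \<phi> x) = - ((u x \<times> n i) \<bullet> \<phi> x)"
          by (simp add: cross3_def inner_vec_def sum_3 algebra_simps)
        then show ?thesis by (simp add: G(2))
      qed
      with polyfun_cmult[OF vpolyfun_inner[OF G(1) \<phi>], of "-1"]
      show "\<exists>g m. polyfun m g \<and> (\<forall>x. n i \<bullet> (u x \<times> \<phi> x) = (n i \<bullet> x + c i) * g x)" by blast
    qed
    then have "0 = (LINT x:S|lborel. rot u x \<bullet> \<phi> x + - (u x \<bullet> rot \<phi> x))"
      by (simp add: divergence_cross[OF u \<phi>])
    also have "\<dots> = (LINT x:S|lborel. rot u x \<bullet> \<phi> x) + (LINT x:S|lborel. - (u x \<bullet> rot \<phi> x))"
      by (intro set_integral_add_continuous continuous_intros vpolyfun_continuous[OF vpolyfun_rot[OF u]]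
          vpolyfun_continuous[OF u] vpolyfun_continuous[OF \<phi>] vpolyfun_continuous[OF vpolyfun_rot[OF \<phi>]])
    also have "(LINT x:S|lborel. - (u x \<bullet> rot \<phi> x)) = - (LINT x:S|lborel. u x \<bullet> rot \<phi> x)"
      by (simp add: set_lebesgue_integral_def)
    also have "(LINT x:S|lborel. u x \<bullet> rot \<phi> x) = 0"
      using orth[of "rot \<phi>"] vpolyfun_rot[OF \<phi>] by simp
    finally show ?thesis by simp
  qed
  have rn: "rot u x \<bullet> n i = 0" if i: "i \<in> I" for i x
  proof -
    from trace[OF i] obtain G where G: "vpolyfun k G" "\<And>x. u x \<times> n i = (n i \<bullet> x + c i) *\<^sub>R G x" by blast
    obtain y where y: "n i \<bullet> y + c i \<noteq> 0" using lam_nz[OF i] by blast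
    have Gn: "G x \<bullet> n i = 0" for x
    proof (rule polyfun_cancel[OF lam[of i] vpolyfunD[OF G(1)] polyfun_zero y])
      fix x
      have "(n i \<bullet> x + c i) * (G x \<bullet> n i) = (u x \<times> n i) \<bullet> n i" by (simp add: G(2))
      then show "(n i \<bullet> x + c i) * (G x \<bullet> n i) = (n i \<bullet> x + c i) * 0" by (simp add: dot_cross_self)
    qed
    have rn_eq: "rot u x \<bullet> n i = (n i \<bullet> x + c i) * divergence G x" for x
    proof -
      have "pd j (\<lambda>x. n i \<bullet> x + c i) x = n i $ j" for j
        by (simp add: pd_affine[OF linear_inner] inner_axis)
      then have "divergence (\<lambda>x. (n i \<bullet> x + c i) *\<^sub>R G x) x = n i \<bullet> G x + (n i \<bullet> x + c i) * divergence G x"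
        by (simp add: divergence_scaleR[OF lam G(1)]) (simp add: inner_vec_def)
      moreover have "rot (\<lambda>_. n i) x = 0" by (simp add: rot_def pd_def frechet_derivative_const vec_eq_iff forall_3)
      then have "divergence (\<lambda>x. u x \<times> n i) x = rot u x \<bullet> n i"
        by (simp add: divergence_cross[OF u vpolyfun_const[OF order_refl]])
      ultimately show ?thesis using Gn[of x] by (simp add: G(2) inner_commute)
    qed
    have \<psi>: "polyfun (k - 1) (divergence G)" by (rule polyfun_divergence[OF G(1)])
    have "rot u x \<bullet> (divergence G x *\<^sub>R n i) = (n i \<bullet> x + c i) * (divergence G x * divergence G x)" for x
      by (simp add: rn_eq)
    then have "(LINT x:S|lborel. (n i \<bullet> x + c i) * (divergence G x * divergence G x))
        = (LINT x:S|lborel. rot u x \<bullet> (divergence G x *\<^sub>R n i))" by (simp only:)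
    also have "\<dots> = 0" by (rule curl_orth[OF vpolyfun_scaleR_const[OF \<psi>]])
    finally have "(LINT x:S|lborel. (n i \<bullet> x + c i) * (divergence G x * divergence G x)) = 0" .
    then have "divergence G x = 0"
      by (intro weighted_square_zero_real[OF _ _ _ \<psi>, of "\<lambda>x. n i \<bullet> x + c i"]
          polyfun_continuous[OF lam]) (use i in \<open>auto simp: S_eq pos_def\<close>)
    then show ?thesis by (simp add: rn_eq)
  qed
  have r0: "rot u x = 0" for x
    using cross_dual_basis(2)[of "n i" "n j" "n l" "rot u x"] ijl(4)
      rn[OF ijl(1)] rn[OF ijl(2)] rn[OF ijl(3)] by simp
  have "pd i (\<lambda>x. u x $ j) x = pd j (\<lambda>x. u x $ i) x" for i j x
    using r0[of x] exhaust_3[of i] exhaust_3[of j] by (auto simp: rot_def vec_eq_iff forall_3)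
  from curl_free_degree[OF u ux k this] have uk: "vpolyfun k u" .
  have t0: "u x \<bullet> (n j \<times> n i) = 0" if i: "i \<in> I" and j: "j \<in> I" for i j x
  proof (cases "n i \<times> n j = 0")
    case True
    then have "n j \<times> n i = 0" by (metis cross_skew neg_equal_0_iff_equal)
    then show ?thesis by simp
  next
    case False
    have zj: "u x \<bullet> (n j \<times> n i) = 0" if "n j \<bullet> x + c j = 0" for x
    proof -
      have "u x \<bullet> (n j \<times> n i) = (u x \<times> n j) \<bullet> n i"
        by (simp add: cross3_def inner_vec_def sum_3 algebra_simps)
      then show ?thesis using face[OF j that] by simp
    qed
    have zi: "u x \<bullet> (n j \<times> n i) = 0" if "n i \<bullet> x + c i = 0" for x
    proof -
      have "u x \<bullet> (n j \<times> n i) = - ((u x \<times> n i) \<bullet> n j)"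
        by (simp add: cross3_def inner_vec_def sum_3 algebra_simps)
      then show ?thesis using face[OF i that] by simp
    qed
    obtain \<psi> where \<psi>: "polyfun (k - 1) \<psi>" "\<And>x. u x \<bullet> (n j \<times> n i) = (n j \<bullet> x + c j) * \<psi> x"
      using polyfun_divide[OF vpolyfunD[OF uk] linear_inner, of "n j" "n j" "c j" "n j \<times> n i"] zj nn[OF j] by auto
    have "\<psi> x = 0" if "n i \<bullet> x + c i = 0" for x
    proof -
      obtain y where y: "n i \<bullet> y + c i = 0" "n j \<bullet> y + c j \<noteq> 0" using transversal_planes[OF False] by blast
      show ?thesis
        by (rule vanish_on_plane_cancel[OF lam[of j] \<psi>(1) y nz[OF i] _ that])
          (simp only: \<psi>(2)[symmetric] zi)
    qed
    then obtain \<xi> where \<xi>: "polyfun (k - 2) \<xi>" "\<And>x. \<psi> x = (n i \<bullet> x + c i) * \<xi> x"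
      using polyfun_divide[OF \<psi>(1) linear_inner, of "n i" "n i" "c i"] nn[OF i] by auto
    have "u x \<bullet> (\<xi> x *\<^sub>R (n j \<times> n i)) = ((n i \<bullet> x + c i) * (n j \<bullet> x + c j)) * (\<xi> x * \<xi> x)" for x
      by (simp add: \<psi>(2) \<xi>(2))
    then have "(LINT x:S|lborel. ((n i \<bullet> x + c i) * (n j \<bullet> x + c j)) * (\<xi> x * \<xi> x))
        = (LINT x:S|lborel. u x \<bullet> (\<xi> x *\<^sub>R (n j \<times> n i)))" by (simp only:)
    also have "\<dots> = 0" by (rule orth[OF vpolyfun_scaleR_const[OF \<xi>(1)]])
    finally have "(LINT x:S|lborel. ((n i \<bullet> x + c i) * (n j \<bullet> x + c j)) * (\<xi> x * \<xi> x)) = 0" .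
    then have "\<xi> x = 0"
      by (intro weighted_square_zero_real[OF _ _ _ \<xi>(1), of "\<lambda>x. (n i \<bullet> x + c i) * (n j \<bullet> x + c j)"]
          polyfun_continuous[OF polyfun_mult[OF lam lam]]) (use i j in \<open>auto simp: S_eq pos_def\<close>)
    then show ?thesis by (simp add: \<psi>(2) \<xi>(2))
  qed
  show ?thesis
    using cross_dual_basis(1)[of "n i" "n j" "n l" "u x"] ijl(4)
      t0[OF ijl(3) ijl(2)] t0[OF ijl(1) ijl(3)] t0[OF ijl(2) ijl(1)] by simp
qed

section \<open>Isometric charts\<close>

text \<open>An isometry fixing the origin preserves inner products by polarization, so the square norm
  of its defect from linearity is zero.\<close>

lemma isometry_is_affine:
  fixes \<phi> :: "'a::real_inner \<Rightarrow> 'b::real_inner"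
  assumes d: "\<And>x y. dist (\<phi> x) (\<phi> y) = dist x y"
  shows "linear (\<lambda>x. \<phi> x - \<phi> 0)" "(\<phi> x - \<phi> 0) \<bullet> (\<phi> y - \<phi> 0) = x \<bullet> y"
proof -
  define f where "f = (\<lambda>x. \<phi> x - \<phi> 0)"
  have n: "norm (f x - f y) = norm (x - y)" for x y using d[of x y] by (simp add: f_def dist_norm)
  have n0: "norm (f x) = norm x" for x using d[of x 0] by (simp add: f_def dist_norm)
  have i: "f x \<bullet> f y = x \<bullet> y" for x y
    by (simp add: dot_norm_neg n n0)
  then show "(\<phi> x - \<phi> 0) \<bullet> (\<phi> y - \<phi> 0) = x \<bullet> y" by (simp add: f_def)
  have "linear f"
  proof (rule linearI)
    fix x y
    have "(f (x + y) - f x - f y) \<bullet> (f (x + y) - f x - f y) = 0"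
      by (simp add: inner_diff_left inner_diff_right i inner_add_left inner_add_right)
    then have "f (x + y) - f x - f y = 0" by (simp only: inner_eq_zero_iff)
    then show "f (x + y) = f x + f y" by (simp add: algebra_simps)
  next
    fix c x
    have "(f (c *\<^sub>R x) - c *\<^sub>R f x) \<bullet> (f (c *\<^sub>R x) - c *\<^sub>R f x) = 0"
      by (simp add: inner_diff_left inner_diff_right i)
    then show "f (c *\<^sub>R x) = c *\<^sub>R f x" by simp
  qed
  then show "linear (\<lambda>x. \<phi> x - \<phi> 0)" by (simp add: f_def)
qed

text \<open>The chosen chart is only known to cover \<open>S\<close>; since its range is an affine space of the same dimension as
  the hull of \<open>S\<close>, the two coincide.\<close>

lemma isometric_chart_props:
  fixes S :: "(real^3) set"
  assumes dim: "aff_dim S = int DIM('p::euclidean_space)"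
  defines "\<phi> \<equiv> isometric_chart S :: 'p \<Rightarrow> real^3"
  shows "\<exists>J. linear J \<and> (\<forall>s. \<phi> s = J s + \<phi> 0) \<and> (\<forall>s t. J s \<bullet> J t = s \<bullet> t) \<and> range \<phi> = affine hull S"
proof -
  have "S \<noteq> {}" using dim by auto
  then obtain a where a: "a \<in> S" by blast
  let ?T = "span ((+) (- a) ` S)"
  have "dim ?T = DIM('p)"
    using aff_dim_eq_dim[of a S] dim a by (simp add: hull_inc)
  then have "dim (UNIV :: 'p set) = dim ?T" by simp
  then obtain f :: "'p \<Rightarrow> real^3" where f: "linear f" "range f = ?T" "\<And>x. norm (f x) = norm x"
    using isometries_subspaces[OF subspace_UNIV subspace_span] by (metis UNIV_I)
  have "\<exists>\<phi> :: 'p \<Rightarrow> real^3. (\<forall>x y. dist (\<phi> x) (\<phi> y) = dist x y) \<and> S \<subseteq> range \<phi>"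
  proof (intro exI[of _ "\<lambda>x. a + f x"] conjI allI subsetI)
    fix x y show "dist (a + f x) (a + f y) = dist x y"
      by (simp add: dist_norm linear_diff[OF f(1), symmetric] f(3))
  next
    fix x assume "x \<in> S"
    then have "- a + x \<in> ?T" by (intro span_base imageI)
    then obtain s where "- a + x = f s" using f(2) by (metis imageE)
    then have "x = a + f s" by (simp add: algebra_simps)
    then show "x \<in> range (\<lambda>x. a + f x)" by blast
  qed
  then have \<phi>: "(\<forall>x y. dist (\<phi> x) (\<phi> y) = dist x y) \<and> S \<subseteq> range \<phi>"
    unfolding \<phi>_def isometric_chart_def by (rule someI_ex)
  define J where "J = (\<lambda>x. \<phi> x - \<phi> 0)"
  have J: "linear J" "J x \<bullet> J y = x \<bullet> y" for x y
    unfolding J_def using isometry_is_affine[of \<phi>] \<phi> by auto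
  have range: "range \<phi> = (+) (\<phi> 0) ` range J" by (auto simp: J_def image_image)
  have "inj J"
    using J by (metis (no_types, lifting) inner_eq_zero_iff linear_injective_0)
  then have "dim (range J) = DIM('p)" using dim_image_eq[OF J(1), of UNIV] by simp
  then have "aff_dim (range \<phi>) = aff_dim S"
    using aff_dim_subspace[of "range J"] J(1) subspace_UNIV linear_subspace_image dim
    unfolding range by (simp add: aff_dim_translation_eq linear_subspace_image)
  moreover have "affine (range \<phi>)"
    unfolding range using J(1) by (intro affine_translation[THEN iffD1] subspace_imp_affine linear_subspace_image subspace_UNIV)
  moreover have "affine hull S \<subseteq> range \<phi>" using \<phi> calculation(2) by (intro hull_minimal) auto
  ultimately have "affine hull S = range \<phi>"
    using \<open>S \<noteq> {}\<close> by (intro affine_dim_equal) (auto simp: aff_dim_affine_hull)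
  then show ?thesis using J by (intro exI[of _ J]) (auto simp: J_def)
qed

section \<open>Barycentric coordinates of a tetrahedron\<close>

text \<open>The vectors from one vertex to the others are independent, so a linear form can be prescribed on
  them.\<close>

lemma barycentric_exists:
  fixes C :: "'a::euclidean_space set"
  assumes indep: "\<not> affine_dependent C" and v: "v \<in> C" and two: "C \<noteq> {v}"
  shows "\<exists>p :: 'a \<times> real. \<forall>w\<in>C. fst p \<bullet> w + snd p = (if w = v then 1 else 0)"
proof -
  obtain p where p: "p \<in> C" "p \<noteq> v" using v two by blast
  have "independent ((\<lambda>x. -p + x) ` (C - {p}))"
    using affine_dependent_iff_dependent2[OF p(1)] indep by auto
  then obtain g where g: "linear g" "\<forall>x\<in>(\<lambda>x. -p + x) ` (C - {p}). g x = (if x = -p + v then 1 else 0 :: real)"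
    using linear_independent_extend[of _ "\<lambda>x. if x = -p + v then 1 else 0 :: real"] by blast
  let ?n = "adjoint g 1"
  have n: "?n \<bullet> x = g x" for x using adjoint_works[OF g(1), of x 1] by (simp add: inner_commute)
  have "?n \<bullet> w + - (?n \<bullet> p) = (if w = v then 1 else 0)" if w: "w \<in> C" for w
  proof (cases "w = p")
    case False
    then have "g (- p + w) = (if w = v then 1 else 0)" using g(2) w by auto
    then show ?thesis by (auto simp: n linear_diff[OF g(1)])
  qed (use p in auto)
  then show ?thesis by (intro exI[of _ "(?n, - (?n \<bullet> p))"]) auto
qed

text \<open>The tetrahedron with vertex set \<open>C\<close>. Faces are indexed by their opposite vertex: \<open>lam v\<close> is the barycentric
  coordinate that vanishes on \<open>face v\<close>, with gradient \<open>grad v\<close>.\<close>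

locale tetra =
  fixes C :: "(real^3) set"
  assumes indep: "\<not> affine_dependent C" and card4: "card C = 4"
begin

definition K :: "(real^3) set" where "K = convex hull C"

definition coordinate_data :: "real^3 \<Rightarrow> (real^3) \<times> real"
  where "coordinate_data v = (SOME p. \<forall>w\<in>C. fst p \<bullet> w + snd p = (if w = v then 1 else 0))"

definition grad :: "real^3 \<Rightarrow> real^3" where "grad v = fst (coordinate_data v)"
definition offset :: "real^3 \<Rightarrow> real" where "offset v = snd (coordinate_data v)"
definition lam :: "real^3 \<Rightarrow> real^3 \<Rightarrow> real" where "lam v x = grad v \<bullet> x + offset v"

definition face :: "real^3 \<Rightarrow> (real^3) set" where "face v = convex hull (C - {v})"

lemma finC: "finite C" using aff_independent_finite[OF indep] .

lemma lam_vertex: "v \<in> C \<Longrightarrow> w \<in> C \<Longrightarrow> lam v w = (if w = v then 1 else 0)"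
proof -
  assume v: "v \<in> C" and w: "w \<in> C"
  have "C \<noteq> {v}" using card4 by auto
  from someI_ex[OF barycentric_exists[OF indep v this]] w
  show ?thesis unfolding lam_def grad_def offset_def coordinate_data_def by blast
qed

lemma lam_affine_combination:
  assumes "finite D" "sum u D = 1"
  shows "lam v (\<Sum>w\<in>D. u w *\<^sub>R w) = (\<Sum>w\<in>D. u w * lam v w)"
proof -
  have "(\<Sum>w\<in>D. u w * lam v w) = (\<Sum>w\<in>D. u w * (grad v \<bullet> w)) + sum u D * offset v"
    by (simp add: lam_def distrib_left sum.distrib sum_distrib_right)
  then show ?thesis using assms by (simp add: lam_def inner_sum_right)
qed

lemma lam_affine_combination_vertices:
  assumes "D \<subseteq> C" "sum u D = 1" "v \<in> C"
  shows "lam v (\<Sum>w\<in>D. u w *\<^sub>R w) = (if v \<in> D then u v else 0)"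
proof -
  have f: "finite D" using finC assms(1) finite_subset by blast
  have "(\<Sum>w\<in>D. u w * lam v w) = (\<Sum>w\<in>D. if w = v then u w else 0)"
    using assms by (intro sum.cong) (auto simp: lam_vertex)
  then show ?thesis using f by (simp add: lam_affine_combination[OF f assms(2)])
qed

lemma affine_hull_C: "affine hull C = UNIV"
  using aff_dim_affine_independent[OF indep] card4 aff_dim_eq_full[of C] by simp

lemma lam_sum: "(\<Sum>v\<in>C. lam v x) = 1" and lam_repr: "(\<Sum>v\<in>C. lam v x *\<^sub>R v) = x"
proof -
  have "x \<in> affine hull C" using affine_hull_C by simp
  then obtain u where u: "sum u C = 1" "(\<Sum>v\<in>C. u v *\<^sub>R v) = x"
    unfolding affine_hull_finite[OF finC] by blast
  then have "lam v x = u v" if "v \<in> C" for v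
    using lam_affine_combination_vertices[OF order_refl u(1) that] that by simp
  then show "(\<Sum>v\<in>C. lam v x) = 1" "(\<Sum>v\<in>C. lam v x *\<^sub>R v) = x" using u by simp_all
qed

text \<open>Translation by such a \<open>d\<close> would not change the barycentric coordinates.\<close>

lemma grad_zero_imp_zero:
  assumes "\<And>v. v \<in> C \<Longrightarrow> grad v \<bullet> d = 0"
  shows "d = 0"
proof -
  have "lam v d = lam v 0" if "v \<in> C" for v using assms[OF that] by (simp add: lam_def)
  then have "(\<Sum>v\<in>C. lam v d *\<^sub>R v) = (\<Sum>v\<in>C. lam v 0 *\<^sub>R v)" by simp
  then show ?thesis by (simp add: lam_repr)
qed

lemma grad_sum: "(\<Sum>v\<in>C. grad v) = 0"
proof -
  have "(\<Sum>v\<in>C. grad v) \<bullet> x = 0" for x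
  proof -
    have "(\<Sum>v\<in>C. grad v) \<bullet> x = (\<Sum>v\<in>C. lam v x - lam v 0)" by (simp add: lam_def inner_sum_left)
    also have "\<dots> = 0" by (simp add: sum_subtractf lam_sum)
    finally show ?thesis .
  qed
  then show ?thesis using inner_eq_zero_iff by blast
qed

lemma affine_hull_sub:
  assumes D: "D \<subseteq> C"
  shows "affine hull D = {x. \<forall>w\<in>C-D. lam w x = 0}"
proof (intro equalityI subsetI)
  have f: "finite D" using finC D finite_subset by blast
  fix x assume "x \<in> affine hull D"
  then obtain u where u: "sum u D = 1" "(\<Sum>v\<in>D. u v *\<^sub>R v) = x"
    unfolding affine_hull_finite[OF f] by blast
  show "x \<in> {x. \<forall>w\<in>C-D. lam w x = 0}"
    using lam_affine_combination_vertices[OF D u(1)] unfolding u(2) by simp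
next
  have f: "finite D" using finC D finite_subset by blast
  fix x assume "x \<in> {x. \<forall>w\<in>C-D. lam w x = 0}"
  then have z: "lam v x = 0" if "v \<in> C - D" for v using that by blast
  have s1: "(\<Sum>v\<in>D. lam v x) = 1"
    unfolding lam_sum[of x, symmetric] using z by (intro sum.mono_neutral_left[OF finC D] ballI)
  have "(\<Sum>v\<in>D. lam v x *\<^sub>R v) = (\<Sum>v\<in>C. lam v x *\<^sub>R v)"
    using z by (intro sum.mono_neutral_left[OF finC D] ballI) simp
  then have s2: "(\<Sum>v\<in>D. lam v x *\<^sub>R v) = x" by (simp only: lam_repr)
  show "x \<in> affine hull D"
    unfolding affine_hull_finite[OF f] using s1 s2 by (intro CollectI exI[of _ "\<lambda>v. lam v x"] conjI)
qed

lemma convex_hull_sub: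
  assumes D: "D \<subseteq> C"
  shows "convex hull D = {x. (\<forall>w\<in>D. 0 \<le> lam w x) \<and> (\<forall>w\<in>C-D. lam w x = 0)}"
proof (intro equalityI subsetI)
  have f: "finite D" using finC D finite_subset by blast
  fix x assume "x \<in> convex hull D"
  then obtain u where u: "\<forall>v\<in>D. 0 \<le> u v" "sum u D = 1" "(\<Sum>v\<in>D. u v *\<^sub>R v) = x"
    unfolding convex_hull_finite[OF f] by blast
  show "x \<in> {x. (\<forall>w\<in>D. 0 \<le> lam w x) \<and> (\<forall>w\<in>C-D. lam w x = 0)}"
    using lam_affine_combination_vertices[OF D u(2)] u(1) D unfolding u(3) by auto
next
  have f: "finite D" using finC D finite_subset by blast
  fix x assume x: "x \<in> {x. (\<forall>w\<in>D. 0 \<le> lam w x) \<and> (\<forall>w\<in>C-D. lam w x = 0)}"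
  from x have z: "lam v x = 0" if "v \<in> C - D" for v using that by blast
  have s1: "(\<Sum>v\<in>D. lam v x) = 1"
    unfolding lam_sum[of x, symmetric] using z by (intro sum.mono_neutral_left[OF finC D] ballI)
  have "(\<Sum>v\<in>D. lam v x *\<^sub>R v) = (\<Sum>v\<in>C. lam v x *\<^sub>R v)"
    using z by (intro sum.mono_neutral_left[OF finC D] ballI) simp
  then have s2: "(\<Sum>v\<in>D. lam v x *\<^sub>R v) = x" by (simp only: lam_repr)
  have "\<forall>v\<in>D. 0 \<le> lam v x" using x by blast
  then show "x \<in> convex hull D"
    unfolding convex_hull_finite[OF f] using s1 s2 by (intro CollectI exI[of _ "\<lambda>v. lam v x"] conjI)
qed

lemma K_eq: "K = {x. \<forall>w\<in>C. 0 \<le> lam w x}"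
  unfolding K_def by (simp add: convex_hull_sub)

lemma affine_hull_face: "v \<in> C \<Longrightarrow> affine hull (face v) = {x. lam v x = 0}"
  unfolding face_def affine_hull_convex_hull by (subst affine_hull_sub) (auto simp: Diff_Diff_Int)

lemma face_subset_K: "face v \<subseteq> K"
  unfolding face_def K_def by (intro hull_mono) auto

lemma affine_hull_K: "affine hull K = UNIV"
  unfolding K_def affine_hull_convex_hull by (rule affine_hull_C)

lemma facet_iff: "F facet_of K \<longleftrightarrow> (\<exists>v\<in>C. F = face v)"
  unfolding K_def face_def using facet_of_convex_hull_affine_independent_alt[OF indep, of F] card4 by auto

lemma extreme_point_iff: "p extreme_point_of K \<longleftrightarrow> p \<in> C"
  unfolding K_def by (rule extreme_point_of_convex_hull_affine_independent[OF indep])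

lemma vertex_in_face: "v \<in> C \<Longrightarrow> w \<in> C \<Longrightarrow> w \<in> face v \<longleftrightarrow> w \<noteq> v"
proof
  assume "v \<in> C" "w \<in> C" "w \<in> face v"
  then have "lam v w = 0" using affine_hull_face[of v] hull_inc[of w "face v"] by auto
  then show "w \<noteq> v" using lam_vertex[of v w] \<open>v \<in> C\<close> by auto
next
  assume "v \<in> C" "w \<in> C" "w \<noteq> v"
  then show "w \<in> face v" unfolding face_def by (intro hull_inc) auto
qed

lemma face_inj: "inj_on face C"
  by (rule inj_onI) (metis vertex_in_face)

lemma grad_nonzero: "v \<in> C \<Longrightarrow> grad v \<noteq> 0"
proof
  assume v: "v \<in> C" and z: "grad v = 0"
  have "C \<noteq> {v}" using card4 by auto
  then obtain w where "w \<in> C" "w \<noteq> v" using v by blast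
  then show False using lam_vertex[OF v v] lam_vertex[OF v, of w] z by (simp add: lam_def)
qed

lemma grad_diff: "u \<in> C \<Longrightarrow> v \<in> C \<Longrightarrow> w \<in> C \<Longrightarrow>
  grad v \<bullet> (u - w) = (if u = v then 1 else 0) - (if w = v then 1 else 0)"
proof -
  assume "u \<in> C" "v \<in> C" "w \<in> C"
  moreover have "grad v \<bullet> (u - w) = lam v u - lam v w" by (simp add: lam_def inner_diff_right)
  ultimately show ?thesis by (simp add: lam_vertex)
qed

lemma four_vertices:
  assumes "v \<in> C"
  obtains i j l where "C = {v, i, j, l}" "distinct [v, i, j, l]"
proof -
  have "card (C - {v}) = 3" using card4 assms finC by simp
  then obtain i j l where "C - {v} = {i, j, l}" "i \<noteq> j" "j \<noteq> l" "i \<noteq> l" by (auto simp: card_3_iff)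
  then show ?thesis using assms by (intro that[of i j l]) auto
qed

text \<open>The edge vectors at \<open>m\<close> are dual to the gradients at the other vertices.\<close>

lemma grad_triple_nonzero:
  assumes C: "C = {m, i, j, l}" and d: "distinct [m, i, j, l]"
  shows "grad i \<bullet> (grad j \<times> grad l) \<noteq> 0" "grad j \<times> grad l \<noteq> 0"
proof -
  have "(grad j \<times> grad l) \<bullet> ((j - m) \<times> (l - m))
    = (grad j \<bullet> (j - m)) * (grad l \<bullet> (l - m)) - (grad j \<bullet> (l - m)) * (grad l \<bullet> (j - m))"
    by (simp only: cross3_simps) (simp add: algebra_simps)
  also have "\<dots> = 1"
  proof -
    have "m \<in> C" "j \<in> C" "l \<in> C" by (subst C, simp)+
    then show ?thesis using d by (simp add: grad_diff)
  qed
  finally show nz: "grad j \<times> grad l \<noteq> 0" by auto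
  show "grad i \<bullet> (grad j \<times> grad l) \<noteq> 0"
  proof
    assume z: "grad i \<bullet> (grad j \<times> grad l) = 0"
    have "grad j \<bullet> (grad j \<times> grad l) = 0" "grad l \<bullet> (grad j \<times> grad l) = 0" by (rule dot_cross_self)+
    moreover have "grad m + (grad i + (grad j + grad l)) = 0" using grad_sum d unfolding C by simp
    then have "grad m = - (grad i + (grad j + grad l))" by (simp only: eq_neg_iff_add_eq_0)
    ultimately have "grad v \<bullet> (grad j \<times> grad l) = 0" if "v \<in> {m, i, j, l}" for v
      using that z by (elim insertE emptyE) (simp_all add: inner_add_left inner_diff_left)
    then have "grad v \<bullet> (grad j \<times> grad l) = 0" if "v \<in> C" for v
      using that by (subst (asm) C)
    then show False using grad_zero_imp_zero nz by blast
  qed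
qed

lemma sum_C: "(\<Sum>F | F facet_of K. f F) = (\<Sum>v\<in>C. f (face v))"
proof -
  have "{F. F facet_of K} = face ` C" by (auto simp: facet_iff)
  then show ?thesis using sum.reindex[OF face_inj, of f] by simp
qed

text \<open>Affine functions are determined by their values at the vertices.\<close>

lemma bary_eq:
  assumes v: "v \<in> C"
  shows "bary K (face v) = lam v"
  unfolding bary_def
proof (rule the_equality)
  have "lam v p = 1" if "p extreme_point_of K" "p \<notin> face v" for p
    using that v vertex_in_face[OF v, of p] lam_vertex[OF v, of p] by (auto simp: extreme_point_iff)
  moreover have "lam v x = 0" if "x \<in> face v" for x
    using affine_hull_face[OF v] hull_inc[OF that, of affine] by auto
  ultimately show "(\<exists>a c. lam v = (\<lambda>x. a \<bullet> x + c)) \<and> (\<forall>x\<in>face v. lam v x = 0) \<and>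
    (\<forall>p. p extreme_point_of K \<and> p \<notin> face v \<longrightarrow> lam v p = 1)"
    by (auto simp: lam_def fun_eq_iff)
next
  fix l assume l: "(\<exists>a c. l = (\<lambda>x. a \<bullet> x + c)) \<and> (\<forall>x\<in>face v. l x = 0) \<and>
    (\<forall>p. p extreme_point_of K \<and> p \<notin> face v \<longrightarrow> l p = 1)"
  then obtain a c where ac: "l = (\<lambda>x. a \<bullet> x + c)" by blast
  have lv: "l w = lam v w" if "w \<in> C" for w
    using l vertex_in_face[OF v that] that by (auto simp: extreme_point_iff lam_vertex[OF v that])
  show "l = lam v"
  proof
    fix x
    have "l x = a \<bullet> (\<Sum>w\<in>C. lam w x *\<^sub>R w) + c * (\<Sum>w\<in>C. lam w x)"
      by (simp add: lam_repr lam_sum ac)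
    also have "\<dots> = (\<Sum>w\<in>C. lam w x * l w)"
      by (simp add: ac inner_sum_right sum_distrib_left distrib_left sum.distrib mult.commute)
    also have "\<dots> = (\<Sum>w\<in>C. lam w x * lam v w)" using lv by simp
    also have "\<dots> = lam v (\<Sum>w\<in>C. lam w x *\<^sub>R w)"
      by (rule lam_affine_combination[OF finC lam_sum, symmetric])
    finally show "l x = lam v x" by (simp add: lam_repr)
  qed
qed

lemma bubble_eq: "bubble K x = (\<Prod>v\<in>C. lam v x)"
proof -
  have "{F. F facet_of K} = face ` C" by (auto simp: facet_iff)
  then show ?thesis unfolding bubble_def using prod.reindex[OF face_inj, of "\<lambda>F. bary K F x"] by (simp add: bary_eq)
qed

lemma face_bubble_eq: "v \<in> C \<Longrightarrow> face_bubble K (face v) x = (\<Prod>w\<in>C-{v}. lam w x)"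
proof -
  assume v: "v \<in> C"
  have "{G. G facet_of K \<and> G \<noteq> face v} = face ` (C - {v})"
    using v inj_onD[OF face_inj] by (auto simp: facet_iff)
  moreover have "inj_on face (C - {v})" using face_inj inj_on_subset by blast
  ultimately show ?thesis
    unfolding face_bubble_def using prod.reindex[of face "C - {v}" "\<lambda>F. bary K F x"] by (simp add: bary_eq)
qed

lemma bubble_factor: "v \<in> C \<Longrightarrow> bubble K x = lam v x * face_bubble K (face v) x"
  by (simp add: bubble_eq face_bubble_eq prod.remove[OF finC])

text \<open>The defining inequalities determine a unit normal \<open>n\<close>: the function
  \<open>n \<bullet> x\<close> is constant on the face, hence an affine function of \<open>lam v\<close>, with nonpositive slope.\<close>

lemma outward_normal_eq:
  assumes v: "v \<in> C"
  shows "outward_normal K (face v) = - (1 / norm (grad v)) *\<^sub>R grad v"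
  unfolding outward_normal_def
proof (rule the_equality)
  have n0: "norm (grad v) > 0" using grad_nonzero[OF v] by simp
  show "norm (- (1 / norm (grad v)) *\<^sub>R grad v) = 1 \<and>
    (\<forall>x\<in>face v. \<forall>y\<in>K. (- (1 / norm (grad v)) *\<^sub>R grad v) \<bullet> (y - x) \<le> 0)"
  proof (intro conjI ballI)
    fix x y assume x: "x \<in> face v" and y: "y \<in> K"
    have "lam v x = 0" using affine_hull_face[OF v] hull_inc[OF x, of affine] by auto
    moreover have "lam v y \<ge> 0" using y v by (simp add: K_eq)
    ultimately have "grad v \<bullet> (y - x) \<ge> 0" by (simp add: lam_def inner_diff_right)
    then show "(- (1 / norm (grad v)) *\<^sub>R grad v) \<bullet> (y - x) \<le> 0" using n0 by simp
  qed (use n0 in simp)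
next
  fix n assume n: "norm n = 1 \<and> (\<forall>x\<in>face v. \<forall>y\<in>K. n \<bullet> (y - x) \<le> 0)"
  obtain i j l where C: "C = {v, i, j, l}" and d: "distinct [v, i, j, l]" by (rule four_vertices[OF v])
  have "i \<in> C" "j \<in> C" "l \<in> C" by (subst C, simp)+
  then have inF: "i \<in> face v" "j \<in> face v" "l \<in> face v" using d by (auto simp: vertex_in_face v)
  have inK: "v \<in> K" using v by (auto simp: K_def hull_inc)
  have le: "n \<bullet> (y - x) \<le> 0" if "x \<in> face v" "y \<in> face v" for x y
    using n that face_subset_K by blast
  have eq: "n \<bullet> x = n \<bullet> i" if "x \<in> face v" for x
    using le[OF that inF(1)] le[OF inF(1) that] by (simp add: inner_diff_right)
  define t where "t = n \<bullet> (v - i)"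
  have t: "t \<le> 0" using n inF(1) inK by (auto simp: t_def)
  have par: "n = t *\<^sub>R grad v"
  proof -
    have "n \<bullet> x - n \<bullet> i = t * lam v x" for x
    proof -
      have nw: "n \<bullet> w - n \<bullet> i = t * lam v w" if "w \<in> C" for w
        using that eq[of w] vertex_in_face[OF v that] lam_vertex[OF v that]
        by (cases "w = v") (auto simp: t_def inner_diff_right)
      have "n \<bullet> x - n \<bullet> i = n \<bullet> (\<Sum>w\<in>C. lam w x *\<^sub>R w) - (n \<bullet> i) * (\<Sum>w\<in>C. lam w x)"
        by (simp add: lam_repr lam_sum)
      also have "\<dots> = (\<Sum>w\<in>C. lam w x * (n \<bullet> w - n \<bullet> i))"
        by (simp add: inner_sum_right sum_distrib_left right_diff_distrib sum_subtractf mult.commute)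
      also have "\<dots> = (\<Sum>w\<in>C. t * (lam w x * lam v w))" using nw by (simp add: mult_ac)
      also have "\<dots> = t * lam v (\<Sum>w\<in>C. lam w x *\<^sub>R w)"
        by (simp add: lam_affine_combination[OF finC lam_sum] sum_distrib_left)
      finally show ?thesis by (simp add: lam_repr)
    qed
    from this[of "n - t *\<^sub>R grad v"] this[of 0]
    have "(n - t *\<^sub>R grad v) \<bullet> (n - t *\<^sub>R grad v) = 0"
      by (simp add: lam_def inner_diff_right inner_diff_left inner_commute algebra_simps)
    then show ?thesis by simp
  qed
  then have "\<bar>t\<bar> * norm (grad v) = 1" using n by (metis norm_scaleR)
  then have "t = - (1 / norm (grad v))" using t grad_nonzero[OF v] by (simp add: field_simps)
  with par show "n = - (1 / norm (grad v)) *\<^sub>R grad v" by simp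
qed

lemma centroid_pos:
  assumes D: "D \<subseteq> C" "D \<noteq> {}"
  shows "\<exists>x. (\<forall>w\<in>D. 0 < lam w x) \<and> (\<forall>w\<in>C-D. lam w x = 0)"
proof -
  have f: "finite D" using finC D finite_subset by blast
  let ?u = "\<lambda>w. 1 / real (card D)"
  have c: "card D > 0" using f D(2) by (simp add: card_gt_0_iff)
  then have s: "sum ?u D = 1" by simp
  show ?thesis
    using lam_affine_combination_vertices[OF D(1) s] c D(1)
    by (intro exI[of _ "\<Sum>w\<in>D. ?u w *\<^sub>R w"]) auto
qed

lemma cell_K: "cell C (\<lambda>v x. grad v \<bullet> x) offset K"
proof
  show "compact K" unfolding K_def using finC by (intro compact_convex_hull finite_imp_compact)
  show "K = {x. \<forall>i\<in>C. 0 \<le> grad i \<bullet> x + offset i}" by (simp add: K_eq lam_def)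
  have "C \<noteq> {}" using card4 by auto
  from centroid_pos[OF order_refl this] show "\<exists>x. \<forall>i\<in>C. 0 < grad i \<bullet> x + offset i" by (auto simp: lam_def)
qed (auto simp: finC inner_add_right)

lemma aff_dim_sub: "D \<subseteq> C \<Longrightarrow> aff_dim (convex hull D) = int (card D) - 1"
  using aff_dim_affine_independent[of D] affine_dependent_subset[of D C] indep by (cases "affine_dependent D") (auto simp: aff_dim_convex_hull)

text \<open>In an isometric chart every face of the simplex is a polyhedral cell of full dimension, with
  the barycentric coordinates of its vertices as defining functions.\<close>

lemma cell_chart:
  fixes J :: "'p::euclidean_space \<Rightarrow> real^3"
  assumes D: "D \<subseteq> C" "D \<noteq> {}" and J: "linear J" "\<And>s. \<phi> s = J s + \<phi> 0" "\<And>s t. J s \<bullet> J t = s \<bullet> t"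
    and range: "range \<phi> = affine hull D"
  shows "cell D (\<lambda>w s. grad w \<bullet> J s) (\<lambda>w. lam w (\<phi> 0)) (\<phi> -` (convex hull D))"
proof (rule cell.intro)
  have lam_eq: "grad w \<bullet> J s + lam w (\<phi> 0) = lam w (\<phi> s)" for w s
    by (subst J(2)[of s]) (simp add: lam_def inner_add_right)
  have off0: "lam w (\<phi> s) = 0" if "w \<in> C - D" for w s
    using range affine_hull_sub[OF D(1)] that by auto
  show "finite D" using finC D finite_subset by blast
  show "linear (\<lambda>s. grad w \<bullet> J s)" if "w \<in> D" for w
    using linear_compose[OF J(1) linear_inner[of "grad w"]] by (simp add: o_def)
  show "\<phi> -` (convex hull D) = {x. \<forall>i\<in>D. 0 \<le> grad i \<bullet> J x + lam i (\<phi> 0)}"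
    unfolding lam_eq convex_hull_sub[OF D(1)] using off0 by auto
  have inj: "norm (\<phi> s - \<phi> t) = norm (s - t)" for s t
  proof -
    have "\<phi> s - \<phi> t = J (s - t)" by (subst J(2)[of s], subst J(2)[of t]) (simp add: linear_diff[OF J(1)])
    then show ?thesis by (simp add: norm_eq_sqrt_inner J(3))
  qed
  have cpt: "compact (convex hull D)" using \<open>finite D\<close> by (intro compact_convex_hull finite_imp_compact)
  have "continuous_on UNIV \<phi>"
  proof -
    have "continuous_on UNIV (\<lambda>s. J s + \<phi> 0)"
      using J(1) by (intro continuous_intros linear_continuous_on) (simp add: linear_linear)
    then show ?thesis by (simp flip: J(2))
  qed
  then have "closed (\<phi> -` (convex hull D))"
    using compact_imp_closed[OF cpt] by (intro closed_vimage) auto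
  moreover have "bounded (\<phi> -` (convex hull D))"
  proof -
    obtain B where B: "\<And>x. x \<in> convex hull D \<Longrightarrow> norm x \<le> B"
      using compact_imp_bounded[OF cpt] by (auto simp: bounded_iff)
    have "norm s \<le> B + norm (\<phi> 0)" if "\<phi> s \<in> convex hull D" for s
      using inj[of s 0] B[OF that] norm_triangle_ineq4[of "\<phi> s" "\<phi> 0"] by simp
    then show ?thesis by (auto simp: bounded_iff)
  qed
  ultimately show "compact (\<phi> -` (convex hull D))" by (simp add: compact_eq_bounded_closed)
  obtain x where x: "\<forall>w\<in>D. 0 < lam w x" "\<forall>w\<in>C-D. lam w x = 0" using centroid_pos[OF D] by blast
  then have "x \<in> range \<phi>" using range affine_hull_sub[OF D(1)] by auto
  then obtain s where "x = \<phi> s" by blast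
  then show "\<exists>s. \<forall>i\<in>D. 0 < grad i \<bullet> J s + lam i (\<phi> 0)" unfolding lam_eq using x(1) by blast
qed

end

section \<open>Unisolvence of the Nedelec element\<close>

lemma restr_UNIV: "affine hull S = UNIV \<Longrightarrow> restr S f = f"
  by (rule ext) (simp add: restr_def)

lemma restr_apply: "x \<in> affine hull S \<Longrightarrow> restr S f x = f x"
  by (simp add: restr_def)

lemma vpolyfun_id: "vpolyfun 1 (\<lambda>x. x)"
  unfolding vpolyfun_def by (auto intro: polyfun_linear[OF linear_inner] simp: inner_commute)

lemma tangential_part: "n \<bullet> n = 1 \<Longrightarrow> n \<bullet> d = 0 \<Longrightarrow> (n \<times> d) \<times> n = d"
  for n d :: "real^3"
proof -
  assume n: "n \<bullet> n = 1" and d: "n \<bullet> d = 0"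
  have "(n \<times> d) \<times> n = (n \<bullet> n) *\<^sub>R d - (n \<bullet> d) *\<^sub>R n"
    by (simp only: cross3_simps forall_3) (simp add: algebra_simps)
  then show ?thesis using n d by simp
qed

lemma cross_inner_cross: "(a \<times> n) \<bullet> (d \<times> n) = (a \<bullet> d) * (n \<bullet> n) - (a \<bullet> n) * (n \<bullet> d)"
  for a d n :: "real^3"
  by (simp only: cross3_simps) (simp add: algebra_simps)

context tetra
begin

lemma vpoly_space_K: "vpoly_space m K = {u. vpolyfun m u}"
  unfolding vpoly_space_eq by (simp add: restr_UNIV[OF affine_hull_K])

lemma zero_on_K:
  assumes "polyfun m f" "\<And>x. x \<in> K \<Longrightarrow> f x = 0"
  shows "f x = 0"
proof -
  interpret cell C "\<lambda>v x. grad v \<bullet> x" offset K by (rule cell_K)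
  show ?thesis by (rule polyfun_zero_on_open[OF assms(1) open_pos pos_nonempty]) (use assms(2) pos_subset in blast)
qed

text \<open>In \<open>u = p + v\<close> with \<open>v \<bullet> x = 0\<close> only \<open>p\<close>, of degree \<open>k\<close>, contributes to \<open>u \<bullet> x\<close>; moving
  the origin to \<open>a\<close> changes this product by \<open>u \<bullet> a\<close>, again of degree \<open>k + 1\<close>.\<close>

lemma nedelec_degrees:
  assumes "u \<in> nedelec k K"
  shows "vpolyfun (k + 1) u" "polyfun (k + 1) (\<lambda>x. u x \<bullet> (x - a))"
proof -
  from assms obtain p v where u: "u = p + v" and p: "vpolyfun k p" and v: "vpolyfun (k + 1) v"
    and vx: "\<forall>x\<in>K. v x \<bullet> x = 0"
    unfolding nedelec_def vpoly_space_K by (auto elim!: set_plus_elim)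
  have "polyfun (k + 1 + 1) (\<lambda>x. v x \<bullet> x)" by (rule vpolyfun_inner[OF v vpolyfun_id])
  then have vx0: "v x \<bullet> x = 0" for x by (rule zero_on_K) (use vx in blast)
  show u1: "vpolyfun (k + 1) u"
    unfolding u plus_fun_def by (intro vpolyfun_add v vpolyfun_mono[OF p]) simp
  have "polyfun (k + 1) (\<lambda>x. p x \<bullet> x)" by (rule vpolyfun_inner[OF p vpolyfun_id])
  moreover have "polyfun (k + 1) (\<lambda>x. u x \<bullet> a)" by (rule vpolyfunD[OF u1])
  ultimately have "polyfun (k + 1) (\<lambda>x. p x \<bullet> x - u x \<bullet> a)" by (rule polyfun_diff)
  moreover have "u x \<bullet> (x - a) = p x \<bullet> x - u x \<bullet> a" for x
    by (simp add: u inner_diff_right inner_add_left vx0)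
  ultimately show "polyfun (k + 1) (\<lambda>x. u x \<bullet> (x - a))" by simp
qed

lemma edge_iff: "e edge_of K \<longleftrightarrow> (\<exists>p q. p \<in> C \<and> q \<in> C \<and> p \<noteq> q \<and> e = convex hull {p, q})"
proof
  assume "e edge_of K"
  then obtain D where D: "D \<subseteq> C" "e = convex hull D" "aff_dim e = 1"
    unfolding edge_of_def K_def face_of_convex_hull_affine_independent[OF indep] by blast
  then have "card D = 2" using aff_dim_sub[OF D(1)] by simp
  then obtain p q where "D = {p, q}" "p \<noteq> q" by (auto simp: card_2_iff)
  with D show "\<exists>p q. p \<in> C \<and> q \<in> C \<and> p \<noteq> q \<and> e = convex hull {p, q}" by auto
next
  assume "\<exists>p q. p \<in> C \<and> q \<in> C \<and> p \<noteq> q \<and> e = convex hull {p, q}"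
  then obtain p q where pq: "p \<in> C" "q \<in> C" "p \<noteq> q" "e = convex hull {p, q}" by blast
  then have "{p, q} \<subseteq> C" by simp
  then show "e edge_of K"
    unfolding edge_of_def K_def face_of_convex_hull_affine_independent[OF indep]
    using aff_dim_sub[of "{p, q}"] pq by (intro conjI exI[of _ "{p, q}"]) auto
qed

lemma chart:
  assumes "D \<subseteq> C" "card D = DIM('p::euclidean_space) + 1"
  shows "\<exists>J. linear J \<and> (\<forall>s. (isometric_chart (convex hull D) :: 'p \<Rightarrow> real^3) s = J s + isometric_chart (convex hull D) (0 :: 'p)) \<and>
    (\<forall>s t :: 'p. J s \<bullet> J t = s \<bullet> t) \<and> range (isometric_chart (convex hull D) :: 'p \<Rightarrow> real^3) = affine hull D \<and>
    cell D (\<lambda>w s. grad w \<bullet> J s) (\<lambda>w. lam w (isometric_chart (convex hull D) (0 :: 'p)))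
      ((isometric_chart (convex hull D) :: 'p \<Rightarrow> real^3) -` (convex hull D))"
proof -
  have "aff_dim (convex hull D) = int DIM('p)" using aff_dim_sub[OF assms(1)] assms(2) by simp
  from isometric_chart_props[OF this] obtain J where J: "linear J"
    "\<And>s. (isometric_chart (convex hull D) :: 'p \<Rightarrow> real^3) s = J s + isometric_chart (convex hull D) (0 :: 'p)"
    "\<And>s t :: 'p. J s \<bullet> J t = s \<bullet> t" "range (isometric_chart (convex hull D) :: 'p \<Rightarrow> real^3) = affine hull D"
    unfolding affine_hull_convex_hull by blast
  have "D \<noteq> {}" using assms(2) by auto
  from cell_chart[OF assms(1) this J] J show ?thesis by blast
qed

lemma card_face: "v \<in> C \<Longrightarrow> C - {v} \<subseteq> C \<and> card (C - {v}) = DIM(real^2) + 1"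
  using card4 finC by auto

lemma face_chart:
  assumes v: "v \<in> C"
  defines "\<phi> \<equiv> isometric_chart (face v) :: real^2 \<Rightarrow> real^3"
  shows "\<exists>J. linear J \<and> (\<forall>s. \<phi> s = J s + \<phi> 0) \<and> (\<forall>s t. J s \<bullet> J t = s \<bullet> t) \<and>
    (\<forall>w s. grad w \<bullet> J s + lam w (\<phi> 0) = lam w (\<phi> s)) \<and> (\<forall>s. lam v (\<phi> s) = 0) \<and>
    range \<phi> = {x. lam v x = 0} \<and> (\<forall>s. \<phi> s \<in> affine hull (face v)) \<and>
    cell (C - {v}) (\<lambda>w s. grad w \<bullet> J s) (\<lambda>w. lam w (\<phi> 0)) (\<phi> -` (face v))"
proof -
  note D = card_face[OF v, THEN conjunct1] card_face[OF v, THEN conjunct2]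
  from chart[OF D] obtain J where J: "linear J" "\<And>s. \<phi> s = J s + \<phi> 0" "\<And>s t. J s \<bullet> J t = s \<bullet> t"
    "range \<phi> = affine hull (C - {v})"
    and cell: "cell (C - {v}) (\<lambda>w s. grad w \<bullet> J s) (\<lambda>w. lam w (\<phi> 0)) (\<phi> -` (face v))"
    unfolding \<phi>_def face_def by blast
  have rng: "range \<phi> = {x. lam v x = 0}" "range \<phi> = affine hull (face v)"
    using J(4) affine_hull_face[OF v] by (simp_all add: face_def affine_hull_convex_hull)
  have "lam v (\<phi> s) = 0" "\<phi> s \<in> affine hull (face v)" for s
    using rangeI[of \<phi> s] unfolding rng(1) rng(2)[symmetric] by simp_all
  moreover have "grad w \<bullet> J s + lam w (\<phi> 0) = lam w (\<phi> s)" for w s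
    by (subst J(2)[of s]) (simp add: lam_def inner_add_right)
  ultimately show ?thesis using J rng cell by blast
qed

text \<open>In arc length coordinates the tangential component has degree \<open>k\<close>, so it is itself an admissible
  test function.\<close>

lemma edge_trace_zero:
  assumes u: "vpolyfun (k + 1) u" "\<And>a. polyfun (k + 1) (\<lambda>x. u x \<bullet> (x - a))"
    and pq: "p \<in> C" "q \<in> C" "p \<noteq> q" and t: "unit_tangent (convex hull {p, q}) t"
    and dof: "\<And>\<kappa>. \<kappa> \<in> poly_space k (convex hull {p, q}) \<Longrightarrow> L2_edge (convex hull {p, q}) (\<lambda>x. u x \<bullet> t) \<kappa> = 0"
    and x: "x \<in> affine hull {p, q}"
  shows "u x \<bullet> (q - p) = 0"
proof -
  let ?e = "convex hull {p, q}"
  define \<phi> where "\<phi> = (isometric_chart ?e :: real \<Rightarrow> real^3)"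
  have D: "{p, q} \<subseteq> C" "card {p, q} = DIM(real) + 1" using pq by auto
  from chart[OF D] obtain J where J: "linear J" "\<And>s. \<phi> s = J s + \<phi> 0" "\<And>s t. J s \<bullet> J t = s \<bullet> t"
    "range \<phi> = affine hull {p, q}"
    and cell: "cell {p, q} (\<lambda>w s. grad w \<bullet> J s) (\<lambda>w. lam w (\<phi> 0)) (\<phi> -` ?e)"
    unfolding \<phi>_def by blast
  interpret cell "{p, q}" "\<lambda>w s. grad w \<bullet> J s" "\<lambda>w. lam w (\<phi> 0)" "\<phi> -` ?e" by (rule cell)
  define \<tau> where "\<tau> = J 1"
  have Js: "J s = s *\<^sub>R \<tau>" for s using linear_scale[OF J(1), of s 1] by (simp add: \<tau>_def)
  have \<tau>: "\<tau> \<bullet> \<tau> = 1" using J(3)[of 1 1] by (simp add: \<tau>_def)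
  have \<phi>: "\<phi> s = s *\<^sub>R \<tau> + \<phi> 0" for s using J(2)[of s] Js by simp
  have lin: "linear (\<lambda>s. s *\<^sub>R \<tau>)" by (rule linearI) (auto simp: scaleR_add_left)
  define g where "g s = u (\<phi> s) \<bullet> \<tau>" for s
  have g1: "polyfun (k + 1) g"
    using polyfun_compose_affine[OF vpolyfunD[OF u(1), of \<tau>] lin, of "\<phi> 0"]
    unfolding g_def by (simp flip: \<phi>)
  moreover have "polyfun (k + 1) (\<lambda>s. s * g s)"
  proof -
    have "\<phi> s - \<phi> 0 = s *\<^sub>R \<tau>" for s by (subst \<phi>) simp
    then show ?thesis
      using polyfun_compose_affine[OF u(2)[of "\<phi> 0"] lin, of "\<phi> 0"]
      unfolding g_def by (simp flip: \<phi>)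
  qed
  ultimately have g: "polyfun k g" by (rule edge_trace_degree)
  have aff: "affine hull ?e = range \<phi>" using J(4) by (simp add: affine_hull_convex_hull)
  have onrange: "\<exists>s. y = \<phi> s" if "y \<in> affine hull ?e" for y using that aff by auto
  from t obtain y z c where yz: "y \<in> ?e" "z \<in> ?e" "t = c *\<^sub>R (z - y)" and nt: "norm t = 1"
    unfolding unit_tangent_def by blast
  obtain sy sz where s: "y = \<phi> sy" "z = \<phi> sz" using onrange yz(1,2) hull_inc by metis
  \<comment> \<open>The given tangent agrees with that of the chart up to a nonzero factor.\<close>
  define d where "d = c * (sz - sy)"
  have td: "t = d *\<^sub>R \<tau>"
    unfolding yz(3) s d_def by (subst \<phi>[of sz], subst \<phi>[of sy]) (simp add: algebra_simps)
  have d: "d \<noteq> 0" using nt td by auto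
  define \<kappa> where "\<kappa> = restr ?e (\<lambda>x. g (\<tau> \<bullet> x + - (\<tau> \<bullet> \<phi> 0)))"
  have "polyfun k (\<lambda>x. g (\<tau> \<bullet> x + - (\<tau> \<bullet> \<phi> 0)))"
    by (rule polyfun_compose_affine[OF g linear_inner])
  then have "\<kappa> \<in> poly_space k ?e" unfolding poly_space_eq \<kappa>_def by blast
  from dof[OF this] have "L2_edge ?e (\<lambda>x. u x \<bullet> t) \<kappa> = 0" .
  moreover have "(u (\<phi> s) \<bullet> t) \<bullet> \<kappa> (\<phi> s) = d * (1 * (g s * g s))" for s
  proof -
    have "\<kappa> (\<phi> s) = g (\<tau> \<bullet> \<phi> s + - (\<tau> \<bullet> \<phi> 0))" using aff by (simp add: \<kappa>_def restr_apply)
    also have "\<tau> \<bullet> \<phi> s + - (\<tau> \<bullet> \<phi> 0) = s" by (subst \<phi>[of s]) (simp add: inner_add_right \<tau>)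
    finally show ?thesis by (simp add: td g_def)
  qed
  ultimately have "(LINT s:\<phi> -` ?e|lborel. d * (1 * (g s * g s))) = 0"
    unfolding L2_edge_def Let_def \<phi>_def[symmetric] by simp
  then have "(LINT s:\<phi> -` ?e|lborel. 1 * (g s * g s)) = 0" using d by simp
  then have g0: "g s = 0" for s
    by (intro weighted_square_zero_real[OF _ _ _ g, of "\<lambda>_. 1"]) auto
  have "x \<in> affine hull ?e" "p \<in> affine hull ?e" "q \<in> affine hull ?e"
    using x by (auto simp: affine_hull_convex_hull hull_inc)
  then obtain sx sp sq where s: "x = \<phi> sx" "p = \<phi> sp" "q = \<phi> sq" using onrange by metis
  have "q - p = (sq - sp) *\<^sub>R \<tau>"
    unfolding s(2,3) by (subst \<phi>[of sq], subst \<phi>[of sp]) (simp add: algebra_simps)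
  then show ?thesis using g0[of sx] by (simp add: s(1) g_def)
qed

text \<open>A direction along which the coordinates of \<open>v\<close> and \<open>w\<close> are constant is that of the opposite edge.\<close>

lemma direction_of_edge:
  assumes C: "C = {v, w, p, q}" and d: "distinct [v, w, p, q]" and z: "grad v \<bullet> d = 0" "grad w \<bullet> d = 0"
  shows "d = (grad q \<bullet> d) *\<^sub>R (q - p)"
proof -
  have in_C: "v \<in> C" "w \<in> C" "p \<in> C" "q \<in> C" by (subst C, simp)+
  have "(\<Sum>v\<in>{v, w, p, q}. grad v) = 0" using grad_sum C by simp
  then have "grad v + (grad w + (grad p + grad q)) = 0" using d by simp
  then have "(grad v + (grad w + (grad p + grad q))) \<bullet> d = 0" by simp
  then have s: "grad p \<bullet> d = - (grad q \<bullet> d)" using z by (simp add: inner_add_left)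
  have e: "grad v \<bullet> (q - p) = 0" "grad w \<bullet> (q - p) = 0" "grad p \<bullet> (q - p) = -1" "grad q \<bullet> (q - p) = 1"
    using d by (auto simp: grad_diff[OF in_C(4) _ in_C(3)] in_C)
  have "grad x \<bullet> (d - (grad q \<bullet> d) *\<^sub>R (q - p)) = 0" if "x \<in> {v, w, p, q}" for x
    using that unfolding inner_diff_right[of _ d] inner_scaleR_right
    by (elim insertE emptyE) (simp_all add: e z s)
  then have "grad x \<bullet> (d - (grad q \<bullet> d) *\<^sub>R (q - p)) = 0" if "x \<in> C" for x
    using that by (subst (asm) C)
  from grad_zero_imp_zero[OF this] show ?thesis by simp
qed

definition unit_normal :: "real^3 \<Rightarrow> real^3" where "unit_normal v = outward_normal K (face v)"

lemma unit_normal_unit: "v \<in> C \<Longrightarrow> unit_normal v \<bullet> unit_normal v = 1"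
  using grad_nonzero by (simp add: unit_normal_def outward_normal_eq dot_square_norm power2_eq_square)

lemma unit_normal_inner: "v \<in> C \<Longrightarrow> unit_normal v \<bullet> d = - (1 / norm (grad v)) * (grad v \<bullet> d)"
  by (simp add: unit_normal_def outward_normal_eq)

text \<open>The chart \<open>\<phi>\<close> with linear part \<open>J\<close> turns the statement into the planar one for \<open>U = J\<^sup>T u \<circ> \<phi>\<close>.
  A planar test field \<open>\<nu>\<close> corresponds to \<open>\<mu> = J\<nu> \<times> n\<close> on the face, because
  \<open>(u \<times> n) \<bullet> (J\<nu> \<times> n) = u \<bullet> J\<nu>\<close> for tangential \<open>J\<nu>\<close>.\<close>

lemma face_trace_zero:
  assumes v: "v \<in> C" and k: "1 \<le> k"
    and u: "vpolyfun (k + 1) u" "\<And>a. polyfun (k + 1) (\<lambda>x. u x \<bullet> (x - a))"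
    and edge: "\<And>p q x. p \<in> C \<Longrightarrow> q \<in> C \<Longrightarrow> p \<noteq> q \<Longrightarrow> x \<in> affine hull {p, q} \<Longrightarrow> u x \<bullet> (q - p) = 0"
    and dof: "\<And>\<mu>. \<mu> \<in> tangential_space (k - 1) K (face v) \<Longrightarrow>
      L2_face (face v) (\<lambda>x. u x \<times> unit_normal v) \<mu> = 0"
    and x: "lam v x = 0"
  shows "u x \<times> grad v = 0"
proof -
  define \<phi> where "\<phi> = (isometric_chart (face v) :: real^2 \<Rightarrow> real^3)"
  note D = card_face[OF v, THEN conjunct1] card_face[OF v, THEN conjunct2]
  from face_chart[OF v] obtain J where J: "linear J" "\<And>s. \<phi> s = J s + \<phi> 0" "\<And>s t. J s \<bullet> J t = s \<bullet> t"
    and lamJ: "\<And>w s. grad w \<bullet> J s + lam w (\<phi> 0) = lam w (\<phi> s)" and lamv: "\<And>s. lam v (\<phi> s) = 0"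
    and rng: "range \<phi> = {x. lam v x = 0}" and aff: "\<And>s. \<phi> s \<in> affine hull (face v)"
    and cell: "cell (C - {v}) (\<lambda>w s. grad w \<bullet> J s) (\<lambda>w. lam w (\<phi> 0)) (\<phi> -` (face v))"
    unfolding \<phi>_def[symmetric] by blast
  have nabv: "grad v \<bullet> J s = 0" for s using lamJ[of v s] by (simp add: lamv)
  have adj: "a \<bullet> J s = adjoint J a \<bullet> s" for a s by (metis J(1) adjoint_works inner_commute)
  have adjJ: "adjoint J (J s) = s" for s
  proof -
    have "(adjoint J (J s) - s) \<bullet> t = 0" for t by (simp add: inner_diff_left adj[symmetric] J(3))
    then have "adjoint J (J s) - s = 0" using inner_eq_zero_iff by blast
    then show ?thesis by simp
  qed
  have inner2: "a \<bullet> J r = r $ 1 * (a \<bullet> J (axis 1 1)) + r $ 2 * (a \<bullet> J (axis 2 1))" for a r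
  proof -
    have "J r = J (\<Sum>j\<in>UNIV. r $ j *\<^sub>R axis j 1)"
      by (simp add: basis_expansion flip: scalar_mult_eq_scaleR)
    also have "\<dots> = r $ 1 *\<^sub>R J (axis 1 1) + r $ 2 *\<^sub>R J (axis 2 1)"
      by (simp add: sum_2 linear_add[OF J(1)] linear_scale[OF J(1)])
    finally show ?thesis by (simp add: inner_add_right)
  qed
  define U where "U s = adjoint J (u (\<phi> s))" for s
  have uphi: "vpolyfun (k + 1) (\<lambda>s. u (\<phi> s))"
    using vpolyfun_compose_affine[OF u(1) J(1), of "\<phi> 0"] by (simp flip: J(2))
  then have U: "vpolyfun (k + 1) U"
    unfolding U_def by (rule vpolyfun_compose_linear) (rule adjoint_linear[OF J(1)])
  have UJ: "U s \<bullet> d = u (\<phi> s) \<bullet> J d" for s d by (simp add: U_def adj)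
  have "polyfun (k + 1) (\<lambda>s. u (\<phi> s) \<bullet> (\<phi> s - \<phi> 0))"
    using polyfun_compose_affine[OF u(2)[of "\<phi> 0"] J(1), of "\<phi> 0"] by (simp flip: J(2))
  moreover have "\<phi> s - \<phi> 0 = J s" for s by (subst J(2)) simp
  ultimately have Us: "polyfun (k + 1) (\<lambda>s. U s \<bullet> s)" by (simp only: UJ)
  have nz: "\<exists>e. grad w \<bullet> J e \<noteq> 0" if w: "w \<in> C - {v}" for w
  proof -
    have "C - {v} \<noteq> {w}"
    proof
      assume a: "C - {v} = {w}"
      show False using D(2) unfolding a by simp
    qed
    then obtain y where y: "y \<in> C - {v}" "y \<noteq> w" using w by blast
    have "w \<in> range \<phi>" "y \<in> range \<phi>" using w y v by (simp_all add: rng lam_vertex)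
    then obtain sw sy where s: "w = \<phi> sw" "y = \<phi> sy" by blast
    have "lam w w - lam w y = grad w \<bullet> J (sw - sy)"
      using lamJ[of w sw] lamJ[of w sy] s by (simp add: linear_diff[OF J(1)] inner_diff_right)
    then have "grad w \<bullet> J (sw - sy) = 1" using w y by (simp add: lam_vertex)
    then show ?thesis by (metis zero_neq_one)
  qed
  have edge2: "grad w \<bullet> J (axis 1 1) * U s $ 2 - grad w \<bullet> J (axis 2 1) * U s $ 1 = 0"
    if w: "w \<in> C - {v}" and s: "grad w \<bullet> J s + lam w (\<phi> 0) = 0" for w s
  proof -
    have "card (C - {v} - {w}) = 2" using D(2) w finC by simp
    then obtain p q where pq: "C - {v} - {w} = {p, q}" "p \<noteq> q" by (auto simp: card_2_iff)
    have C: "C = {v, w, p, q}" "distinct [v, w, p, q]" using pq v w by auto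
    have in_C: "p \<in> C" "q \<in> C" using pq by auto
    let ?r = "vector [- (grad w \<bullet> J (axis 2 1)), grad w \<bullet> J (axis 1 1)] :: real^2"
    have "grad w \<bullet> J ?r = 0" by (subst inner2) simp
    from direction_of_edge[OF C nabv this] have Jr: "J ?r = (grad q \<bullet> J ?r) *\<^sub>R (q - p)" .
    have "C - {p, q} = {v, w}" using pq v w by auto
    then have "\<phi> s \<in> affine hull {p, q}"
      using in_C s lamJ[of w s] lamv[of s] by (subst affine_hull_sub) auto
    from edge[OF in_C pq(2) this] have "U s \<bullet> ?r = 0" unfolding UJ by (subst Jr) simp
    moreover have "U s \<bullet> vector [- a, b] = b * U s $ 2 - a * U s $ 1" for a b
      by (simp add: inner_vec_def sum_2 algebra_simps)
    ultimately show ?thesis by (simp only:)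
  qed
  obtain i j l where C: "C = {v, i, j, l}" and d: "distinct [v, i, j, l]" by (rule four_vertices[OF v])
  have ij: "i \<in> C - {v}" "j \<in> C - {v}" using d by (subst C, auto)+
  have det: "grad i \<bullet> J (axis 1 1) * (grad j \<bullet> J (axis 2 1)) \<noteq> grad i \<bullet> J (axis 2 1) * (grad j \<bullet> J (axis 1 1))"
  proof
    assume eq: "grad i \<bullet> J (axis 1 1) * (grad j \<bullet> J (axis 2 1)) = grad i \<bullet> J (axis 2 1) * (grad j \<bullet> J (axis 1 1))"
    let ?r = "vector [- (grad i \<bullet> J (axis 2 1)), grad i \<bullet> J (axis 1 1)] :: real^2"
    have "grad i \<bullet> J ?r = 0" by (subst inner2) simp
    from direction_of_edge[OF C d nabv this] have Jr: "J ?r = (grad l \<bullet> J ?r) *\<^sub>R (l - j)" .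
    have "grad j \<bullet> J ?r = 0" by (subst inner2) (use eq in \<open>simp add: algebra_simps\<close>)
    moreover have "j \<in> C" "l \<in> C" by (subst C, simp)+
    then have "grad j \<bullet> (l - j) = - 1" using d by (auto simp: grad_diff)
    moreover have "grad j \<bullet> J ?r = (grad l \<bullet> J ?r) * (grad j \<bullet> (l - j))"
      using arg_cong[OF Jr, of "\<lambda>y. grad j \<bullet> y"] by (simp only: inner_scaleR_right)
    ultimately have z: "grad l \<bullet> J ?r = 0" by simp
    from Jr have "J ?r = 0" unfolding z by simp
    then have "?r \<bullet> ?r = 0" using J(3)[of ?r ?r] by simp
    then have "?r = 0" by (simp only: inner_eq_zero_iff)
    then have "grad i \<bullet> J (axis 2 1) = 0" "grad i \<bullet> J (axis 1 1) = 0" by (auto simp: vec_eq_iff forall_2)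
    then have "grad i \<bullet> J e = 0" for e by (subst inner2) simp
    with nz[OF ij(1)] show False by blast
  qed
  have n1: "unit_normal v \<bullet> unit_normal v = 1" by (rule unit_normal_unit[OF v])
  have orth: "(LINT s:\<phi> -` (face v)|lborel. U s \<bullet> \<nu> s) = 0" if \<nu>: "vpolyfun (k - 1) \<nu>" for \<nu>
  proof -
    \<comment> \<open>The adjoint of \<open>J\<close> inverts the chart on its range.\<close>
    define m where "m = (\<lambda>x. J (\<nu> (adjoint J x + - adjoint J (\<phi> 0))) \<times> unit_normal v)"
    have "vpolyfun (k - 1) m"
      using vpolyfun_cross[OF vpolyfun_compose_linear[OF vpolyfun_compose_affine[OF \<nu> adjoint_linear[OF J(1)],
          of "- adjoint J (\<phi> 0)"] J(1)] vpolyfun_const[OF order_refl, of "unit_normal v"]]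
      unfolding m_def add_0_right .
    then have "restr (face v) m \<in> tangential_space (k - 1) K (face v)"
      unfolding tangential_space_def vpoly_space_eq
      by (auto simp: restr_def m_def unit_normal_def dot_cross_self)
    from dof[OF this] have "L2_face (face v) (\<lambda>x. u x \<times> unit_normal v) (restr (face v) m) = 0" .
    moreover have "(u (\<phi> s) \<times> unit_normal v) \<bullet> restr (face v) m (\<phi> s) = U s \<bullet> \<nu> s" for s
    proof -
      have "adjoint J (\<phi> s) + - adjoint J (\<phi> 0) = s"
        by (subst J(2)[of s]) (simp add: linear_add[OF adjoint_linear[OF J(1)]] adjJ)
      then have "restr (face v) m (\<phi> s) = J (\<nu> s) \<times> unit_normal v"
        by (simp add: restr_apply aff m_def)
      moreover have "unit_normal v \<bullet> J (\<nu> s) = 0" by (simp add: unit_normal_inner[OF v] nabv)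
      ultimately show ?thesis by (simp add: cross_inner_cross n1 UJ)
    qed
    ultimately show ?thesis unfolding L2_face_def Let_def \<phi>_def[symmetric] by simp
  qed
  have "U s = 0" for s
    by (rule nedelec_2d_zero[OF cell nz U Us _ edge2 ij det orth]) (use k in auto)
  moreover have "x \<in> range \<phi>" using x rng by simp
  then obtain s where s: "x = \<phi> s" by blast
  ultimately have uJ: "u x \<bullet> J d = 0" for d using UJ[of s d] by simp
  \<comment> \<open>Testing \<open>u x\<close> with the tangential direction \<open>grad v \<times> z\<close> produces the square norm of \<open>z\<close>.\<close>
  let ?z = "u x \<times> grad v"
  have "lam v (\<phi> 0 + grad v \<times> ?z) = lam v (\<phi> 0)" by (simp add: lam_def inner_add_right dot_cross_self)
  also have "\<dots> = 0" by (rule lamv)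
  finally have "\<phi> 0 + grad v \<times> ?z \<in> range \<phi>" by (simp add: rng)
  then obtain r where "\<phi> 0 + grad v \<times> ?z = \<phi> r" by blast
  then have "grad v \<times> ?z = J r" using J(2)[of r] by (simp add: add.commute)
  then have "u x \<bullet> (grad v \<times> ?z) = 0" using uJ by simp
  moreover have "u x \<bullet> (grad v \<times> ?z) = ?z \<bullet> ?z"
    by (simp only: cross3_simps) (simp add: algebra_simps)
  ultimately show ?thesis by simp
qed

text \<open>Unisolvence of the Nedelec element: the moments determine successively the traces on edges, on faces,
  and the field in the cell.\<close>

lemma nedelec_zero:
  assumes "u \<in> nedelec k K" and k: "1 \<le> k" and t: "\<And>e. e edge_of K \<Longrightarrow> unit_tangent e (t e)"
    and edge: "\<And>e \<kappa>. e edge_of K \<Longrightarrow> \<kappa> \<in> poly_space k e \<Longrightarrow> L2_edge e (\<lambda>x. u x \<bullet> t e) \<kappa> = 0"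
    and face: "\<And>v \<mu>. v \<in> C \<Longrightarrow> \<mu> \<in> tangential_space (k - 1) K (face v) \<Longrightarrow>
      L2_face (face v) (\<lambda>x. u x \<times> unit_normal v) \<mu> = 0"
    and inner: "\<And>\<rho>. vpolyfun (k - 2) \<rho> \<Longrightarrow> L2_cell K u \<rho> = 0"
  shows "u x = 0"
proof -
  note u = nedelec_degrees[OF assms(1)]
  have e: "u x \<bullet> (q - p) = 0" if "p \<in> C" "q \<in> C" "p \<noteq> q" "x \<in> affine hull {p, q}" for p q x
  proof -
    have "convex hull {p, q} edge_of K" using that by (auto simp: edge_iff)
    from edge_trace_zero[OF u that(1-3) t[OF this] edge[OF this] that(4)] show ?thesis .
  qed
  have f: "u x \<times> grad v = 0" if "v \<in> C" "grad v \<bullet> x + offset v = 0" for v x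
    using face_trace_zero[OF that(1) k u e face[OF that(1)]] that(2) by (simp add: lam_def)
  have "C \<noteq> {}" using card4 by auto
  then obtain m where m: "m \<in> C" by blast
  obtain i j l where C: "C = {m, i, j, l}" and d: "distinct [m, i, j, l]" by (rule four_vertices[OF m])
  have in_C: "i \<in> C" "j \<in> C" "l \<in> C" by (subst C, simp)+
  have ux: "polyfun (k + 1) (\<lambda>x. u x \<bullet> x)" using u(2)[of 0] by simp
  have "0 \<le> k" using k by simp
  from nedelec_3d_zero[OF cell_K grad_nonzero u(1) ux this f in_C grad_triple_nonzero(1)[OF C d]
      inner[unfolded L2_cell_def]]
  show ?thesis by blast
qed

end

section \<open>Dimensions of subspaces of function spaces\<close>

lemma subspace_set_plus:
  assumes "subspace V" "subspace W"
  shows "subspace (V + W)"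
proof -
  have "V + W = {x + y |x y. x \<in> V \<and> y \<in> W}" by (auto simp: set_plus_def)
  then show ?thesis using subspace_sums[OF assms] by simp
qed

lemma subspace_set_sum:
  assumes "\<And>i. i \<in> I \<Longrightarrow> subspace (V i)"
  shows "subspace (\<Sum>i\<in>I. V i)"
  using assms
proof (induction I rule: infinite_finite_induct)
  case (insert i I)
  then show ?case by (simp add: subspace_set_plus)
qed (simp_all add: set_zero)

lemma fin_dim_basis:
  assumes "fin_dim V"
  obtains B where "finite B" "B \<subseteq> V" "independent B" "V \<subseteq> span B" "card B = dim V"
proof -
  obtain B where B: "B \<subseteq> V" "independent B" "V \<subseteq> span B" "card B = dim V"
    using basis_exists by blast
  obtain A where "finite A" "V \<subseteq> span A" using assms by (auto simp: fin_dim_def)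
  then have "finite B" using independent_span_bound[of A B] B by blast
  with B show ?thesis by (rule that[rotated])
qed

lemma dim_set_plus_direct:
  assumes V: "subspace V" "fin_dim V" and W: "subspace W" "fin_dim W" and VW: "V \<inter> W \<subseteq> {0}"
  shows "dim (V + W) = dim V + dim W"
proof -
  obtain A where A: "finite A" "A \<subseteq> V" "independent A" "V \<subseteq> span A" "card A = dim V"
    by (rule fin_dim_basis[OF V(2)])
  obtain B where B: "finite B" "B \<subseteq> W" "independent B" "W \<subseteq> span B" "card B = dim W"
    by (rule fin_dim_basis[OF W(2)])
  have disj: "A \<inter> B = {}"
  proof (rule ccontr)
    assume "A \<inter> B \<noteq> {}"
    then obtain x where "x \<in> A" "x \<in> B" by blast
    then have "x = 0" using A(2) B(2) VW by blast
    with \<open>x \<in> A\<close> A(3) show False using dependent_zero by blast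
  qed
  have "independent (A \<union> B)"
    unfolding dependent_finite[OF finite_UnI[OF A(1) B(1)]]
  proof clarify
    fix u x assume x: "x \<in> A \<union> B" "u x \<noteq> 0" and z: "(\<Sum>v\<in>A \<union> B. u v *\<^sub>R v) = 0"
    let ?a = "\<Sum>v\<in>A. u v *\<^sub>R v" and ?b = "\<Sum>v\<in>B. u v *\<^sub>R v"
    have ab: "?a + ?b = 0" using z by (simp add: sum.union_disjoint[OF A(1) B(1) disj])
    have aV: "?a \<in> V" using A(2) V(1) by (intro subspace_sum subspace_scale) auto
    have bW: "?b \<in> W" using B(2) W(1) by (intro subspace_sum subspace_scale) auto
    have "?a = - ?b" using ab by (simp add: eq_neg_iff_add_eq_0)
    then have "?a \<in> W" using subspace_neg[OF W(1) bW] by simp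
    with aV VW have a0: "?a = 0" by blast
    with ab have b0: "?b = 0" by simp
    have "u x = 0"
    proof (cases "x \<in> A")
      case True
      with a0 A(3) show ?thesis unfolding dependent_finite[OF A(1)] by blast
    next
      case False
      with x have "x \<in> B" by blast
      with b0 B(3) show ?thesis unfolding dependent_finite[OF B(1)] by blast
    qed
    with x(2) show False by simp
  qed
  moreover have "A \<union> B \<subseteq> V + W"
  proof -
    have "A \<subseteq> V + W" using A(2) set_zero_plus2[OF subspace_0[OF W(1)], of V] by (simp add: add.commute)
    moreover have "B \<subseteq> V + W" using B(2) set_zero_plus2[OF subspace_0[OF V(1)], of W] by blast
    ultimately show ?thesis by blast
  qed
  moreover have "V + W \<subseteq> span (A \<union> B)"
  proof
    fix x assume "x \<in> V + W"
    then obtain v w where "x = v + w" "v \<in> V" "w \<in> W" by (auto elim: set_plus_elim)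
    moreover have "span A \<subseteq> span (A \<union> B)" "span B \<subseteq> span (A \<union> B)" by (auto intro!: span_mono)
    ultimately show "x \<in> span (A \<union> B)" using A B by (auto intro!: span_add)
  qed
  ultimately have "dim (V + W) = card (A \<union> B)"
    by (intro dim_unique[of "A \<union> B"]) auto
  then show ?thesis using A B disj by (simp add: card_Un_disjoint)
qed

text \<open>Directness is expressed by the uniqueness of the representation of zero.\<close>

lemma dim_set_sum_direct:
  assumes "finite I" "\<And>i. i \<in> I \<Longrightarrow> subspace (V i)" "\<And>i. i \<in> I \<Longrightarrow> fin_dim (V i)"
    and "\<And>s. (\<And>i. i \<in> I \<Longrightarrow> s i \<in> V i) \<Longrightarrow> (\<Sum>i\<in>I. s i) = 0 \<Longrightarrow> (\<And>i. i \<in> I \<Longrightarrow> s i = 0)"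
  shows "dim (\<Sum>i\<in>I. V i) = (\<Sum>i\<in>I. dim (V i))"
  using assms
proof (induction I rule: finite_induct)
  case empty
  have "dim {0 :: 'b} = 0" by (intro dim_unique[of "{}"]) (auto simp: independent_empty)
  then show ?case by (simp add: set_zero)
next
  case (insert j I)
  have sub: "s i = 0" if s: "\<And>i. i \<in> I \<Longrightarrow> s i \<in> V i" "(\<Sum>i\<in>I. s i) = 0" and i: "i \<in> I" for s i
  proof -
    let ?s = "\<lambda>i. if i = j then 0 else s i"
    have "(\<Sum>i\<in>I. ?s i) = (\<Sum>i\<in>I. s i)" using insert.hyps by (intro sum.cong) auto
    then have "(\<Sum>i\<in>insert j I. ?s i) = 0" using insert.hyps s(2) by simp
    moreover have "?s i \<in> V i" if "i \<in> insert j I" for i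
      using s(1) that subspace_0[OF insert.prems(1)[of j]] by auto
    ultimately have "?s i = 0" using insert.prems(3)[of ?s i] i by blast
    then show ?thesis using i insert.hyps by (auto split: if_splits)
  qed
  have IH: "dim (\<Sum>i\<in>I. V i) = (\<Sum>i\<in>I. dim (V i))"
    using insert.prems(1,2) sub by (intro insert.IH) auto
  have "V j \<inter> (\<Sum>i\<in>I. V i) \<subseteq> {0}"
  proof
    fix x assume "x \<in> V j \<inter> (\<Sum>i\<in>I. V i)"
    then obtain s where s: "x = (\<Sum>i\<in>I. s i)" "\<And>i. i \<in> I \<Longrightarrow> s i \<in> V i" and x: "x \<in> V j"
      unfolding set_sum_alt[OF insert.hyps(1)] by blast
    let ?s = "\<lambda>i. if i = j then - x else s i"
    have "(\<Sum>i\<in>I. ?s i) = (\<Sum>i\<in>I. s i)" using insert.hyps by (intro sum.cong) auto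
    then have "(\<Sum>i\<in>insert j I. ?s i) = 0" using insert.hyps s(1) by simp
    moreover have "?s i \<in> V i" if "i \<in> insert j I" for i
      using s(2) that x subspace_neg[OF insert.prems(1)[of j] x] by auto
    ultimately have "?s j = 0" using insert.prems(3)[of ?s j] by blast
    then show "x \<in> {0}" by simp
  qed
  then have "dim (V j + (\<Sum>i\<in>I. V i)) = dim (V j) + dim (\<Sum>i\<in>I. V i)"
    using insert.prems(1,2) insert.hyps
    by (intro dim_set_plus_direct subspace_set_sum fin_dim_sum) auto
  then show ?case using insert.hyps IH by simp
qed

lemma dim_linear_image:
  assumes L: "linear L" and V: "subspace V" and inj: "\<And>x. x \<in> V \<Longrightarrow> L x = 0 \<Longrightarrow> x = 0"
  shows "dim (L ` V) = dim V"
proof -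
  obtain B where B: "B \<subseteq> V" "independent B" "V \<subseteq> span B" "card B = dim V"
    using basis_exists by blast
  have VB: "span B = V" using B V by (simp add: span_subspace)
  have injV: "inj_on L V"
  proof (rule inj_onI)
    fix x y assume "x \<in> V" "y \<in> V" "L x = L y"
    then have "x - y \<in> V" "L (x - y) = 0" using V by (auto simp: subspace_diff linear_diff[OF L])
    then show "x = y" using inj by fastforce
  qed
  have "independent (L ` B)"
    using linear_independent_injective_image[OF L B(2)] injV VB by simp
  moreover have "span (L ` B) = span (L ` V)"
    using linear_span_image[OF L, of B] linear_subspace_image[OF L V] VB by (metis span_eq_iff)
  ultimately have "dim (L ` V) = card (L ` B)" by (intro dim_eq_card) auto
  also have "\<dots> = card B" using inj_on_subset[OF injV B(1)] by (rule card_image)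
  finally show ?thesis using B(4) by simp
qed

text \<open>Solvability of a positive definite problem on a finite dimensional space. A new spanning vector \<open>s\<close> is
  first replaced by its part \<open>s'\<close> orthogonal to the previous ones, and the solution is then corrected
  by a multiple of \<open>s'\<close>.\<close>

lemma riesz_finite:
  fixes \<beta> :: "'v::real_vector \<Rightarrow> 'v \<Rightarrow> real"
  assumes W: "subspace W"
    and add: "\<And>x y z. x \<in> W \<Longrightarrow> y \<in> W \<Longrightarrow> z \<in> W \<Longrightarrow> \<beta> (x + y) z = \<beta> x z + \<beta> y z"
    and scale: "\<And>c x z. x \<in> W \<Longrightarrow> z \<in> W \<Longrightarrow> \<beta> (c *\<^sub>R x) z = c * \<beta> x z"
    and sym: "\<And>x y. x \<in> W \<Longrightarrow> y \<in> W \<Longrightarrow> \<beta> x y = \<beta> y x"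
    and pos: "\<And>x. x \<in> W \<Longrightarrow> \<beta> x x = 0 \<Longrightarrow> x = 0"
    and S: "finite S" "S \<subseteq> W"
    and f: "\<And>x y. x \<in> W \<Longrightarrow> y \<in> W \<Longrightarrow> f (x + y) = f x + (f y :: real)"
      "\<And>c x. x \<in> W \<Longrightarrow> f (c *\<^sub>R x) = c * f x"
  shows "\<exists>p\<in>span S. \<forall>w\<in>span S. \<beta> p w = f w"
  using S f
proof (induction S arbitrary: f rule: finite_induct)
  case empty
  have "\<beta> 0 0 = 0" "f 0 = 0"
    using scale[of 0 0 0] empty(3)[of 0 0] subspace_0[OF W] by auto
  then show ?case by simp
next
  case (insert s S)
  have s: "s \<in> W" and SW: "S \<subseteq> W" using insert.prems(1) by auto
  have spW: "span S \<subseteq> W" using SW W by (rule span_minimal)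
  have add2: "\<beta> z (x + y) = \<beta> z x + \<beta> z y" if "x \<in> W" "y \<in> W" "z \<in> W" for x y z
    using add[OF that] sym that W by (metis subspace_add)
  have scale2: "\<beta> z (c *\<^sub>R x) = c * \<beta> z x" if "x \<in> W" "z \<in> W" for c x z
    using scale[OF that] sym that W by (metis subspace_scale)
  obtain p where p: "p \<in> span S" "\<And>w. w \<in> span S \<Longrightarrow> \<beta> p w = f w"
    using insert.IH[OF SW insert.prems(2,3)] by blast
  obtain r where r: "r \<in> span S" "\<And>w. w \<in> span S \<Longrightarrow> \<beta> r w = \<beta> s w"
    using insert.IH[OF SW, of "\<beta> s"] add2 scale2 s by blast
  \<comment> \<open>The component of \<open>s\<close> orthogonal to the span of \<open>S\<close>.\<close>
  define s' where "s' = s - r"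
  have rW: "r \<in> W" and pW: "p \<in> W" using r(1) p(1) spW by auto
  have s'W: "s' \<in> W" using s rW W by (simp add: s'_def subspace_diff)
  have s_eq: "s = s' + r" by (simp add: s'_def)
  have orth: "\<beta> s' w = 0" if "w \<in> span S" for w
  proof -
    have "\<beta> s w = \<beta> s' w + \<beta> r w" using add[OF s'W rW] that spW s_eq by auto
    then show ?thesis using r(2)[OF that] by simp
  qed
  have sub: "span S \<subseteq> span (insert s S)" by (intro span_mono) auto
  have s'in: "s' \<in> span (insert s S)"
    unfolding s'_def by (intro span_diff) (use r(1) sub in \<open>auto intro: span_base\<close>)
  define c where "c = (if s' = 0 then 0 else (f s' - \<beta> p s') / \<beta> s' s')"
  have cs': "\<beta> p s' + c * \<beta> s' s' = f s'"
  proof (cases "s' = 0")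
    case True
    have "\<beta> p (0 *\<^sub>R 0) = 0" "f (0 *\<^sub>R 0) = 0"
      using scale2[of 0 p 0] insert.prems(3)[of 0 0] pW subspace_0[OF W] by simp_all
    then show ?thesis using True by (simp add: c_def)
  next
    case False
    then have "\<beta> s' s' \<noteq> 0" using pos[OF s'W] by blast
    then show ?thesis using False by (simp add: c_def)
  qed
  have csW: "c *\<^sub>R s' \<in> W" using s'W W by (simp add: subspace_scale)
  show ?case
  proof (intro bexI ballI)
    show "p + c *\<^sub>R s' \<in> span (insert s S)"
      using p(1) sub s'in by (intro span_add span_scale) auto
    fix w assume "w \<in> span (insert s S)"
    then obtain a where a: "w - a *\<^sub>R s \<in> span S" by (auto simp: span_insert)
    define y where "y = w - a *\<^sub>R s + a *\<^sub>R r"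
    have y: "y \<in> span S" using a r(1) by (simp add: y_def span_add span_scale)
    then have yW: "y \<in> W" using spW by blast
    have w: "w = y + a *\<^sub>R s'" by (simp add: y_def s'_def algebra_simps)
    have asW: "a *\<^sub>R s' \<in> W" using s'W W by (simp add: subspace_scale)
    have "\<beta> (p + c *\<^sub>R s') w = \<beta> p w + c * \<beta> s' w"
      using add[OF pW csW] scale[OF s'W] yW asW W by (simp add: w subspace_add)
    also have "\<dots> = (\<beta> p y + a * \<beta> p s') + c * (\<beta> s' y + a * \<beta> s' s')"
      by (simp add: w add2[OF yW asW pW] add2[OF yW asW s'W] scale2[OF s'W pW] scale2[OF s'W s'W])
    also have "\<dots> = f y + a * (\<beta> p s' + c * \<beta> s' s')"
      by (simp add: p(2)[OF y] orth[OF y] algebra_simps)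
    also have "\<dots> = f w" by (simp add: cs' w insert.prems(2)[OF yW asW] insert.prems(3)[OF s'W])
    finally show "\<beta> (p + c *\<^sub>R s') w = f w" .
  qed
qed

section \<open>Bubble functions\<close>

lemma rot_scaleR:
  assumes f: "polyfun m f" and v: "vpolyfun n v"
  shows "rot (\<lambda>x. f x *\<^sub>R v x) x = (\<chi> j. pd j f x) \<times> v x + f x *\<^sub>R rot v x"
proof -
  have "pd j (\<lambda>x. f x * v x $ a) x = f x * pd j (\<lambda>x. v x $ a) x + pd j f x * v x $ a" for j a
    by (rule pd_mult[OF f vpolyfun_nth[OF v]])
  then show ?thesis
    by (simp add: rot_def cross3_def vec_eq_iff forall_3 algebra_simps)
qed

context tetra
begin

abbreviation "bub \<equiv> bubble K"
abbreviation "fbub v \<equiv> face_bubble K (face v)"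

lemma polyfun_lam: "polyfun 1 (lam v)"
  unfolding lam_def by (rule polyfun_affine[OF linear_inner order_refl])

lemma polyfun_bubble: "polyfun 4 bub"
proof -
  have "polyfun (\<Sum>v\<in>C. 1) (\<lambda>x. \<Prod>v\<in>C. lam v x)" by (intro polyfun_prod finC polyfun_lam)
  moreover have "(\<Sum>v\<in>C. 1 :: int) = 4" using card4 by simp
  ultimately show ?thesis by (simp flip: bubble_eq)
qed

lemma polyfun_face_bubble:
  assumes "v \<in> C"
  shows "polyfun 3 (fbub v)"
proof -
  have "polyfun (\<Sum>w\<in>C-{v}. 1) (\<lambda>x. \<Prod>w\<in>C-{v}. lam w x)" using finC by (intro polyfun_prod polyfun_lam) auto
  moreover have "(\<Sum>w\<in>C-{v}. 1 :: int) = 3" using card4 finC assms by simp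
  ultimately show ?thesis by (simp flip: face_bubble_eq[OF assms])
qed

lemma bubble_zero: "v \<in> C \<Longrightarrow> lam v x = 0 \<Longrightarrow> bub x = 0"
  by (simp add: bubble_factor)

lemma face_bubble_zero: "v \<in> C \<Longrightarrow> w \<in> C \<Longrightarrow> w \<noteq> v \<Longrightarrow> lam v x = 0 \<Longrightarrow> fbub w x = 0"
  using finC by (auto simp: face_bubble_eq intro!: prod_zero)

lemma weights:
  assumes v: "v \<in> C"
  shows "x \<in> K \<Longrightarrow> 0 \<le> lam v x * (bub x * fbub v x)"
    and "(\<And>w. w \<in> C \<Longrightarrow> 0 < lam w x) \<Longrightarrow> 0 < lam v x * (bub x * fbub v x)"
proof -
  assume "x \<in> K"
  then have p: "0 \<le> lam w x" if "w \<in> C" for w using that by (simp add: K_eq)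
  show "0 \<le> lam v x * (bub x * fbub v x)"
    unfolding bubble_eq face_bubble_eq[OF v] using v p by (intro mult_nonneg_nonneg prod_nonneg) auto
next
  assume p: "\<And>w. w \<in> C \<Longrightarrow> 0 < lam w x"
  show "0 < lam v x * (bub x * fbub v x)"
    unfolding bubble_eq face_bubble_eq[OF v] using v p by (intro mult_pos_pos prod_pos) auto
qed

lemma zero_on_face:
  assumes v: "v \<in> C" and f: "polyfun m f" and z: "\<And>x. x \<in> face v \<Longrightarrow> f x = 0" and x: "lam v x = 0"
  shows "f x = 0"
proof -
  define \<phi> where "\<phi> = (isometric_chart (face v) :: real^2 \<Rightarrow> real^3)"
  from face_chart[OF v] obtain J where J: "linear J" "\<And>s. \<phi> s = J s + \<phi> 0"
    and rng: "range \<phi> = {x. lam v x = 0}"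
    and cell: "cell (C - {v}) (\<lambda>w s. grad w \<bullet> J s) (\<lambda>w. lam w (\<phi> 0)) (\<phi> -` (face v))"
    unfolding \<phi>_def[symmetric] by blast
  interpret cell "C - {v}" "\<lambda>w s. grad w \<bullet> J s" "\<lambda>w. lam w (\<phi> 0)" "\<phi> -` (face v)" by (rule cell)
  have "polyfun m (\<lambda>s. f (\<phi> s))"
    using polyfun_compose_affine[OF f J(1), of "\<phi> 0"] by (simp flip: J(2))
  then have "f (\<phi> s) = 0" for s
    by (rule polyfun_zero_on_open[OF _ open_pos pos_nonempty]) (use pos_subset z in blast)
  moreover have "x \<in> range \<phi>" using x rng by simp
  ultimately show ?thesis by blast
qed

text \<open>The face bubble is positive at the centroid of the face.\<close>

lemma face_plane_cancel:
  assumes v: "v \<in> C" and u: "vpolyfun m u" and z: "\<And>x. lam v x = 0 \<Longrightarrow> fbub v x *\<^sub>R u x = 0" and x: "lam v x = 0"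
  shows "u x = 0"
proof -
  have "C - {v} \<noteq> {}"
  proof
    assume a: "C - {v} = {}"
    have "card (C - {v}) = 3" using card4 v finC by simp
    then show False unfolding a by simp
  qed
  from centroid_pos[OF _ this] obtain y where y: "\<forall>w\<in>C-{v}. 0 < lam w y" "\<forall>w\<in>C - (C - {v}). lam w y = 0" by blast
  have "fbub v y > 0" using y(1) by (auto simp: face_bubble_eq[OF v] intro!: prod_pos)
  moreover have "lam v y = 0" using y(2) v by blast
  ultimately have "u x \<bullet> u x = 0"
    using vanish_on_plane_cancel[OF polyfun_face_bubble[OF v] vpolyfunD[OF u, of "u x"], of "grad v" y "offset v" x]
      z x grad_nonzero[OF v] unfolding lam_def[symmetric] by (fastforce simp: inner_commute)
  then show ?thesis by simp
qed

lemma compact_K: "compact K"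
  using cell.cpt[OF cell_K] .

lemma continuous_bubble: "continuous_on S bub" and continuous_face_bubble: "v \<in> C \<Longrightarrow> continuous_on S (fbub v)"
  by (auto intro: polyfun_continuous polyfun_bubble polyfun_face_bubble)

text \<open>The inner product of fields on \<open>K\<close> with weight \<open>W\<close>. Both the orthogonality in \<^const>\<open>Q_face\<close> and the
  correction that makes restriction to the face surjective are of this form.\<close>

definition weighted_inner :: "(real^3 \<Rightarrow> real) \<Rightarrow> (real^3 \<Rightarrow> real^3) \<Rightarrow> (real^3 \<Rightarrow> real^3) \<Rightarrow> real"
  where "weighted_inner W u v = (LINT x:K|lborel. W x * (u x \<bullet> v x))"

lemma weighted_inner_integrable:
  assumes "continuous_on K W" "vpolyfun m u" "vpolyfun n v"
  shows "set_integrable lborel K (\<lambda>x. W x * (u x \<bullet> v x))"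
  by (intro set_integrable_continuous_compact compact_K continuous_intros assms(1)
      vpolyfun_continuous[OF assms(2)] vpolyfun_continuous[OF assms(3)])

lemma weighted_inner_add:
  assumes "continuous_on K W" "vpolyfun m u" "vpolyfun m' u'" "vpolyfun n v"
  shows "weighted_inner W (u + u') v = weighted_inner W u v + weighted_inner W u' v"
  using set_integral_add[OF weighted_inner_integrable[OF assms(1,2,4)] weighted_inner_integrable[OF assms(1,3,4)]]
  by (simp add: weighted_inner_def inner_add_left distrib_left)

lemma weighted_inner_scale: "weighted_inner W (c *\<^sub>R u) v = c * weighted_inner W u v"
  by (simp add: weighted_inner_def mult.left_commute)

lemma weighted_inner_sym: "weighted_inner W u v = weighted_inner W v u"
  by (simp add: weighted_inner_def inner_commute)

text \<open>The fields \<open>q \<times> n\<close> are exactly the tangential ones, and a tangential field only sees the tangential part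
  \<open>(n \<times> \<rho>) \<times> n\<close> of a test field \<open>\<rho>\<close>, so the cross products may be dropped on both sides.\<close>

lemma Q_face_iff:
  assumes v: "v \<in> C"
  shows "q \<in> Q_face m K (face v) \<longleftrightarrow> vpolyfun m q \<and> (\<forall>x. q x \<bullet> unit_normal v = 0) \<and>
    (\<forall>\<rho>. vpolyfun (m - 1) \<rho> \<longrightarrow> weighted_inner (\<lambda>x. bub x * fbub v x) q \<rho> = 0)" (is "_ \<longleftrightarrow> ?R q")
proof -
  have n1: "unit_normal v \<bullet> unit_normal v = 1" by (rule unit_normal_unit[OF v])
  have cross_poly: "vpolyfun i (\<lambda>x. u x \<times> unit_normal v)" "vpolyfun i (\<lambda>x. unit_normal v \<times> u x)" if "vpolyfun i u" for i u
    using vpolyfun_cross[OF that vpolyfun_const[OF order_refl, of "unit_normal v"]]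
      vpolyfun_cross[OF vpolyfun_const[OF order_refl, of "unit_normal v"] that] by simp_all
  have cell_eq: "L2_cell K u (\<lambda>x. (bub x * fbub v x) *\<^sub>R w x) = weighted_inner (\<lambda>x. bub x * fbub v x) u w" for u w
    by (simp add: L2_cell_def weighted_inner_def)
  show ?thesis
  proof
    assume "q \<in> Q_face m K (face v)"
    then obtain p where q: "q = (\<lambda>x. p x \<times> unit_normal v)" and p: "vpolyfun m p"
      and orth: "\<And>w. vpolyfun (m - 1) w \<Longrightarrow> weighted_inner (\<lambda>x. bub x * fbub v x) q (\<lambda>x. w x \<times> unit_normal v) = 0"
      unfolding Q_face_def Let_def vpoly_space_K unit_normal_def[symmetric] cell_eq by blast
    have tan: "q x \<bullet> unit_normal v = 0" for x by (simp add: q dot_cross_self)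
    have "weighted_inner (\<lambda>x. bub x * fbub v x) q \<rho> = 0" if \<rho>: "vpolyfun (m - 1) \<rho>" for \<rho>
    proof -
      have "q x \<bullet> \<rho> x = q x \<bullet> ((unit_normal v \<times> \<rho> x) \<times> unit_normal v)" for x
      proof -
        have "q x \<bullet> ((unit_normal v \<times> \<rho> x) \<times> unit_normal v) = (q x \<bullet> \<rho> x) * (unit_normal v \<bullet> unit_normal v) - (q x \<bullet> unit_normal v) * (unit_normal v \<bullet> \<rho> x)"
          by (simp only: cross3_simps) (simp add: algebra_simps)
        then show ?thesis by (simp add: n1 tan)
      qed
      then have "weighted_inner (\<lambda>x. bub x * fbub v x) q \<rho> = weighted_inner (\<lambda>x. bub x * fbub v x) q (\<lambda>x. (unit_normal v \<times> \<rho> x) \<times> unit_normal v)"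
        unfolding weighted_inner_def by (simp only:)
      then show ?thesis using orth[OF cross_poly(2)[OF \<rho>]] by simp
    qed
    then show "?R q" using tan cross_poly(1)[OF p] q by blast
  next
    assume R: "?R q"
    have "q = (\<lambda>x. (unit_normal v \<times> q x) \<times> unit_normal v)"
      using R n1 by (intro ext tangential_part[symmetric]) (auto simp: inner_commute)
    moreover have "vpolyfun m (\<lambda>x. unit_normal v \<times> q x)" using R by (intro cross_poly(2)) blast
    moreover have "weighted_inner (\<lambda>x. bub x * fbub v x) q (\<lambda>x. w x \<times> unit_normal v) = 0" if "vpolyfun (m - 1) w" for w
      using R cross_poly(1)[OF that] by blast
    ultimately show "q \<in> Q_face m K (face v)"
      unfolding Q_face_def Let_def vpoly_space_K unit_normal_def[symmetric] cell_eq by (intro CollectI exI[of _ "\<lambda>x. unit_normal v \<times> q x"]) auto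
  qed
qed

lemma vpolyfun_fun_ops:
  "vpolyfun m 0" "vpolyfun m u \<Longrightarrow> vpolyfun m v \<Longrightarrow> vpolyfun m (u + v)" "vpolyfun m u \<Longrightarrow> vpolyfun m (c *\<^sub>R u)"
  by (simp_all add: zero_fun_def plus_fun_def scaleR_fun_def vpolyfun_zero vpolyfun_add vpolyfun_cmult)

lemma continuous_weight: "v \<in> C \<Longrightarrow> continuous_on S (\<lambda>x. bub x * fbub v x)"
  by (intro continuous_on_mult continuous_bubble continuous_face_bubble)

lemma subspace_Q_face:
  assumes v: "v \<in> C"
  shows "subspace (Q_face m K (face v))"
  unfolding subspace_def
proof (intro conjI allI ballI)
  show "0 \<in> Q_face m K (face v)"
    using weighted_inner_scale[of _ 0 0] by (simp add: Q_face_iff[OF v] vpolyfun_fun_ops)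
next
  fix p q assume "p \<in> Q_face m K (face v)" "q \<in> Q_face m K (face v)"
  then show "p + q \<in> Q_face m K (face v)"
    by (auto simp: Q_face_iff[OF v] vpolyfun_fun_ops inner_add_left weighted_inner_add[OF continuous_weight[OF v]])
next
  fix c q assume "q \<in> Q_face m K (face v)"
  then show "c *\<^sub>R q \<in> Q_face m K (face v)"
    by (auto simp: Q_face_iff[OF v] vpolyfun_fun_ops weighted_inner_scale)
qed

text \<open>Such a field is \<open>\<lambda>\<^sub>F p\<close> with \<open>p\<close> of degree \<open>m - 1\<close>, and \<open>p\<close> is an admissible test field in the orthogonality
  condition, where it gives a weighted square norm.\<close>

lemma Q_face_zero:
  assumes v: "v \<in> C" and q: "q \<in> Q_face m K (face v)" and z: "\<And>x. lam v x = 0 \<Longrightarrow> q x = 0"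
  shows "q = 0"
proof -
  have c: "continuous_on K (\<lambda>x. lam v x * (bub x * fbub v x))"
    by (rule continuous_on_mult[OF polyfun_continuous[OF polyfun_lam] continuous_weight[OF v]])
  interpret cell C "\<lambda>v x. grad v \<bullet> x" offset K by (rule cell_K)
  note q' = q[unfolded Q_face_iff[OF v]]
  have "grad v \<bullet> grad v \<noteq> 0" using grad_nonzero[OF v] by simp
  then obtain p where p: "vpolyfun (m - 1) p" "\<And>x. q x = lam v x *\<^sub>R p x"
    using vpolyfun_divide[OF conjunct1[OF q'] linear_inner, of "grad v" "grad v" "offset v"] z
    unfolding lam_def by blast
  have "weighted_inner (\<lambda>x. bub x * fbub v x) q p = 0" using q' p(1) by blast
  then have *: "(LINT x:K|lborel. (lam v x * (bub x * fbub v x)) * (p x \<bullet> p x)) = 0"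
    by (simp add: weighted_inner_def p(2) mult_ac)
  have w: "0 < lam v x * (bub x * fbub v x)" if "x \<in> pos" for x
    using that by (intro weights(2)[OF v]) (auto simp: pos_def lam_def)
  have "p x = 0" for x by (rule weighted_square_zero[OF c weights(1)[OF v] w p(1) *])
  then show ?thesis by (intro ext) (simp add: p(2))
qed

end

section \<open>Linearity and locality of the degrees of freedom\<close>

lemma chart_integral_diff:
  fixes \<phi> :: "'p::euclidean_space \<Rightarrow> real^3" and f g p :: "real^3 \<Rightarrow> 'b::real_inner"
  assumes \<phi>: "continuous_on UNIV \<phi>" and f: "continuous_on UNIV f" and g: "continuous_on UNIV g"
    and p: "continuous_on UNIV p" and T: "compact T" and m: "\<And>s. \<mu> (\<phi> s) = p (\<phi> s)"
  shows "(LINT s:T|lborel. (f (\<phi> s) - g (\<phi> s)) \<bullet> \<mu> (\<phi> s))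
    = (LINT s:T|lborel. f (\<phi> s) \<bullet> \<mu> (\<phi> s)) - (LINT s:T|lborel. g (\<phi> s) \<bullet> \<mu> (\<phi> s))"
proof -
  have c: "continuous_on T (\<lambda>s. h (\<phi> s))" if "continuous_on UNIV h" for h :: "real^3 \<Rightarrow> 'b"
    by (rule continuous_on_compose2[OF that continuous_on_subset[OF \<phi>]]) auto
  show ?thesis
    unfolding m inner_diff_left
    by (intro set_integral_diff set_integrable_continuous_compact[OF T] continuous_on_inner c f g p)
qed

context tetra
begin

lemma chart_continuous:
  assumes "D \<subseteq> C" "card D = DIM('p::euclidean_space) + 1"
  shows "continuous_on UNIV (isometric_chart (convex hull D) :: 'p \<Rightarrow> real^3)"
proof -
  let ?\<phi> = "isometric_chart (convex hull D) :: 'p \<Rightarrow> real^3"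
  from chart[OF assms] obtain J where J: "linear J" "\<And>s. ?\<phi> s = J s + ?\<phi> 0" by blast
  have "continuous_on UNIV (\<lambda>s. J s + ?\<phi> 0)"
    using J(1) by (intro continuous_intros linear_continuous_on) (simp add: linear_linear)
  moreover have "(\<lambda>s. J s + ?\<phi> 0) = ?\<phi>" using J(2) by (intro ext) (rule sym)
  ultimately show ?thesis by (simp only:)
qed

lemma chart_in_hull:
  assumes "D \<subseteq> C" "card D = DIM('p::euclidean_space) + 1"
  shows "(isometric_chart (convex hull D) :: 'p \<Rightarrow> real^3) s \<in> affine hull (convex hull D)"
  using chart[OF assms] unfolding affine_hull_convex_hull by blast

lemma chart_compact:
  assumes "D \<subseteq> C" "card D = DIM('p::euclidean_space) + 1"
  shows "compact ((isometric_chart (convex hull D) :: 'p \<Rightarrow> real^3) -` (convex hull D))"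
  using chart[OF assms] cell.cpt by blast

lemma L2_face_diff:
  assumes v: "v \<in> C" and f: "continuous_on UNIV f" and g: "continuous_on UNIV g"
    and \<mu>: "\<mu> \<in> tangential_space m K (face v)"
  shows "L2_face (face v) (\<lambda>x. f x - g x) \<mu> = L2_face (face v) f \<mu> - L2_face (face v) g \<mu>"
proof -
  from \<mu> obtain p where p: "vpolyfun m p" "\<mu> = restr (face v) p"
    unfolding tangential_space_def vpoly_space_eq by blast
  note D = card_face[OF v, THEN conjunct1] card_face[OF v, THEN conjunct2]
  show ?thesis
    unfolding L2_face_def Let_def
    by (rule chart_integral_diff[OF _ f g vpolyfun_continuous[OF p(1)]])
      (simp_all only: p(2) face_def restr_apply chart_in_hull[OF D] chart_continuous[OF D] chart_compact[OF D])
qed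

lemma L2_face_cong:
  assumes v: "v \<in> C" and f: "\<And>x. lam v x = 0 \<Longrightarrow> f x = g x"
  shows "L2_face (face v) f \<mu> = L2_face (face v) g \<mu>"
proof -
  let ?\<phi> = "isometric_chart (face v) :: real^2 \<Rightarrow> real^3"
  have "f (?\<phi> s) = g (?\<phi> s)" for s using face_chart[OF v] by (intro f) blast
  then show ?thesis by (simp add: L2_face_def)
qed

lemma card_edge: "p \<in> C \<Longrightarrow> q \<in> C \<Longrightarrow> p \<noteq> q \<Longrightarrow> {p, q} \<subseteq> C \<and> card {p, q} = DIM(real) + 1"
  by auto

lemma L2_edge_diff:
  assumes e: "e edge_of K" and f: "continuous_on UNIV f" and g: "continuous_on UNIV g"
    and \<kappa>: "\<kappa> \<in> poly_space m e"
  shows "L2_edge e (\<lambda>x. f x - g x) \<kappa> = L2_edge e f \<kappa> - L2_edge e g \<kappa>"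
proof -
  from \<kappa> obtain p where p: "polyfun m p" "\<kappa> = restr e p" unfolding poly_space_eq by blast
  from e obtain a b where ab: "a \<in> C" "b \<in> C" "a \<noteq> b" "e = convex hull {a, b}" by (auto simp: edge_iff)
  note D = card_edge[OF ab(1-3), THEN conjunct1] card_edge[OF ab(1-3), THEN conjunct2]
  show ?thesis
    unfolding L2_edge_def Let_def
    by (rule chart_integral_diff[OF _ f g polyfun_continuous[OF p(1)]])
      (simp_all only: p(2) ab(4) restr_apply chart_in_hull[OF D] chart_continuous[OF D] chart_compact[OF D])
qed

lemma L2_edge_cong:
  assumes e: "e edge_of K" and f: "\<And>x. x \<in> affine hull e \<Longrightarrow> f x = g x"
  shows "L2_edge e f \<kappa> = L2_edge e g \<kappa>"
proof -
  from e obtain a b where ab: "a \<in> C" "b \<in> C" "a \<noteq> b" "e = convex hull {a, b}" by (auto simp: edge_iff)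
  note D = card_edge[OF ab(1-3), THEN conjunct1] card_edge[OF ab(1-3), THEN conjunct2]
  let ?\<phi> = "isometric_chart e :: real \<Rightarrow> real^3"
  have "f (?\<phi> s) = g (?\<phi> s)" for s
    using chart_in_hull[OF D, of s] unfolding ab(4)[symmetric] by (rule f)
  then show ?thesis by (simp add: L2_edge_def)
qed

lemma L2_cell_diff:
  assumes "vpolyfun m u" "vpolyfun n w" "vpolyfun l \<rho>"
  shows "L2_cell K (\<lambda>x. u x - w x) \<rho> = L2_cell K u \<rho> - L2_cell K w \<rho>"
  unfolding L2_cell_def inner_diff_left
  by (intro set_integral_diff set_integrable_continuous_compact[OF compact_K] continuous_on_inner
      vpolyfun_continuous[OF assms(1)] vpolyfun_continuous[OF assms(2)] vpolyfun_continuous[OF assms(3)])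

lemma bubble_zero_on_edge:
  assumes e: "e edge_of K" and x: "x \<in> affine hull e"
  shows "bub x = 0"
proof -
  from e obtain a b where ab: "a \<in> C" "b \<in> C" "a \<noteq> b" "e = convex hull {a, b}" by (auto simp: edge_iff)
  have "card (C - {a, b}) = 2" using ab card4 finC by simp
  then have "C - {a, b} \<noteq> {}" by (metis card.empty zero_neq_numeral)
  then obtain w where w: "w \<in> C - {a, b}" by blast
  have "lam w x = 0" using x w ab affine_hull_sub[of "{a, b}"] by (auto simp: affine_hull_convex_hull)
  then show ?thesis using w bubble_zero by blast
qed

section \<open>The bubble space\<close>

text \<open>The generic element of \<^const>\<open>Q_space\<close>.\<close>

definition Qsum :: "(real^3 \<Rightarrow> real^3 \<Rightarrow> real^3) \<Rightarrow> real^3 \<Rightarrow> real^3"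
  where "Qsum q = (\<lambda>x. \<Sum>v\<in>C. fbub v x *\<^sub>R q v x)"

lemma Q_space_sum: "Q_space m K = (\<Sum>v\<in>C. mult_space (fbub v) (Q_face m K (face v)))"
  unfolding Q_space_def by (rule sum_C)

lemma Q_spaceE:
  assumes "z \<in> Q_space m K"
  obtains q where "\<And>v. v \<in> C \<Longrightarrow> q v \<in> Q_face m K (face v)" "z = Qsum q"
proof -
  from assms obtain s where s: "z = (\<Sum>v\<in>C. s v)" "\<And>v. v \<in> C \<Longrightarrow> s v \<in> mult_space (fbub v) (Q_face m K (face v))"
    unfolding Q_space_sum set_sum_alt[OF finC] by blast
  from s(2) have "\<forall>v\<in>C. \<exists>q. q \<in> Q_face m K (face v) \<and> s v = (\<lambda>x. fbub v x *\<^sub>R q x)"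
    unfolding mult_space_def by blast
  then obtain q where q: "\<And>v. v \<in> C \<Longrightarrow> q v \<in> Q_face m K (face v)" "\<And>v. v \<in> C \<Longrightarrow> s v = (\<lambda>x. fbub v x *\<^sub>R q v x)"
    by (metis (no_types))
  have "z = Qsum q" by (rule ext) (simp add: Qsum_def s(1) q(2))
  with q(1) show ?thesis by (rule that)
qed

lemma vpolyfun_Qsum:
  assumes "\<And>v. v \<in> C \<Longrightarrow> q v \<in> Q_face m K (face v)"
  shows "vpolyfun (3 + m) (Qsum q)"
  unfolding Qsum_def using assms
  by (intro vpolyfun_sum vpolyfun_scaleR polyfun_face_bubble) (simp_all add: Q_face_iff)

text \<open>The bubbles of all other faces contain the factor \<open>lam v\<close>.\<close>

lemma Qsum_on_face:
  assumes v: "v \<in> C" and x: "lam v x = 0"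
  shows "Qsum q x = fbub v x *\<^sub>R q v x"
proof -
  have "(\<Sum>w\<in>C - {v}. fbub w x *\<^sub>R q w x) = 0"
    using face_bubble_zero[OF v _ _ x] by (intro sum.neutral ballI) auto
  then show ?thesis by (simp add: Qsum_def sum.remove[OF finC v])
qed

lemma Qsum_zero:
  assumes q: "\<And>v. v \<in> C \<Longrightarrow> q v \<in> Q_face m K (face v)" and z: "\<And>x. Qsum q x = 0" and v: "v \<in> C"
  shows "q v = 0"
proof (rule Q_face_zero[OF v q[OF v]])
  have p: "vpolyfun m (q v)" using q[OF v] by (simp add: Q_face_iff[OF v])
  show "q v x = 0" if "lam v x = 0" for x
    by (rule face_plane_cancel[OF v p _ that]) (simp add: z Qsum_on_face[OF v, symmetric])
qed

lemma bubble_interior_dof: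
  assumes q: "\<And>v. v \<in> C \<Longrightarrow> q v \<in> Q_face m K (face v)" and \<rho>: "vpolyfun (m - 1) \<rho>"
  shows "L2_cell K (\<lambda>x. bub x *\<^sub>R Qsum q x) \<rho> = 0"
proof -
  let ?W = "\<lambda>v x. bub x * fbub v x"
  have "(bub x *\<^sub>R Qsum q x) \<bullet> \<rho> x = (\<Sum>v\<in>C. ?W v x * (q v x \<bullet> \<rho> x))" for x
    by (simp add: Qsum_def inner_sum_left sum_distrib_left mult.assoc)
  then have "L2_cell K (\<lambda>x. bub x *\<^sub>R Qsum q x) \<rho> = (LINT x:K|lborel. \<Sum>v\<in>C. ?W v x * (q v x \<bullet> \<rho> x))"
    by (simp add: L2_cell_def)
  also have "\<dots> = (\<Sum>v\<in>C. weighted_inner (?W v) (q v) \<rho>)"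
    unfolding weighted_inner_def set_lebesgue_integral_def scaleR_sum_right
  proof (rule Bochner_Integration.integral_sum)
    fix v assume v: "v \<in> C"
    then have "vpolyfun m (q v)" using q by (simp add: Q_face_iff)
    from weighted_inner_integrable[OF continuous_weight[OF v] this \<rho>]
    show "integrable lborel (\<lambda>x. indicator K x *\<^sub>R (?W v x * (q v x \<bullet> \<rho> x)))"
      unfolding set_integrable_def .
  qed
  also have "\<dots> = 0" using q \<rho> by (intro sum.neutral ballI) (simp add: Q_face_iff)
  finally show ?thesis .
qed

text \<open>On the face, \<open>b\<^sub>K\<close> vanishes and its gradient is \<open>b\<^sub>F \<nabla>\<lambda>\<^sub>F\<close>, a negative multiple of \<open>b\<^sub>F n\<^sub>F\<close>.\<close>

lemma curl_bubble_trace: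
  assumes q: "\<And>v. v \<in> C \<Longrightarrow> q v \<in> Q_face m K (face v)" and v: "v \<in> C" and x: "lam v x = 0"
  shows "curl (\<lambda>x. bub x *\<^sub>R Qsum q x) x \<times> unit_normal v = - (norm (grad v) * (fbub v x)\<^sup>2) *\<^sub>R q v x"
proof -
  note z = vpolyfun_Qsum[OF q]
  have "pd j bub x = grad v $ j * fbub v x" for j
  proof -
    have "bub = (\<lambda>x. (grad v \<bullet> x + offset v) * fbub v x)"
      by (rule ext) (simp add: bubble_factor[OF v] lam_def)
    then have "pd j bub x = pd j (\<lambda>x. (grad v \<bullet> x + offset v) * fbub v x) x" by (rule arg_cong)
    also have "\<dots> = (grad v \<bullet> x + offset v) * pd j (fbub v) x + pd j (\<lambda>x. grad v \<bullet> x + offset v) x * fbub v x"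
      by (rule pd_mult[OF polyfun_affine[OF linear_inner order_refl] polyfun_face_bubble[OF v]])
    also have "grad v \<bullet> x + offset v = 0" using x by (simp add: lam_def)
    also have "pd j (\<lambda>x. grad v \<bullet> x + offset v) x = grad v $ j"
      by (simp add: pd_affine[OF linear_inner] inner_axis)
    finally show ?thesis by simp
  qed
  then have grad: "(\<chi> j. pd j bub x) = fbub v x *\<^sub>R grad v" by (simp add: vec_eq_iff mult.commute)
  have "curl (\<lambda>x. bub x *\<^sub>R Qsum q x) x = rot (\<lambda>x. bub x *\<^sub>R Qsum q x) x"
    by (rule curl_eq_rot[OF vpolyfun_scaleR[OF polyfun_bubble z]])
  also have "\<dots> = (fbub v x *\<^sub>R grad v) \<times> (fbub v x *\<^sub>R q v x)"
    by (simp add: rot_scaleR[OF polyfun_bubble z] grad bubble_zero[OF v x] Qsum_on_face[OF v x])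
  also have "\<dots> = (fbub v x)\<^sup>2 *\<^sub>R (grad v \<times> q v x)"
    by (simp add: cross_mult_left cross_mult_right power2_eq_square)
  finally have c: "curl (\<lambda>x. bub x *\<^sub>R Qsum q x) x = (fbub v x)\<^sup>2 *\<^sub>R (grad v \<times> q v x)" .
  have n0: "norm (grad v) \<noteq> 0" using grad_nonzero[OF v] by simp
  have grad: "grad v = - norm (grad v) *\<^sub>R unit_normal v"
    using n0 by (simp add: unit_normal_def outward_normal_eq[OF v])
  have "unit_normal v \<bullet> q v x = 0" using q[OF v] by (simp add: Q_face_iff[OF v] inner_commute)
  from tangential_part[OF unit_normal_unit[OF v] this] have t: "(unit_normal v \<times> q v x) \<times> unit_normal v = q v x" .
  have "(grad v \<times> q v x) \<times> unit_normal v = - norm (grad v) *\<^sub>R ((unit_normal v \<times> q v x) \<times> unit_normal v)"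
    by (subst grad) (simp only: cross_mult_left)
  then show ?thesis by (simp add: c cross_mult_left t)
qed

text \<open>The restriction of \<open>q v\<close> to the face is itself an admissible test field.\<close>

lemma curl_dof_zero:
  assumes q: "\<And>v. v \<in> C \<Longrightarrow> q v \<in> Q_face m K (face v)" and v: "v \<in> C"
    and dof: "\<And>\<zeta>. \<zeta> \<in> tangential_space m K (face v) \<Longrightarrow>
      L2_face (face v) (\<lambda>x. curl (\<lambda>x. bub x *\<^sub>R Qsum q x) x \<times> unit_normal v) \<zeta> = 0"
  shows "q v = 0"
proof (rule Q_face_zero[OF v q[OF v]])
  note qv = q[OF v, unfolded Q_face_iff[OF v]]
  define \<phi> where "\<phi> = (isometric_chart (face v) :: real^2 \<Rightarrow> real^3)"
  from face_chart[OF v] obtain J where J: "linear J" "\<And>s. \<phi> s = J s + \<phi> 0"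
    and lamJ: "\<And>w s. grad w \<bullet> J s + lam w (\<phi> 0) = lam w (\<phi> s)" and lamv: "\<And>s. lam v (\<phi> s) = 0"
    and rng: "range \<phi> = {x. lam v x = 0}" and aff: "\<And>s. \<phi> s \<in> affine hull (face v)"
    and cell: "cell (C - {v}) (\<lambda>w s. grad w \<bullet> J s) (\<lambda>w. lam w (\<phi> 0)) (\<phi> -` (face v))"
    unfolding \<phi>_def[symmetric] by blast
  have \<zeta>: "restr (face v) (q v) \<in> tangential_space m K (face v)"
    unfolding tangential_space_def vpoly_space_eq using qv by (auto simp: restr_def unit_normal_def)
  have poly: "vpolyfun m (\<lambda>s. q v (\<phi> s))"
    using vpolyfun_compose_affine[OF conjunct1[OF qv] J(1), of "\<phi> 0"] by (simp flip: J(2))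
  have eq: "(curl (\<lambda>x. bub x *\<^sub>R Qsum q x) (\<phi> s) \<times> unit_normal v) \<bullet> restr (face v) (q v) (\<phi> s)
    = - norm (grad v) * ((fbub v (\<phi> s))\<^sup>2 * (q v (\<phi> s) \<bullet> q v (\<phi> s)))" for s
    by (simp add: curl_bubble_trace[OF q v lamv] restr_apply aff)
  have "(LINT s:\<phi> -` (face v)|lborel. - norm (grad v) * ((fbub v (\<phi> s))\<^sup>2 * (q v (\<phi> s) \<bullet> q v (\<phi> s)))) = 0"
    using dof[OF \<zeta>] unfolding L2_face_def Let_def \<phi>_def[symmetric] eq .
  then have "- norm (grad v) * (LINT s:\<phi> -` (face v)|lborel. (fbub v (\<phi> s))\<^sup>2 * (q v (\<phi> s) \<bullet> q v (\<phi> s))) = 0"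
    by (simp only: set_integral_mult_right)
  then have zero: "(LINT s:\<phi> -` (face v)|lborel. (fbub v (\<phi> s))\<^sup>2 * (q v (\<phi> s) \<bullet> q v (\<phi> s))) = 0"
    using grad_nonzero[OF v] by simp
  have cont: "continuous_on (\<phi> -` (face v)) (\<lambda>s. (fbub v (\<phi> s))\<^sup>2)"
    using polyfun_continuous[OF polyfun_compose_affine[OF polyfun_face_bubble[OF v] J(1), of "\<phi> 0"]]
    by (intro continuous_intros) (simp flip: J(2))
  interpret cell "C - {v}" "\<lambda>w s. grad w \<bullet> J s" "\<lambda>w. lam w (\<phi> 0)" "\<phi> -` (face v)" by (rule cell)
  have "0 < (fbub v (\<phi> s))\<^sup>2" if "s \<in> pos" for s
    using that unfolding pos_def lamJ
    by (intro zero_less_power) (auto simp: face_bubble_eq[OF v] intro!: prod_pos)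
  from weighted_square_zero[OF cont _ this poly zero] have qz: "q v (\<phi> s) = 0" for s by simp
  show "q v x = 0" if "lam v x = 0" for x
  proof -
    have "x \<in> range \<phi>" using that rng by simp
    then show ?thesis using qz by blast
  qed
qed

lemma mult_space_linear: "linear (\<lambda>(u :: real^3 \<Rightarrow> real^3) x. (b x :: real) *\<^sub>R u x)"
  by (rule linearI; rule ext) (simp_all add: scaleR_add_right)

text \<open>Given a polynomial extension of a tangential field from the face, removing its normal component
  leaves the values on the face unchanged. Subtracting \<open>\<lambda>\<^sub>F r\<close> does not change them either, and \<open>r\<close> can be chosen
  to achieve the orthogonality: it solves a problem with the positive weight
  \<open>\<lambda>\<^sub>F b\<^sub>K b\<^sub>F\<close> on tangential fields of degree \<open>m - 1\<close>.\<close>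

lemma restr_Q_face:
  assumes v: "v \<in> C"
  shows "restr (face v) ` Q_face m K (face v) = tangential_space m K (face v)"
proof (intro equalityI subsetI)
  fix \<mu> assume "\<mu> \<in> restr (face v) ` Q_face m K (face v)"
  then obtain q where q: "q \<in> Q_face m K (face v)" "\<mu> = restr (face v) q" by blast
  note q' = q(1)[unfolded Q_face_iff[OF v]]
  show "\<mu> \<in> tangential_space m K (face v)"
    unfolding tangential_space_def vpoly_space_eq q(2) using q' by (auto simp: restr_def unit_normal_def)
next
  fix \<mu> assume "\<mu> \<in> tangential_space m K (face v)"
  then obtain p where p: "vpolyfun m p" "\<mu> = restr (face v) p" and tan: "\<forall>x\<in>face v. \<mu> x \<bullet> unit_normal v = 0"
    unfolding tangential_space_def vpoly_space_eq unit_normal_def by blast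
  have ptan: "p x \<bullet> unit_normal v = 0" if "lam v x = 0" for x
  proof (rule zero_on_face[OF v vpolyfunD[OF p(1)] _ that])
    fix x assume "x \<in> face v"
    with tan show "p x \<bullet> unit_normal v = 0" by (auto simp: p(2) restr_apply hull_inc)
  qed
  \<comment> \<open>Projection to the tangential part.\<close>
  define \<pi> where "\<pi> = (\<lambda>(u :: real^3 \<Rightarrow> real^3) x. u x - (u x \<bullet> unit_normal v) *\<^sub>R unit_normal v)"
  have \<pi>poly: "vpolyfun i (\<pi> u)" if "vpolyfun i u" for i u
    unfolding \<pi>_def using that by (intro vpolyfun_diff vpolyfun_scaleR_const vpolyfunD)
  have \<pi>tan: "\<pi> u x \<bullet> unit_normal v = 0" for u x
    by (simp add: \<pi>_def inner_diff_left unit_normal_unit[OF v])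
  have \<pi>inner: "y \<bullet> \<pi> u x = y \<bullet> u x" if "y \<bullet> unit_normal v = 0" for y u x
    by (simp add: \<pi>_def inner_diff_right that)
  define q0 where "q0 = \<pi> p"
  let ?W = "{w :: real^3 \<Rightarrow> real^3. vpolyfun (m - 1) w \<and> (\<forall>x. w x \<bullet> unit_normal v = 0)}"
  let ?b = "\<lambda>x. bub x * fbub v x" and ?c = "\<lambda>x. lam v x * (bub x * fbub v x)"
  have cb: "continuous_on K ?b" by (rule continuous_weight[OF v])
  have cc: "continuous_on K ?c"
    by (rule continuous_on_mult[OF polyfun_continuous[OF polyfun_lam] continuous_weight[OF v]])
  have subW: "subspace ?W"
    unfolding subspace_def by (auto simp: vpolyfun_fun_ops inner_add_left)
  have "fin_dim ?W" by (rule fin_dim_subset[OF fin_dim_vpolyfun]) auto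
  then obtain S where S: "finite S" "S \<subseteq> ?W" "?W \<subseteq> span S" by (rule fin_dim_basis)
  have spS: "span S = ?W" using S subW by (intro span_subspace)
  have q0: "vpolyfun m q0" unfolding q0_def by (rule \<pi>poly[OF p(1)])
  have "\<exists>r\<in>span S. \<forall>w\<in>span S. weighted_inner ?c r w = weighted_inner ?b q0 w"
  proof (rule riesz_finite[OF subW _ _ _ _ S(1,2)])
    show "weighted_inner ?c (x + y) z = weighted_inner ?c x z + weighted_inner ?c y z" if "x \<in> ?W" "y \<in> ?W" "z \<in> ?W" for x y z
      using that weighted_inner_add[OF cc] by blast
    show "weighted_inner ?c (a *\<^sub>R x) z = a * weighted_inner ?c x z" for a x z by (rule weighted_inner_scale)
    show "weighted_inner ?c x y = weighted_inner ?c y x" for x y by (rule weighted_inner_sym)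
    show "weighted_inner ?b q0 (x + y) = weighted_inner ?b q0 x + weighted_inner ?b q0 y" if "x \<in> ?W" "y \<in> ?W" for x y
      unfolding weighted_inner_sym[of ?b q0] using that weighted_inner_add[OF cb _ _ q0] by blast
    show "weighted_inner ?b q0 (a *\<^sub>R x) = a * weighted_inner ?b q0 x" for a x
      unfolding weighted_inner_sym[of ?b q0] by (rule weighted_inner_scale)
    fix x assume x: "x \<in> ?W" and z: "weighted_inner ?c x x = 0"
    interpret cell C "\<lambda>v x. grad v \<bullet> x" offset K by (rule cell_K)
    have w: "0 < ?c y" if "y \<in> pos" for y
      using that by (intro weights(2)[OF v]) (auto simp: pos_def lam_def)
    have "vpolyfun (m - 1) x" using x by blast
    from weighted_square_zero[OF cc weights(1)[OF v] w this z[unfolded weighted_inner_def]]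
    show "x = 0" by (intro ext) simp
  qed
  then obtain r where r: "r \<in> ?W" "\<And>w. w \<in> ?W \<Longrightarrow> weighted_inner ?c r w = weighted_inner ?b q0 w"
    unfolding spS by blast
  define q where "q = (\<lambda>x. q0 x - lam v x *\<^sub>R r x)"
  have lr: "vpolyfun m (\<lambda>x. lam v x *\<^sub>R r x)"
    using vpolyfun_scaleR[OF polyfun_lam, of "m - 1" r v] r(1) by simp
  have qp: "vpolyfun m q" unfolding q_def by (rule vpolyfun_diff[OF q0 lr])
  have qt: "q x \<bullet> unit_normal v = 0" for x
    using r(1) by (simp add: q_def inner_diff_left q0_def \<pi>tan)
  have "weighted_inner ?b q \<rho> = 0" if \<rho>: "vpolyfun (m - 1) \<rho>" for \<rho>
  proof -
    have \<pi>\<rho>: "\<pi> \<rho> \<in> ?W" using \<pi>poly[OF \<rho>] \<pi>tan by blast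
    have "q0 = q + (\<lambda>x. lam v x *\<^sub>R r x)" by (rule ext) (simp add: q_def)
    then have "weighted_inner ?b q0 (\<pi> \<rho>) = weighted_inner ?b q (\<pi> \<rho>) + weighted_inner ?b (\<lambda>x. lam v x *\<^sub>R r x) (\<pi> \<rho>)"
      using weighted_inner_add[OF cb qp lr \<pi>poly[OF \<rho>]] by simp
    moreover have "weighted_inner ?b (\<lambda>x. lam v x *\<^sub>R r x) (\<pi> \<rho>) = weighted_inner ?c r (\<pi> \<rho>)"
      by (simp add: weighted_inner_def mult_ac)
    ultimately have "weighted_inner ?b q (\<pi> \<rho>) = 0" using r(2)[OF \<pi>\<rho>] by simp
    then show ?thesis by (simp add: weighted_inner_def \<pi>inner[OF qt])
  qed
  then have "q \<in> Q_face m K (face v)" using qp qt by (simp add: Q_face_iff[OF v])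
  moreover have "restr (face v) q = \<mu>"
    by (rule ext) (simp add: restr_def p(2) affine_hull_face[OF v] q_def q0_def \<pi>_def ptan)
  ultimately show "\<mu> \<in> restr (face v) ` Q_face m K (face v)" by blast
qed

lemma dim_Q_face:
  assumes v: "v \<in> C"
  shows "dim (Q_face m K (face v)) = dim (tangential_space m K (face v))"
proof -
  have "q = 0" if q: "q \<in> Q_face m K (face v)" and z: "restr (face v) q = 0" for q
  proof (rule Q_face_zero[OF v q])
    fix x assume "lam v x = 0"
    then show "q x = 0" using fun_cong[OF z, of x] affine_hull_face[OF v] by (simp add: restr_def)
  qed
  from dim_linear_image[OF linear_restr[of "face v"] subspace_Q_face[OF v, of m] this] show ?thesis
    by (simp add: restr_Q_face[OF v])
qed

lemma tangentialI:
  assumes "v \<in> C" "vpolyfun m p" "\<And>x. grad v \<bullet> p x = 0"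
  shows "restr (face v) p \<in> tangential_space m K (face v)"
  unfolding tangential_space_def vpoly_space_eq using assms
  by (auto simp: restr_def outward_normal_eq inner_commute[of "p _"])

lemma tangentialE:
  assumes "v \<in> C" "\<mu> \<in> tangential_space m K (face v)"
  obtains p where "vpolyfun m p" "\<mu> = restr (face v) p" "\<And>x. grad v \<bullet> p x = 0"
proof -
  from assms(2) obtain p where p: "p \<in> Q_face m K (face v)" "\<mu> = restr (face v) p"
    unfolding restr_Q_face[OF assms(1), symmetric] by blast
  moreover have "grad v \<bullet> p x = 0" for x
  proof -
    have "unit_normal v \<bullet> p x = 0" using p(1) by (simp add: Q_face_iff[OF assms(1)] inner_commute)
    then show ?thesis using grad_nonzero[OF assms(1)] by (simp add: unit_normal_inner[OF assms(1)])
  qed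
  ultimately show ?thesis using that by (auto simp: Q_face_iff[OF assms(1)])
qed

text \<open>The affine involution of space that exchanges the vertices \<open>v\<close> and \<open>w\<close> and fixes the others; its
  linear part is \<open>swap_lin\<close>.\<close>

definition swap :: "real^3 \<Rightarrow> real^3 \<Rightarrow> real^3 \<Rightarrow> real^3"
  where "swap v w x = x + (lam v x - lam w x) *\<^sub>R (w - v)"

definition swap_lin :: "real^3 \<Rightarrow> real^3 \<Rightarrow> real^3 \<Rightarrow> real^3"
  where "swap_lin v w d = d + (grad v \<bullet> d - grad w \<bullet> d) *\<^sub>R (w - v)"

lemma linear_swap_lin: "linear (swap_lin v w)"
  by (rule linearI) (simp_all add: swap_lin_def inner_add_right algebra_simps)

lemma swap_affine: "swap v w x = swap_lin v w x + (offset v - offset w) *\<^sub>R (w - v)"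
  by (simp add: swap_def swap_lin_def lam_def algebra_simps)

lemma swap_props:
  assumes "v \<in> C" "w \<in> C" "v \<noteq> w"
  shows "grad v \<bullet> swap_lin v w d = grad w \<bullet> d" "grad w \<bullet> swap_lin v w d = grad v \<bullet> d"
    and "swap_lin v w (swap_lin v w d) = d"
    and "lam v (swap v w x) = lam w x" "lam w (swap v w x) = lam v x" "swap v w (swap v w x) = x"
proof -
  have n: "grad v \<bullet> (w - v) = -1" "grad w \<bullet> (w - v) = 1" using assms by (simp_all add: grad_diff)
  show d: "grad v \<bullet> swap_lin v w d = grad w \<bullet> d" "grad w \<bullet> swap_lin v w d = grad v \<bullet> d" for d
    unfolding swap_lin_def inner_add_right inner_scaleR_right n by simp_all
  show "swap_lin v w (swap_lin v w d) = d"
    unfolding swap_lin_def[of v w "swap_lin v w d"] d by (simp add: swap_lin_def algebra_simps)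
  have l: "lam v (x + t *\<^sub>R (w - v)) = lam v x - t" "lam w (x + t *\<^sub>R (w - v)) = lam w x + t" for x t
    unfolding lam_def inner_add_right inner_scaleR_right n by simp_all
  show s: "lam v (swap v w x) = lam w x" "lam w (swap v w x) = lam v x" for x
    unfolding swap_def l by simp_all
  show "swap v w (swap v w x) = x"
    unfolding swap_def[of v w "swap v w x"] s by (simp add: swap_def algebra_simps)
qed

text \<open>The affine involution exchanging \<open>v\<close> and \<open>w\<close> carries one face to the other, and its linear part
  carries tangent vectors to tangent vectors.\<close>

lemma dim_tangential_space_eq:
  assumes v: "v \<in> C" and w: "w \<in> C"
  shows "dim (tangential_space m K (face v)) = dim (tangential_space m K (face w))"
proof (cases "v = w")
  case False
  note sw = swap_props[OF v w False]
  define L where "L = (\<lambda>(\<mu> :: real^3 \<Rightarrow> real^3) x. swap_lin v w (\<mu> (swap v w x)))"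
  have L: "linear L"
    unfolding L_def by (rule linearI; rule ext) (simp_all add: linear_add[OF linear_swap_lin] linear_scale[OF linear_swap_lin])
  have LL: "L (L \<mu>) = \<mu>" for \<mu> by (rule ext) (simp add: L_def sw)
  have poly: "vpolyfun m (\<lambda>x. swap_lin v w (p (swap v w x)))" if "vpolyfun m p" for p
    unfolding swap_affine by (intro vpolyfun_compose_linear[OF vpolyfun_compose_affine] that linear_swap_lin)
  have zero: "swap_lin v w 0 = 0" by (rule linear_0[OF linear_swap_lin])
  have vw: "L \<mu> \<in> tangential_space m K (face w)" if "\<mu> \<in> tangential_space m K (face v)" for \<mu>
  proof -
    from that obtain p where p: "vpolyfun m p" "\<mu> = restr (face v) p" "\<And>x. grad v \<bullet> p x = 0"
      by (rule tangentialE[OF v]) blast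
    have "L \<mu> = restr (face w) (\<lambda>x. swap_lin v w (p (swap v w x)))"
      by (rule ext) (simp add: L_def p(2) restr_def affine_hull_face v w sw zero)
    then show ?thesis using tangentialI[OF w poly[OF p(1)]] sw(2) p(3) by simp
  qed
  have wv: "L \<mu> \<in> tangential_space m K (face v)" if "\<mu> \<in> tangential_space m K (face w)" for \<mu>
  proof -
    from that obtain p where p: "vpolyfun m p" "\<mu> = restr (face w) p" "\<And>x. grad w \<bullet> p x = 0"
      by (rule tangentialE[OF w]) blast
    have "L \<mu> = restr (face v) (\<lambda>x. swap_lin v w (p (swap v w x)))"
      by (rule ext) (simp add: L_def p(2) restr_def affine_hull_face v w sw zero)
    then show ?thesis using tangentialI[OF v poly[OF p(1)]] sw(1) p(3) by simp
  qed
  have "L ` tangential_space m K (face v) = tangential_space m K (face w)"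
  proof (intro equalityI subsetI)
    fix \<mu> assume "\<mu> \<in> tangential_space m K (face w)"
    from wv[OF this] LL[of \<mu>] show "\<mu> \<in> L ` tangential_space m K (face v)" by (metis imageI)
  qed (use vw in blast)
  moreover have "subspace (tangential_space m K (face v))"
    unfolding restr_Q_face[OF v, symmetric] by (rule linear_subspace_image[OF linear_restr subspace_Q_face[OF v]])
  moreover have "\<mu> = 0" if "L \<mu> = 0" for \<mu>
    using LL[of \<mu>] linear_0[OF L] that by simp
  ultimately show ?thesis using dim_linear_image[OF L, of "tangential_space m K (face v)"] by simp
qed simp

section \<open>The enriched space\<close>

lemma subspace_nedelec: "subspace (nedelec k K)"
  unfolding nedelec_def vpoly_space_K
proof (rule subspace_set_plus)
  show "subspace {u. vpolyfun k u}" by (simp add: subspace_def vpolyfun_fun_ops)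
  show "subspace {v \<in> {u. vpolyfun (k + 1) u}. \<forall>x\<in>K. v x \<bullet> x = 0}"
    by (simp add: subspace_def vpolyfun_fun_ops inner_add_left)
qed

lemma fin_dim_nedelec: "fin_dim (nedelec k K)"
  by (rule fin_dim_subset[OF fin_dim_vpolyfun]) (use nedelec_degrees in blast)

lemma subspace_mult_Q_face: "v \<in> C \<Longrightarrow> subspace (mult_space (fbub v) (Q_face m K (face v)))"
  unfolding mult_space_def by (rule linear_subspace_image[OF mult_space_linear subspace_Q_face])

lemma fin_dim_Q_face: "v \<in> C \<Longrightarrow> fin_dim (Q_face m K (face v))"
  by (rule fin_dim_subset[OF fin_dim_vpolyfun[of m]]) (auto simp: Q_face_iff)

lemma fin_dim_mult_Q_face: "v \<in> C \<Longrightarrow> fin_dim (mult_space (fbub v) (Q_face m K (face v)))"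
  unfolding mult_space_def by (rule fin_dim_linear_image[OF mult_space_linear fin_dim_Q_face])

lemma subspace_Q_space: "subspace (Q_space m K)"
  unfolding Q_space_sum by (rule subspace_set_sum[OF subspace_mult_Q_face])

lemma fin_dim_Q_space: "fin_dim (Q_space m K)"
  unfolding Q_space_sum by (rule fin_dim_sum[OF finC fin_dim_mult_Q_face])

lemma dim_Q_space:
  assumes v: "v \<in> C"
  shows "dim (Q_space m K) = 4 * dim (tangential_space m K (face v))"
proof -
  have indep: "s v = 0"
    if s: "\<And>v. v \<in> C \<Longrightarrow> s v \<in> mult_space (fbub v) (Q_face m K (face v))" and z: "(\<Sum>v\<in>C. s v) = 0" and v: "v \<in> C" for s v
  proof -
    from s have "\<forall>v\<in>C. \<exists>q. q \<in> Q_face m K (face v) \<and> s v = (\<lambda>x. fbub v x *\<^sub>R q x)"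
      unfolding mult_space_def by blast
    then obtain q where q: "\<And>v. v \<in> C \<Longrightarrow> q v \<in> Q_face m K (face v)" "\<And>v. v \<in> C \<Longrightarrow> s v = (\<lambda>x. fbub v x *\<^sub>R q v x)"
      by (metis (no_types))
    have "Qsum q x = 0" for x using fun_cong[OF z, of x] by (simp add: Qsum_def q(2))
    from Qsum_zero[OF q(1) this v] show ?thesis by (simp add: q(2)[OF v] fun_eq_iff)
  qed
  have one: "dim (mult_space (fbub w) (Q_face m K (face w))) = dim (tangential_space m K (face v))" if w: "w \<in> C" for w
  proof -
    have "q = 0" if q: "q \<in> Q_face m K (face w)" and z: "(\<lambda>x. fbub w x *\<^sub>R q x) = 0" for q
    proof (rule Q_face_zero[OF w q])
      have p: "vpolyfun m q" using q by (simp add: Q_face_iff[OF w])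
      show "q x = 0" if "lam w x = 0" for x
        by (rule face_plane_cancel[OF w p _ that]) (use fun_cong[OF z] in simp)
    qed
    from dim_linear_image[OF mult_space_linear[of "fbub w"] subspace_Q_face[OF w] this]
    have "dim (mult_space (fbub w) (Q_face m K (face w))) = dim (Q_face m K (face w))"
      by (simp add: mult_space_def)
    then show ?thesis by (simp add: dim_Q_face[OF w] dim_tangential_space_eq[OF w v])
  qed
  have "dim (Q_space m K) = (\<Sum>w\<in>C. dim (mult_space (fbub w) (Q_face m K (face w))))"
    unfolding Q_space_sum
    by (rule dim_set_sum_direct[OF finC], erule subspace_mult_Q_face, erule fin_dim_mult_Q_face, rule indep)
  also have "\<dots> = (\<Sum>w\<in>C. dim (tangential_space m K (face v)))" by (rule sum.cong[OF refl one])
  finally show ?thesis by (simp add: card4)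
qed

lemma dim_bubble_Q_space: "dim (mult_space bub (Q_space m K)) = dim (Q_space m K)"
proof -
  obtain y where y: "bub y \<noteq> 0"
  proof -
    have "C \<noteq> {}" using card4 by auto
    from centroid_pos[OF order_refl this] obtain y where "\<forall>w\<in>C. 0 < lam w y" by blast
    then have "bub y > 0" by (auto simp: bubble_eq intro!: prod_pos)
    then show ?thesis using that[of y] by simp
  qed
  have "z = 0" if z: "z \<in> Q_space m K" and bz: "(\<lambda>x. bub x *\<^sub>R z x) = 0" for z
  proof
    fix x
    from z obtain q where q: "\<And>v. v \<in> C \<Longrightarrow> q v \<in> Q_face m K (face v)" "z = Qsum q" by (rule Q_spaceE) blast
    have p: "vpolyfun (3 + m) z" unfolding q(2) by (rule vpolyfun_Qsum[OF q(1)])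
    have "bub x' * (z x' \<bullet> z x) = 0" for x' using fun_cong[OF bz, of x'] by auto
    from polyfun_mult_eq_0[OF polyfun_bubble vpolyfunD[OF p] this y]
    have "z x \<bullet> z x = 0" .
    then show "z x = 0 x" by simp
  qed
  from dim_linear_image[OF mult_space_linear subspace_Q_space this] show ?thesis by (simp add: mult_space_def)
qed

text \<open>An element of \<open>b\<^sub>K Q\<close> has vanishing Nedelec moments.\<close>

lemma nedelec_bubble_disjoint:
  assumes k: "1 \<le> k"
  shows "nedelec k K \<inter> mult_space bub (Q_space (k - 1) K) = {0}"
proof (intro equalityI subsetI)
  fix u assume u: "u \<in> nedelec k K \<inter> mult_space bub (Q_space (k - 1) K)"
  then obtain z where z: "z \<in> Q_space (k - 1) K" "u = (\<lambda>x. bub x *\<^sub>R z x)" unfolding mult_space_def by blast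
  from z(1) obtain q where q: "\<And>v. v \<in> C \<Longrightarrow> q v \<in> Q_face (k - 1) K (face v)" "z = Qsum q" by (rule Q_spaceE) blast
  have "\<exists>t. unit_tangent e t" if e: "e edge_of K" for e
  proof -
    from e obtain a b where ab: "a \<in> C" "b \<in> C" "a \<noteq> b" "e = convex hull {a, b}" by (auto simp: edge_iff)
    then have "a \<in> e" "b \<in> e" by (auto simp: hull_inc)
    then have "unit_tangent e ((1 / norm (b - a)) *\<^sub>R (b - a))"
      unfolding unit_tangent_def using ab(3) by auto
    then show ?thesis by blast
  qed
  then obtain t where t: "\<And>e. e edge_of K \<Longrightarrow> unit_tangent e (t e)" by metis
  have "u x = 0" for x
  proof (rule nedelec_zero[where u = u and t = t, OF _ k])
    show "u \<in> nedelec k K" using u by blast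
    show "unit_tangent e (t e)" if "e edge_of K" for e by (rule t[OF that])
    show "L2_edge e (\<lambda>x. u x \<bullet> t e) \<kappa> = 0" if "e edge_of K" for e \<kappa>
    proof -
      have "L2_edge e (\<lambda>x. u x \<bullet> t e) \<kappa> = L2_edge e (\<lambda>x. 0) \<kappa>"
        by (rule L2_edge_cong[OF that]) (simp add: z(2) bubble_zero_on_edge[OF that])
      then show ?thesis by (simp add: L2_edge_def)
    qed
    show "L2_face (face v) (\<lambda>x. u x \<times> unit_normal v) \<mu> = 0" if "v \<in> C" for v \<mu>
    proof -
      have "L2_face (face v) (\<lambda>x. u x \<times> unit_normal v) \<mu> = L2_face (face v) (\<lambda>x. 0) \<mu>"
        by (rule L2_face_cong[OF that]) (simp add: z(2) bubble_zero[OF that])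
      then show ?thesis by (simp add: L2_face_def)
    qed
    show "L2_cell K u \<rho> = 0" if "vpolyfun (k - 2) \<rho>" for \<rho>
      unfolding z(2) q(2) using that by (intro bubble_interior_dof[OF q(1)]) simp_all
  qed
  then show "u \<in> {0}" by (simp add: fun_eq_iff)
next
  fix u :: "real^3 \<Rightarrow> real^3" assume "u \<in> {0}"
  moreover have "0 \<in> nedelec k K" by (rule subspace_0[OF subspace_nedelec])
  moreover have "0 \<in> mult_space bub (Q_space (k - 1) K)"
    unfolding mult_space_def using subspace_0[OF subspace_Q_space]
    by (intro image_eqI[of _ _ 0]) (auto simp: fun_eq_iff)
  ultimately show "u \<in> nedelec k K \<inter> mult_space bub (Q_space (k - 1) K)" by simp
qed

lemma dim_U_space:
  assumes k: "1 \<le> k" and v: "v \<in> C"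
  shows "dim (U_space k K) = dim (nedelec k K) + 4 * dim (tangential_space (k - 1) K (face v))"
proof -
  have "dim (U_space k K) = dim (nedelec k K) + dim (mult_space bub (Q_space (k - 1) K))"
    unfolding U_space_def
  proof (rule dim_set_plus_direct[OF subspace_nedelec fin_dim_nedelec])
    show "subspace (mult_space bub (Q_space (k - 1) K))"
      unfolding mult_space_def by (rule linear_subspace_image[OF mult_space_linear subspace_Q_space])
    show "fin_dim (mult_space bub (Q_space (k - 1) K))"
      unfolding mult_space_def by (rule fin_dim_linear_image[OF mult_space_linear fin_dim_Q_space])
  qed (use nedelec_bubble_disjoint[OF k] in blast)
  then show ?thesis by (simp add: dim_bubble_Q_space dim_Q_space[OF v])
qed

lemma subspace_U_space: "subspace (U_space k K)"
  unfolding U_space_def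
  by (rule subspace_set_plus[OF subspace_nedelec])
    (unfold mult_space_def, rule linear_subspace_image[OF mult_space_linear subspace_Q_space])

lemma U_spaceE:
  assumes "u \<in> U_space k K"
  obtains n q where "n \<in> nedelec k K" "\<And>v. v \<in> C \<Longrightarrow> q v \<in> Q_face (k - 1) K (face v)"
    "u = (\<lambda>x. n x + bub x *\<^sub>R Qsum q x)"
proof -
  from assms obtain n b where nb: "u = n + b" "n \<in> nedelec k K" "b \<in> mult_space bub (Q_space (k - 1) K)"
    unfolding U_space_def by (rule set_plus_elim)
  then obtain z where z: "z \<in> Q_space (k - 1) K" "b = (\<lambda>x. bub x *\<^sub>R z x)" unfolding mult_space_def by blast
  from z(1) obtain q where q: "\<And>v. v \<in> C \<Longrightarrow> q v \<in> Q_face (k - 1) K (face v)" "z = Qsum q" by (rule Q_spaceE) blast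
  have "u = (\<lambda>x. n x + bub x *\<^sub>R Qsum q x)" by (rule ext) (simp add: nb(1) z(2) q(2))
  with nb(2) q(1) show ?thesis by (rule that)
qed

text \<open>The bubble part does not contribute to the Nedelec moments, so the Nedelec part vanishes; then the
  curl moments control the bubble part.\<close>

lemma U_space_zero:
  assumes "u \<in> U_space k K" and k: "1 \<le> k" and t: "\<And>e. e edge_of K \<Longrightarrow> unit_tangent e (t e)"
    and edge: "\<And>e \<kappa>. e edge_of K \<Longrightarrow> \<kappa> \<in> poly_space k e \<Longrightarrow> L2_edge e (\<lambda>x. u x \<bullet> t e) \<kappa> = 0"
    and face: "\<And>v \<mu>. v \<in> C \<Longrightarrow> \<mu> \<in> tangential_space (k - 1) K (face v) \<Longrightarrow>
      L2_face (face v) (\<lambda>x. u x \<times> unit_normal v) \<mu> = 0"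
    and curl: "\<And>v \<zeta>. v \<in> C \<Longrightarrow> \<zeta> \<in> tangential_space (k - 1) K (face v) \<Longrightarrow>
      L2_face (face v) (\<lambda>x. curl u x \<times> unit_normal v) \<zeta> = 0"
    and inner: "\<And>\<rho>. vpolyfun (k - 2) \<rho> \<Longrightarrow> L2_cell K u \<rho> = 0"
  shows "u = 0"
proof -
  from assms(1) obtain n q where n: "n \<in> nedelec k K" and q: "\<And>v. v \<in> C \<Longrightarrow> q v \<in> Q_face (k - 1) K (face v)"
    and u: "u = (\<lambda>x. n x + bub x *\<^sub>R Qsum q x)" by (rule U_spaceE) blast
  let ?b = "\<lambda>x. bub x *\<^sub>R Qsum q x"
  note bp = vpolyfun_scaleR[OF polyfun_bubble vpolyfun_Qsum[OF q]]
  note np = nedelec_degrees(1)[OF n]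
  have up: "vpolyfun (max (k + 1) (4 + (3 + (k - 1)))) u"
    unfolding u by (intro vpolyfun_add vpolyfun_mono[OF np] vpolyfun_mono[OF bp]) auto
  have "n x = 0" for x
  proof (rule nedelec_zero[where t = t, OF n k])
    show "unit_tangent e (t e)" if "e edge_of K" for e by (rule t[OF that])
  next
    fix e \<kappa> assume e: "e edge_of K" and \<kappa>: "\<kappa> \<in> poly_space k e"
    have "L2_edge e (\<lambda>x. n x \<bullet> t e) \<kappa> = L2_edge e (\<lambda>x. u x \<bullet> t e) \<kappa>"
      by (rule L2_edge_cong[OF e]) (simp add: u bubble_zero_on_edge[OF e])
    then show "L2_edge e (\<lambda>x. n x \<bullet> t e) \<kappa> = 0" using edge[OF e \<kappa>] by simp
  next
    fix v \<mu> assume v: "v \<in> C" and \<mu>: "\<mu> \<in> tangential_space (k - 1) K (face v)"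
    have "L2_face (face v) (\<lambda>x. n x \<times> unit_normal v) \<mu> = L2_face (face v) (\<lambda>x. u x \<times> unit_normal v) \<mu>"
      by (rule L2_face_cong[OF v]) (simp add: u bubble_zero[OF v])
    then show "L2_face (face v) (\<lambda>x. n x \<times> unit_normal v) \<mu> = 0" using face[OF v \<mu>] by simp
  next
    fix \<rho> :: "real^3 \<Rightarrow> real^3" assume \<rho>: "vpolyfun (k - 2) \<rho>"
    have "n = (\<lambda>x. u x - ?b x)" by (rule ext) (simp add: u)
    then have "L2_cell K n \<rho> = L2_cell K u \<rho> - L2_cell K ?b \<rho>"
      using L2_cell_diff[OF up bp \<rho>] by (simp only:)
    also have "L2_cell K ?b \<rho> = 0" using \<rho> by (intro bubble_interior_dof[OF q]) simp_all
    finally show "L2_cell K n \<rho> = 0" using inner[OF \<rho>] by simp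
  qed
  then have ub: "u = ?b" by (simp add: u)
  have q0: "q v = 0" if v: "v \<in> C" for v
    by (rule curl_dof_zero[OF q v]) (use curl[OF v] ub in simp_all)
  then have "Qsum q x = 0" for x by (simp add: Qsum_def)
  then show "u = 0" by (simp add: ub fun_eq_iff)
qed

lemma U_space_unisolvent:
  assumes u: "u \<in> U_space k K" and w: "w \<in> U_space k K" and k: "1 \<le> k"
    and t: "\<And>e. e edge_of K \<Longrightarrow> unit_tangent e (t e)"
    and edge: "\<And>e \<kappa>. e edge_of K \<Longrightarrow> \<kappa> \<in> poly_space k e \<Longrightarrow>
      L2_edge e (\<lambda>x. u x \<bullet> t e) \<kappa> = L2_edge e (\<lambda>x. w x \<bullet> t e) \<kappa>"
    and face: "\<And>v \<mu>. v \<in> C \<Longrightarrow> \<mu> \<in> tangential_space (k - 1) K (face v) \<Longrightarrow>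
      L2_face (face v) (\<lambda>x. u x \<times> unit_normal v) \<mu> = L2_face (face v) (\<lambda>x. w x \<times> unit_normal v) \<mu>"
    and curl: "\<And>v \<zeta>. v \<in> C \<Longrightarrow> \<zeta> \<in> tangential_space (k - 1) K (face v) \<Longrightarrow>
      L2_face (face v) (\<lambda>x. curl u x \<times> unit_normal v) \<zeta> = L2_face (face v) (\<lambda>x. curl w x \<times> unit_normal v) \<zeta>"
    and inner: "\<And>\<rho>. vpolyfun (k - 2) \<rho> \<Longrightarrow> L2_cell K u \<rho> = L2_cell K w \<rho>"
  shows "u = w"
proof -
  have poly: "\<exists>m. vpolyfun m f" if f: "f \<in> U_space k K" for f
  proof -
    from f obtain n q where n: "n \<in> nedelec k K" and q: "\<And>v. v \<in> C \<Longrightarrow> q v \<in> Q_face (k - 1) K (face v)"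
      and f: "f = (\<lambda>x. n x + bub x *\<^sub>R Qsum q x)" by (rule U_spaceE) blast
    have "vpolyfun (max (k + 1) (4 + (3 + (k - 1)))) f"
      unfolding f by (intro vpolyfun_add vpolyfun_mono[OF nedelec_degrees(1)[OF n]]
          vpolyfun_mono[OF vpolyfun_scaleR[OF polyfun_bubble vpolyfun_Qsum[OF q]]]) auto
    then show ?thesis by blast
  qed
  obtain m where up: "vpolyfun m u" using poly[OF u] by blast
  obtain l where wp: "vpolyfun l w" using poly[OF w] by blast
  define d where "d = (\<lambda>x. u x - w x)"
  have "d = u - w" by (rule ext) (simp add: d_def)
  then have dU: "d \<in> U_space k K" using subspace_diff[OF subspace_U_space u w] by simp
  have cont: "continuous_on UNIV (\<lambda>x. f x \<times> unit_normal v)" "continuous_on UNIV (\<lambda>x. f x \<bullet> a)" if "vpolyfun m f" for m f v a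
    using vpolyfun_continuous[OF that] by (auto intro!: continuous_intros continuous_on_cross)
  have "d = 0"
  proof (rule U_space_zero[where t = t, OF dU k])
    show "unit_tangent e (t e)" if "e edge_of K" for e by (rule t[OF that])
  next
    fix e \<kappa> assume e: "e edge_of K" and \<kappa>: "\<kappa> \<in> poly_space k e"
    show "L2_edge e (\<lambda>x. d x \<bullet> t e) \<kappa> = 0"
      using L2_edge_diff[OF e cont(2)[OF up] cont(2)[OF wp] \<kappa>] edge[OF e \<kappa>]
      by (simp add: d_def inner_diff_left)
  next
    fix v \<mu> assume v: "v \<in> C" and \<mu>: "\<mu> \<in> tangential_space (k - 1) K (face v)"
    show "L2_face (face v) (\<lambda>x. d x \<times> unit_normal v) \<mu> = 0"
      using L2_face_diff[OF v cont(1)[OF up] cont(1)[OF wp] \<mu>] face[OF v \<mu>]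
      by (simp add: d_def Cross3.left_diff_distrib)
    have "curl d = (\<lambda>x. rot u x - rot w x)"
    proof
      fix x
      have "curl d x = rot d x"
        unfolding d_def by (rule curl_eq_rot[of "max m l"], rule vpolyfun_diff)
          (auto intro: vpolyfun_mono[OF up] vpolyfun_mono[OF wp])
      also have "\<dots> = rot u x - rot w x"
        by (simp add: rot_def d_def vec_eq_iff forall_3 pd_diff[OF vpolyfun_nth[OF up] vpolyfun_nth[OF wp]])
      finally show "curl d x = rot u x - rot w x" .
    qed
    then show "L2_face (face v) (\<lambda>x. curl d x \<times> unit_normal v) \<mu> = 0"
      using L2_face_diff[OF v cont(1)[OF vpolyfun_rot[OF up]] cont(1)[OF vpolyfun_rot[OF wp]] \<mu>] curl[OF v \<mu>]
      by (simp add: curl_eq_rot[OF up] curl_eq_rot[OF wp] Cross3.left_diff_distrib)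
  next
    fix \<rho> :: "real^3 \<Rightarrow> real^3" assume \<rho>: "vpolyfun (k - 2) \<rho>"
    show "L2_cell K d \<rho> = 0"
      unfolding d_def using L2_cell_diff[OF up wp \<rho>] inner[OF \<rho>] by simp
  qed
  then show ?thesis by (simp add: d_def fun_eq_iff)
qed

end

theorem theorem3p1:
  fixes K :: "(real^3) set" and k :: int and t :: "(real^3) set \<Rightarrow> real^3"
  assumes "3 simplex K" and "k \<ge> 1"
    and "\<And>e. e edge_of K \<Longrightarrow> unit_tangent e (t e)"
  shows "(U_space k K = nedelec k K + mult_space (bubble K) (Q_space (k - 1) K) \<and>
      nedelec k K \<inter> mult_space (bubble K) (Q_space (k - 1) K) = {0}) \<and>
    (\<forall>F. F facet_of K \<longrightarrow>
      dim (U_space k K) = dim (nedelec k K) + 4 * dim (tangential_space (k - 1) K F)) \<and>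
    (\<forall>u \<in> U_space k K. \<forall>v \<in> U_space k K.
      (\<forall>e. e edge_of K \<longrightarrow> (\<forall>\<kappa> \<in> poly_space k e.
        L2_edge e (\<lambda>x. u x \<bullet> t e) \<kappa> = L2_edge e (\<lambda>x. v x \<bullet> t e) \<kappa>)) \<and>
      (\<forall>F. F facet_of K \<longrightarrow> (\<forall>\<mu> \<in> tangential_space (k - 1) K F.
        L2_face F (\<lambda>x. cross3 (u x) (outward_normal K F)) \<mu> =
        L2_face F (\<lambda>x. cross3 (v x) (outward_normal K F)) \<mu>)) \<and>
      (\<forall>F. F facet_of K \<longrightarrow> (\<forall>\<zeta> \<in> tangential_space (k - 1) K F.
        L2_face F (\<lambda>x. cross3 (curl u x) (outward_normal K F)) \<zeta> =
        L2_face F (\<lambda>x. cross3 (curl v x) (outward_normal K F)) \<zeta>)) \<and>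
      (\<forall>\<rho> \<in> vpoly_space (k - 2) K. L2_cell K u \<rho> = L2_cell K v \<rho>)
      \<longrightarrow> u = v)"
proof -
  from assms(1) obtain C where C: "\<not> affine_dependent C" "int (card C) = 3 + 1" "K = convex hull C"
    unfolding simplex_def by blast
  interpret tetra C by unfold_locales (use C in auto)
  have K: "K = convex hull C" by (rule C(3))
  have KK: "tetra.K C = K" unfolding K_def K ..
  note rules = nedelec_bubble_disjoint[OF assms(2), unfolded KK] dim_U_space[OF assms(2), unfolded KK]
    facet_iff[unfolded KK] vpoly_space_K[unfolded KK] unit_normal_def[unfolded KK]
  have facet: "face w facet_of K" if "w \<in> C" for w using that rules(3) by blast
  show ?thesis
  proof (intro conjI allI impI ballI, goal_cases)
    case 1
    show ?case by (rule U_space_def)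
  next
    case 2
    show ?case by (rule rules(1))
  next
    case (3 F)
    then obtain w where w: "w \<in> C" "F = face w" unfolding rules(3) by blast
    show ?case unfolding w(2) by (rule rules(2)[OF w(1)])
  next
    case (4 u v)
    note dof = 4(3)
    show ?case
    proof (rule U_space_unisolvent[unfolded KK rules(5), where t = t, OF 4(1,2) assms(2)])
      show "unit_tangent e (t e)" if "e edge_of K" for e by (rule assms(3)[OF that])
      show "L2_edge e (\<lambda>x. u x \<bullet> t e) \<kappa> = L2_edge e (\<lambda>x. v x \<bullet> t e) \<kappa>"
        if "e edge_of K" "\<kappa> \<in> poly_space k e" for e \<kappa>
        using dof that by blast
      show "L2_cell K u \<rho> = L2_cell K v \<rho>" if "vpolyfun (k - 2) \<rho>" for \<rho>
        using dof that unfolding rules(4) by blast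
    next
      fix w \<mu> assume "w \<in> C" "\<mu> \<in> tangential_space (k - 1) K (face w)"
      with dof facet show "L2_face (face w) (\<lambda>x. cross3 (u x) (outward_normal K (face w))) \<mu> =
          L2_face (face w) (\<lambda>x. cross3 (v x) (outward_normal K (face w))) \<mu>"
        "L2_face (face w) (\<lambda>x. cross3 (curl u x) (outward_normal K (face w))) \<mu> =
          L2_face (face w) (\<lambda>x. cross3 (curl v x) (outward_normal K (face w))) \<mu>"
        by blast+
    qed
  qed
qed

end
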